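(* Let $a>0$ and $R\in\{0,1,2,\dots\}$, with $a\neq N+\tfrac12$ for every integer $N$ with $N-R$ even. Then $$U_R^{(0,2)}(-a,z)=\tfrac12\left\{U_R^{(0,1)}(-a,z)+U_R^{(0,3)}(-a,z)\right\}+\lambda_R(a)\,U(-a,z),$$ where $$\lambda_R(a)=-\left\{\tan(\pi a)+(-1)^R\sec(\pi a)\right\}2^{-\frac12a+\frac32R-\frac14}\,\pi\,\mathbf F\left(\tfrac12-\tfrac12R,-\tfrac12R;\tfrac12a-\tfrac12R+\tfrac34;\tfrac12\right).$$
   Context: $U(a,z)$ is the parabolic cylinder function: the solution of $y''-(\tfrac14z^2+a)y=0$ with $U(a,z)\sim z^{-a-1/2}e^{-z^2/4}$ as $z\to\infty$, $|\arg z|\le\frac34\pi-\delta$. Put $U_j(a,z)=U((-1)^ja,(-i)^jz)$, $j=0,1,2,3$, and for $j<k$ $$U_R^{(j,k)}(a,z)=\frac{1}{\mathscr W\{U_j(a,z),U_k(a,z)\}}\left[U_k(a,z)\int_{i^j\infty}^zt^RU_j(a,t)dt-U_j(a,z)\int_{i^k\infty}^zt^RU_k(a,t)dt\right]$$ ($\mathscr W$ the Wronskian), a particular solution of $y''-(\frac14z^2+a)y=z^R$. At parameter values where $a=N+\tfrac12$ with $N-R$ odd, $U_R^{(0,2)}(-a,z)$ and $\tan(\pi a)+(-1)^R\sec(\pi a)$ have removable singularities and are understood as limits. $\mathbf{F}(a,b;c;z)=\sum_{s\ge0}\frac{(a)_s(b)_sz^s}{\Gamma(c+s)s!}$. *)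

theory Defs
  imports "HOL-Complex_Analysis.Complex_Analysis" "HOL-Library.Landau_Symbols"
begin

text \<open>
  The asymptotic condition is \<open>y z ~ z powr (- a - 1/2) * exp (- z^2/4)\<close> as \<open>z \<rightarrow> \<infinity>\<close> inside the closed
  sector \<open>\<bar>arg z\<bar> \<le> 3\<pi>/4 - \<delta>\<close>, for each \<open>\<delta> > 0\<close>; \<open>powr\<close> is the principal branch. On the
  positive real axis the condition forces \<open>y\<close> to be recessive, so it determines \<open>y\<close> uniquely.
\<close>

definition is_parabolic_cylinder_U :: "complex \<Rightarrow> (complex \<Rightarrow> complex) \<Rightarrow> bool" where
  "is_parabolic_cylinder_U a y \<longleftrightarrow>
     y holomorphic_on UNIV \<and>
     (\<forall>z. deriv (deriv y) z - (z\<^sup>2 / 4 + a) * y z = 0) \<and>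
     (\<forall>\<delta>>0. asymp_equiv y
        (inf at_infinity (principal {z. z \<noteq> 0 \<and> \<bar>Arg z\<bar> \<le> 3 * pi / 4 - \<delta>}))
        (\<lambda>z. z powr (- a - 1/2) * exp (- z\<^sup>2 / 4)))"

definition parabolic_cylinder_U :: "complex \<Rightarrow> complex \<Rightarrow> complex" where
  "parabolic_cylinder_U a = (THE y. is_parabolic_cylinder_U a y)"

definition U_sol :: "nat \<Rightarrow> complex \<Rightarrow> complex \<Rightarrow> complex" where
  "U_sol j a z = parabolic_cylinder_U ((-1) ^ j * a) ((- \<i>) ^ j * z)"

definition wronskian :: "(complex \<Rightarrow> complex) \<Rightarrow> (complex \<Rightarrow> complex) \<Rightarrow> complex \<Rightarrow> complex" where
  "wronskian f g z = f z * deriv g z - deriv f z * g z"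

text \<open>\<open>int_from_inf d f z\<close> is the integral of \<open>f\<close> from \<open>d\<infinity>\<close> to \<open>z\<close>. It is used for entire \<open>f\<close>
  decaying exponentially in a sector about the direction \<open>d\<close>.\<close>

definition int_from_inf :: "complex \<Rightarrow> (complex \<Rightarrow> complex) \<Rightarrow> complex \<Rightarrow> complex" where
  "int_from_inf d f z =
     Lim at_top (\<lambda>r::real. contour_integral (linepath (of_real r * d) z) f)"

text \<open>\<open>U_inhom j k R a\<close> is \<open>U_R^(j,k)(a, \<cdot>)\<close>. The Wronskian does not depend on the point at which
  it is evaluated.\<close>

definition U_inhom :: "nat \<Rightarrow> nat \<Rightarrow> nat \<Rightarrow> complex \<Rightarrow> complex \<Rightarrow> complex" where
  "U_inhom j k R a z =
     1 / wronskian (U_sol j a) (U_sol k a) z *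
       (U_sol k a z * int_from_inf (\<i> ^ j) (\<lambda>t. t ^ R * U_sol j a t) z
        - U_sol j a z * int_from_inf (\<i> ^ k) (\<lambda>t. t ^ R * U_sol k a t) z)"

text \<open>The parameter values \<open>a = N + 1/2\<close> with \<open>N - R\<close> odd, at which the singularities are removable.\<close>

definition removable_param :: "nat \<Rightarrow> real \<Rightarrow> bool" where
  "removable_param R a \<longleftrightarrow> (\<exists>N::int. a = of_int N + 1/2 \<and> odd (N - int R))"

text \<open>\<open>U_inhom02_neg R a z\<close> is \<open>U_R^(0,2)(-a, z)\<close>, with the limiting value at removable parameters.\<close>

definition U_inhom02_neg :: "nat \<Rightarrow> real \<Rightarrow> complex \<Rightarrow> complex" where
  "U_inhom02_neg R a z =
     (if removable_param R a
      then Lim (at a) (\<lambda>b. U_inhom 0 2 R (- complex_of_real b) z)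
      else U_inhom 0 2 R (- complex_of_real a) z)"

definition tan_sec :: "nat \<Rightarrow> real \<Rightarrow> real" where
  "tan_sec R a =
     (if removable_param R a
      then Lim (at a) (\<lambda>b. tan (pi * b) + (-1) ^ R * (1 / cos (pi * b)))
      else tan (pi * a) + (-1) ^ R * (1 / cos (pi * a)))"

text \<open>\<open>1/\<Gamma>\<close> is the entire function \<open>rGamma\<close>, which vanishes at the poles of \<open>\<Gamma>\<close>.\<close>

definition hyperF_reg :: "'a::Gamma \<Rightarrow> 'a \<Rightarrow> 'a \<Rightarrow> 'a \<Rightarrow> 'a" where
  "hyperF_reg a b c z =
     (\<Sum>s. pochhammer a s * pochhammer b s * z ^ s * rGamma (c + of_nat s) / fact s)"

definition lambda_coeff :: "nat \<Rightarrow> real \<Rightarrow> real" where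
  "lambda_coeff R a =
     - tan_sec R a * 2 powr (- a / 2 + 3 / 2 * real R - 1 / 4) * pi *
       hyperF_reg (1/2 - real R / 2) (- real R / 2) (a / 2 - real R / 2 + 3 / 4) (1/2)"

end

theory Submission
  imports Defs
begin

text \<open>
  \<open>U(a, z) = exp (-z\<^sup>2/4) D\<^sub>\<nu>(z)\<close> with \<open>\<nu> = a + 1/2\<close>, where the entire function \<open>D\<^sub>\<nu>\<close> is given by a power series with
  coefficients built from the values \<open>U(a, 0)\<close>. For \<open>\<nu> > 0\<close> it is a Laplace integral along any ray \<open>arg t = \<phi>\<close>,
  \<open>\<bar>\<phi>\<bar> < \<pi>/4\<close>, and rotating the ray gives the asymptotics in \<open>\<bar>arg z\<bar> < 3\<pi>/4\<close>; the recurrence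
  \<open>U(a-1) = z U(a) + (a + 1/2) U(a+1)\<close> extends this to all real \<open>a\<close>.

  Three solutions of a second order equation satisfy \<open>W\<^sub>1\<^sub>2 U\<^sub>0 + W\<^sub>2\<^sub>0 U\<^sub>1 + W\<^sub>0\<^sub>1 U\<^sub>2 = 0\<close>, and so do their primitives from \<open>0\<close>.
  Hence the difference of two of the inhomogeneous solutions is a multiple of \<open>U\<^sub>0\<close>, with a factor that is a
  combination of the half-line moments \<open>M\<^sub>R(\<plusminus>a)\<close>, \<open>M\<^sub>R(a) = \<integral>\<^sub>0\<^sup>\<infinity> t\<^sup>R U(a, t) dt\<close>. The moments themselves
  are incomplete Beta integrals, but in the required combination of \<open>M\<^sub>0(a)\<close> and \<open>M\<^sub>0(-a)\<close> they add up to a complete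
  one, and the recurrences in \<open>R\<close> and \<open>a\<close> reduce the general case to this one and match the
  three-term recurrence of the terminating hypergeometric sum. The removable parameters follow by continuity in \<open>a\<close>.
\<close>

subsection \<open>Gamma function identities and the power series\<close>

text \<open>The power series comes first because the Laplace integral diverges for \<nu> \<le> 0,
  while the theorem needs parameters of both signs. Coefficients built from 1/\<Gamma> have no
  poles, so recurrences can carry facts from \<nu> > 0 to all real \<nu>. The coefficient of U_0 is
  split into a tangent and a combination of moments in order to isolate the singularity. The
  Wronskian of U_0 and U_2 is a multiple of 1/\<Gamma>(1/2 - a); by reflection, dividing by it
  amounts to dividing by cos(\<pi> a). The quotient is absorbed by tan + sec, which is the tangent
  of a half angle and regular at the removable parameters. What remains is continuous for all real
  a. The end point 1/2 of the incomplete Beta integrals is the image of t = 0. The reflection u to 1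
  - u exchanges the parameters a and 2 - a, so M_0(-a) has to be moved to 2 - a before the two
  pieces fit together.\<close>

lemma rGamma_reflection_real: "rGamma x * rGamma (1 - x) = sin (pi * x) / (pi::real)"
proof -
  have "complex_of_real (Gamma x * Gamma (1 - x)) = complex_of_real (pi / sin (pi * x))"
    using Gamma_reflection_complex[of "complex_of_real x"] Gamma_complex_of_real[of "1 - x"]
      sin_of_real[of "pi * x", where 'a = complex]
    by (simp add: Gamma_complex_of_real)
  then have "Gamma x * Gamma (1 - x) = pi / sin (pi * x)"
    by (simp only: of_real_eq_iff)
  then have "inverse (Gamma x * Gamma (1 - x)) = inverse (pi / sin (pi * x))" by simp
  then show ?thesis by (simp add: rGamma_inverse_Gamma)
qed

text \<open>The reciprocal form extends the classical formula across the poles: if \<open>y\<close>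
  or \<open>y + 1/2\<close> is a non-positive integer, so is \<open>2 * y\<close>, and both sides
  vanish.\<close>

lemma rGamma_legendre_duplication_real:
  fixes y :: real
  shows "rGamma y * rGamma (y + 1/2) = 2 powr (2*y - 1) * rGamma (2*y) / sqrt pi"
proof (cases "y \<in> \<int>\<^sub>\<le>\<^sub>0 \<or> y + 1/2 \<in> \<int>\<^sub>\<le>\<^sub>0")
  case True
  then have "2 * y \<in> \<int>\<^sub>\<le>\<^sub>0"
  proof
    assume "y \<in> \<int>\<^sub>\<le>\<^sub>0"
    then obtain n :: int where n: "y = of_int n" "n \<le> 0" by (auto simp: nonpos_Ints_def)
    then have "2 * y = of_int (2 * n)" "2 * n \<le> 0" by auto
    then show ?thesis by (simp only: nonpos_Ints_of_int)
  next
    assume "y + 1/2 \<in> \<int>\<^sub>\<le>\<^sub>0"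
    then obtain n :: int where n: "y + 1/2 = of_int n" "n \<le> 0" by (auto simp: nonpos_Ints_def)
    then have "2 * y = of_int (2 * n - 1)" "2 * n - 1 \<le> 0" by auto
    then show ?thesis by (simp only: nonpos_Ints_of_int)
  qed
  then show ?thesis using True by (auto simp: rGamma_nonpos_Int)
next
  case False
  then have "complex_of_real y \<notin> \<int>\<^sub>\<le>\<^sub>0" "complex_of_real y + 1/2 \<notin> \<int>\<^sub>\<le>\<^sub>0"
    using of_real_in_nonpos_Ints_iff[of "y + 1/2", where 'a = complex]
      of_real_in_nonpos_Ints_iff[of y, where 'a = complex] by auto
  from Gamma_legendre_duplication[OF this]
  have "complex_of_real (Gamma y * Gamma (y + 1/2)) = of_real (exp ((1 - 2*y) * ln 2) * sqrt pi * Gamma (2*y))"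
    using Gamma_complex_of_real[of "y + 1/2"] Gamma_complex_of_real[of "2*y"]
      exp_of_real[of "(1 - 2*y) * ln 2", where 'a = complex]
    by (simp add: Gamma_complex_of_real)
  then have "Gamma y * Gamma (y + 1/2) = exp ((1 - 2*y) * ln 2) * sqrt pi * Gamma (2*y)"
    by (simp only: of_real_eq_iff)
  then have "inverse (Gamma y * Gamma (y + 1/2)) = inverse (2 powr (1 - 2*y) * sqrt pi * Gamma (2*y))"
    by (simp add: powr_def)
  then show ?thesis
    by (simp add: rGamma_inverse_Gamma field_simps powr_diff)
qed

text \<open>\<open>pcf_h \<nu>\<close> is the value \<open>U(a, 0)\<close> at \<open>\<nu> = a + 1/2\<close>.\<close>

definition pcf_h :: "real \<Rightarrow> real" where
  "pcf_h \<nu> = sqrt pi * 2 powr (- \<nu> / 2) * rGamma ((\<nu> + 1) / 2)"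

text \<open>The recurrence of U in its parameter, taken at the origin, where the term with the
  factor z drops out.\<close>

lemma pcf_h_rec: "pcf_h (\<nu> - 1) = \<nu> * pcf_h (\<nu> + 1)"
proof -
  have "rGamma (\<nu> / 2) = \<nu> / 2 * rGamma (\<nu> / 2 + 1)" by (rule rGamma_plus1[symmetric])
  moreover have "2 powr (- (\<nu> - 1) / 2) = 2 * 2 powr (- (\<nu> + 1) / 2)"
  proof -
    have "2 powr (- (\<nu> - 1) / 2) = 2 powr (1 + (- (\<nu> + 1) / 2))" by (simp add: field_simps)
    then show ?thesis by (simp only: powr_add) simp
  qed
  moreover have "(\<nu> + 1 + 1) / 2 = \<nu> / 2 + 1" "(\<nu> - 1 + 1) / 2 = \<nu> / 2" by simp_all
  ultimately show ?thesis unfolding pcf_h_def by (simp only:) simp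
qed

lemma continuous_on_pcf_h [continuous_intros]:
  assumes "continuous_on S f" shows "continuous_on S (\<lambda>x. pcf_h (f x))"
proof -
  have "continuous_on UNIV pcf_h"
    unfolding pcf_h_def by (intro continuous_intros continuous_on_compose2[OF continuous_on_rGamma[of UNIV]]) auto
  then show ?thesis using assms by (rule continuous_on_compose2) auto
qed

text \<open>\<open>(-1) ^ k * pcf_coeff \<nu> k\<close> is the k-th derivative at 0 of the solution
  of D'' = z D' + \<nu> D; the last clause is this equation read off at the origin.\<close>

fun pcf_coeff :: "real \<Rightarrow> nat \<Rightarrow> real" where
  "pcf_coeff \<nu> 0 = pcf_h \<nu>"
| "pcf_coeff \<nu> (Suc 0) = pcf_h (\<nu> - 1)"
| "pcf_coeff \<nu> (Suc (Suc k)) = (\<nu> + real k) * pcf_coeff \<nu> k"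

text \<open>\<open>pcf_D \<nu>\<close> is \<open>z \<mapsto> exp (z\<^sup>2 / 4) * U(a, z)\<close> with \<open>\<nu> = a + 1/2\<close>.\<close>

definition pcf_D :: "real \<Rightarrow> 'a \<Rightarrow> 'a::{real_normed_field,banach}" where
  "pcf_D \<nu> z = (\<Sum>k. of_real ((-1) ^ k * pcf_coeff \<nu> k / fact k) * z ^ k)"

definition pcf_bound :: "real \<Rightarrow> real" where
  "pcf_bound \<nu> = \<bar>pcf_h \<nu>\<bar> + \<bar>pcf_h (\<nu> - 1)\<bar>"

text \<open>The recurrence jumps two indices and multiplies by about k, so the growth is that of the
  square root of k!, which division by k! beats. The dependence on \<nu> is explicit and continuous,
  as joint continuity requires.\<close>

lemma pcf_coeff_bound:
  "\<bar>pcf_coeff \<nu> k\<bar> \<le> pcf_bound \<nu> * sqrt (\<bar>\<nu>\<bar> + 1) ^ k * sqrt (fact k)"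
proof (induction \<nu> k rule: pcf_coeff.induct)
  case (1 \<nu>) then show ?case by (simp add: pcf_bound_def)
next
  case (2 \<nu>)
  have "\<bar>pcf_h (\<nu> - 1)\<bar> \<le> pcf_bound \<nu> * 1" by (simp add: pcf_bound_def)
  also have "\<dots> \<le> pcf_bound \<nu> * sqrt (\<bar>\<nu>\<bar> + 1)"
    by (intro mult_left_mono) (auto simp: pcf_bound_def)
  finally show ?case by simp
next
  case (3 \<nu> k)
  have "\<bar>\<nu> + real k\<bar> \<le> (\<bar>\<nu>\<bar> + 1) * real (Suc k)"
  proof -
    have "0 \<le> \<bar>\<nu>\<bar> * real k" by simp
    moreover have "(\<bar>\<nu>\<bar> + 1) * real (Suc k) = \<bar>\<nu>\<bar> * real k + \<bar>\<nu>\<bar> + real k + 1" by (simp add: algebra_simps)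
    ultimately show ?thesis by linarith
  qed
  moreover have "real (Suc k) \<le> sqrt (real (Suc (Suc k)) * real (Suc k))"
  proof (rule real_le_rsqrt)
    show "(real (Suc k))\<^sup>2 \<le> real (Suc (Suc k)) * real (Suc k)" by (simp add: power2_eq_square algebra_simps)
  qed
  ultimately have "\<bar>\<nu> + real k\<bar> \<le> (\<bar>\<nu>\<bar> + 1) * sqrt (real (Suc (Suc k)) * real (Suc k))"
    by (smt (verit) mult_left_mono abs_ge_zero)
  then have "\<bar>\<nu> + real k\<bar> * \<bar>pcf_coeff \<nu> k\<bar> \<le> ((\<bar>\<nu>\<bar> + 1) * sqrt (real (Suc (Suc k)) * real (Suc k))) *
      (pcf_bound \<nu> * sqrt (\<bar>\<nu>\<bar> + 1) ^ k * sqrt (fact k))"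
    using 3 by (intro mult_mono) auto
  also have "\<dots> = pcf_bound \<nu> * ((sqrt (\<bar>\<nu>\<bar> + 1) * sqrt (\<bar>\<nu>\<bar> + 1)) * sqrt (\<bar>\<nu>\<bar> + 1) ^ k) *
      (sqrt (real (Suc (Suc k))) * sqrt (real (Suc k)) * sqrt (fact k))"
    by (simp add: real_sqrt_mult del: of_nat_Suc)
  also have "\<dots> = pcf_bound \<nu> * sqrt (\<bar>\<nu>\<bar> + 1) ^ Suc (Suc k) * sqrt (fact (Suc (Suc k)))"
    by (simp add: real_sqrt_mult del: of_nat_Suc real_sqrt_mult_self)
  finally show ?case by (simp add: abs_mult)
qed

lemma summable_power_over_sqrt_fact: "summable (\<lambda>k. x ^ k / sqrt (fact k) :: real)"
proof -
  obtain N :: nat where N: "real N \<ge> 4 * x\<^sup>2" using real_arch_simple by blast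
  show ?thesis
  proof (rule summable_ratio_test[of "1/2" N])
    fix n assume "n \<ge> N"
    then have "4 * x\<^sup>2 \<le> real (Suc n)" using N by simp
    then have "sqrt (4 * x\<^sup>2) \<le> sqrt (real (Suc n))" by (rule real_sqrt_le_mono)
    then have "2 * \<bar>x\<bar> \<le> sqrt (real (Suc n))" by (simp add: real_sqrt_mult)
    then have "\<bar>x\<bar> / sqrt (real (Suc n)) \<le> 1/2" by (simp add: field_simps del: of_nat_Suc)
    moreover have "norm (x ^ Suc n / sqrt (fact (Suc n))) = \<bar>x\<bar> / sqrt (real (Suc n)) * norm (x ^ n / sqrt (fact n))"
      by (simp add: real_sqrt_mult abs_mult power_abs del: of_nat_Suc)
    ultimately show "norm (x ^ Suc n / sqrt (fact (Suc n))) \<le> 1/2 * norm (x ^ n / sqrt (fact n))"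
      by (metis mult_right_mono norm_ge_zero)
  qed simp
qed

text \<open>With \<open>C\<close>, \<open>A\<close>, \<open>B\<close> in place of the actual values,
  one majorant serves a whole neighbourhood of a point (\<nu>, z).\<close>

lemma pcf_term_bound:
  fixes z :: "'a::{real_normed_field,banach}"
  assumes "pcf_bound \<nu> \<le> C" "\<bar>\<nu>\<bar> \<le> A" "norm z \<le> B"
  shows "norm (of_real ((-1) ^ k * pcf_coeff \<nu> k / fact k) * z ^ k) \<le>
           C * ((sqrt (A + 1) * B) ^ k / sqrt (fact k))"
proof -
  have C: "0 \<le> pcf_bound \<nu>" by (simp add: pcf_bound_def)
  have f: "sqrt (fact k) / fact k = 1 / sqrt (fact k :: real)"
    by (simp add: sqrt_divide_self_eq inverse_eq_divide)
  have "norm (of_real ((-1) ^ k * pcf_coeff \<nu> k / fact k) * z ^ k) = \<bar>pcf_coeff \<nu> k\<bar> / fact k * norm z ^ k"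
    by (simp add: norm_mult norm_power abs_mult power_abs norm_divide)
  also have "\<dots> \<le> (pcf_bound \<nu> * sqrt (\<bar>\<nu>\<bar> + 1) ^ k * sqrt (fact k)) / fact k * B ^ k"
    using assms by (intro mult_mono divide_right_mono pcf_coeff_bound power_mono) (auto simp: C)
  also have "\<dots> = pcf_bound \<nu> * (sqrt (\<bar>\<nu>\<bar> + 1) ^ k * B ^ k * (sqrt (fact k) / fact k))"
    by simp
  also have "\<dots> \<le> C * (sqrt (A + 1) ^ k * B ^ k * (sqrt (fact k) / fact k))"
  proof -
    have "0 \<le> B" using assms(3) norm_ge_zero[of z] by linarith
    then show ?thesis using assms C by (intro mult_mono power_mono mult_right_mono) auto
  qed
  finally show ?thesis unfolding f by (simp add: power_mult_distrib)
qed

lemma summable_pcf: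
  fixes z :: "'a::{real_normed_field,banach}"
  shows "summable (\<lambda>k. of_real ((-1) ^ k * pcf_coeff \<nu> k / fact k) * z ^ k)"
  by (rule summable_comparison_test'[OF summable_mult[OF summable_power_over_sqrt_fact] pcf_term_bound])
    (rule order_refl)+

lemma pcf_coeff_Suc: "pcf_coeff \<nu> (Suc k) = \<nu> * pcf_coeff (\<nu> + 1) k"
proof -
  \<comment> \<open>Two consecutive indices are carried together because the defining recurrence has
    step two.\<close>
  have "pcf_coeff \<nu> (Suc k) = \<nu> * pcf_coeff (\<nu> + 1) k \<and> pcf_coeff \<nu> (Suc (Suc k)) = \<nu> * pcf_coeff (\<nu> + 1) (Suc k)"
    by (induction k) (auto simp: pcf_h_rec algebra_simps)
  then show ?thesis by simp
qed

lemma pcf_coeff_shift: "pcf_coeff (\<nu> - 1) (Suc k) = pcf_coeff \<nu> (Suc (Suc k)) - real (Suc k) * pcf_coeff \<nu> k"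
  using pcf_coeff_Suc[of "\<nu> - 1" k] by (simp add: algebra_simps)

text \<open>Differentiation shifts the index, and by \<open>pcf_coeff_Suc\<close> this amounts to
  raising the parameter. The generic type serves the real moments and the complex solutions
  alike.\<close>

lemma has_field_derivative_pcf_D:
  "(pcf_D \<nu> has_field_derivative - of_real \<nu> * pcf_D (\<nu> + 1) z) (at (z :: 'a::{real_normed_field,banach}))"
proof -
  let ?c = "\<lambda>\<nu> k. of_real ((-1) ^ k * pcf_coeff \<nu> k / fact k) :: 'a"
  have d: "diffs (?c \<nu>) k = - of_real \<nu> * ?c (\<nu> + 1) k" for k
  proof -
    have "diffs (?c \<nu>) k = of_real (real (Suc k) * ((-1) ^ Suc k * pcf_coeff \<nu> (Suc k) / fact (Suc k)))"
      by (simp only: diffs_def of_real_mult of_real_of_nat_eq)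
    also have "real (Suc k) * ((-1) ^ Suc k * pcf_coeff \<nu> (Suc k) / fact (Suc k)) = - \<nu> * ((-1) ^ k * pcf_coeff (\<nu> + 1) k / fact k)"
      by (simp add: pcf_coeff_Suc divide_simps del: of_nat_Suc)
    finally show ?thesis by simp
  qed
  have "((\<lambda>z. \<Sum>k. ?c \<nu> k * z ^ k) has_field_derivative (\<Sum>k. diffs (?c \<nu>) k * z ^ k)) (at z)"
    by (rule termdiffs_strong_converges_everywhere) (rule summable_pcf)
  also have "(\<Sum>k. diffs (?c \<nu>) k * z ^ k) = - of_real \<nu> * pcf_D (\<nu> + 1) z"
    unfolding d pcf_D_def by (subst suminf_mult[symmetric]) (simp_all only: summable_pcf mult.assoc)
  finally show ?thesis unfolding pcf_D_def .
qed

lemma pcf_D_rec: "pcf_D (\<nu> - 1) z = z * pcf_D \<nu> z + of_real \<nu> * pcf_D (\<nu> + 1) (z :: 'a::{real_normed_field,banach})"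
proof -
  let ?t = "\<lambda>\<nu> k. of_real ((-1) ^ k * pcf_coeff \<nu> k / fact k) * z ^ k :: 'a"
  have "of_real \<nu> * pcf_D (\<nu> + 1) z = (\<Sum>k. of_real \<nu> * ?t (\<nu> + 1) k)"
    unfolding pcf_D_def by (rule suminf_mult[symmetric, OF summable_pcf])
  also have "\<dots> = of_real \<nu> * ?t (\<nu> + 1) 0 + (\<Sum>k. of_real \<nu> * ?t (\<nu> + 1) (Suc k))"
    using suminf_split_initial_segment[OF summable_mult[OF summable_pcf, of "of_real \<nu>" "\<nu> + 1" z], of 1] by simp
  finally have 1: "of_real \<nu> * pcf_D (\<nu> + 1) z = of_real \<nu> * ?t (\<nu> + 1) 0 + (\<Sum>k. of_real \<nu> * ?t (\<nu> + 1) (Suc k))" .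
  have 2: "z * pcf_D \<nu> z = (\<Sum>k. z * ?t \<nu> k)"
    unfolding pcf_D_def by (rule suminf_mult[symmetric, OF summable_pcf])
  have 3: "pcf_D (\<nu> - 1) z = ?t (\<nu> - 1) 0 + (\<Sum>k. ?t (\<nu> - 1) (Suc k))"
    unfolding pcf_D_def using suminf_split_initial_segment[OF summable_pcf[of "\<nu> - 1" z], of 1] by simp
  have s: "summable (\<lambda>k. of_real \<nu> * ?t (\<nu> + 1) (Suc k))"
    using summable_mult[OF summable_pcf, of "of_real \<nu>" "\<nu> + 1" z] by (subst (asm) summable_Suc_iff[symmetric])
  have t: "?t (\<nu> - 1) (Suc k) = z * ?t \<nu> k + of_real \<nu> * ?t (\<nu> + 1) (Suc k)" for k
  proof -
    have "(-1) ^ Suc k * pcf_coeff (\<nu> - 1) (Suc k) / fact (Suc k) =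
      (-1) ^ k * pcf_coeff \<nu> k / fact k + \<nu> * ((-1) ^ Suc k * pcf_coeff (\<nu> + 1) (Suc k) / fact (Suc k))"
      unfolding pcf_coeff_shift pcf_coeff_Suc[of \<nu> "Suc k"] by (simp add: divide_simps del: of_nat_Suc pcf_coeff.simps) (simp add: algebra_simps del: pcf_coeff.simps)
    then have "?t (\<nu> - 1) (Suc k) = of_real ((-1) ^ k * pcf_coeff \<nu> k / fact k + \<nu> * ((-1) ^ Suc k * pcf_coeff (\<nu> + 1) (Suc k) / fact (Suc k))) * z ^ Suc k"
      by (simp only:)
    then show ?thesis by (simp only: of_real_add of_real_mult power_Suc) (simp add: algebra_simps del: pcf_coeff.simps)
  qed
  have "(\<Sum>k. ?t (\<nu> - 1) (Suc k)) = (\<Sum>k. z * ?t \<nu> k) + (\<Sum>k. of_real \<nu> * ?t (\<nu> + 1) (Suc k))"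
    unfolding t by (rule suminf_add[symmetric, OF summable_mult[OF summable_pcf] s])
  moreover have "?t (\<nu> - 1) 0 = of_real \<nu> * ?t (\<nu> + 1) 0" by (simp add: pcf_h_rec)
  ultimately show ?thesis unfolding 1 2 3 by simp
qed

lemma pcf_D_0: "pcf_D \<nu> 0 = of_real (pcf_h \<nu>)"
  unfolding pcf_D_def by (subst powser_zero) simp

lemma pcf_D_of_real: "pcf_D \<nu> (of_real x) = of_real (pcf_D \<nu> x)"
proof -
  have "pcf_D \<nu> (of_real x :: 'a) = (\<Sum>k. of_real ((-1) ^ k * pcf_coeff \<nu> k / fact k * x ^ k))"
    by (simp add: pcf_D_def)
  also have "\<dots> = of_real (pcf_D \<nu> x)"
    unfolding pcf_D_def using summable_pcf[of \<nu> x] by (subst suminf_of_real) simp_all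
  finally show ?thesis .
qed

section \<open>Joint continuity in the parameter and the variable\<close>

lemma continuous_on_pcf_D_joint:
  "continuous_on UNIV (\<lambda>(\<nu>, z :: 'a::{real_normed_field,banach}). pcf_D \<nu> z)"
proof -
  have coeff: "continuous_on UNIV (\<lambda>\<nu>. pcf_coeff \<nu> k)" for k
  proof -
    have "continuous_on UNIV (\<lambda>\<nu>. pcf_coeff \<nu> k) \<and> continuous_on UNIV (\<lambda>\<nu>. pcf_coeff \<nu> (Suc k))"
      by (induction k) (auto intro!: continuous_intros)
    then show ?thesis by simp
  qed
  have "continuous (at p) (\<lambda>(\<nu>, z :: 'a). pcf_D \<nu> z)" for p
  proof -
    obtain \<nu>0 and z0 :: 'a where p: "p = (\<nu>0, z0)" by fastforce
    \<comment> \<open>\<open>pcf_bound\<close> is bounded on the compact parameter interval, so this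
      box has a single Weierstrass majorant.\<close>
    define S where "S = {\<nu>0 - 1<..<\<nu>0 + 1} \<times> ball z0 1"
    have "continuous_on {\<nu>0 - 1..\<nu>0 + 1} pcf_bound" unfolding pcf_bound_def by (intro continuous_intros)
    then have "bounded (pcf_bound ` {\<nu>0 - 1..\<nu>0 + 1})" by (intro compact_imp_bounded compact_continuous_image) auto
    then obtain C where C: "\<And>\<nu>. \<nu> \<in> {\<nu>0 - 1..\<nu>0 + 1} \<Longrightarrow> pcf_bound \<nu> \<le> C"
      unfolding bounded_iff by (metis imageI real_norm_def abs_le_D1)
    let ?f = "\<lambda>k (\<nu>, z::'a). of_real ((-1) ^ k * pcf_coeff \<nu> k / fact k) * z ^ k"
    let ?M = "\<lambda>k. C * ((sqrt (\<bar>\<nu>0\<bar> + 1 + 1) * (norm z0 + 1)) ^ k / sqrt (fact k))"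
    have "uniform_limit S (\<lambda>n x. \<Sum>k<n. ?f k x) (\<lambda>x. \<Sum>k. ?f k x) sequentially"
    proof (rule Weierstrass_m_test)
      fix k x assume "x \<in> S"
      then obtain \<nu> z where x: "x = (\<nu>, z)" "\<bar>\<nu> - \<nu>0\<bar> < 1" "dist z0 z < 1" by (auto simp: S_def)
      have "norm z \<le> norm z0 + 1" using x(3) by (smt (verit) dist_norm norm_minus_commute norm_triangle_sub)
      moreover have "pcf_bound \<nu> \<le> C" using C x(2) by (auto simp: abs_if split: if_splits)
      moreover have "\<bar>\<nu>\<bar> \<le> \<bar>\<nu>0\<bar> + 1" using x(2) by linarith
      ultimately show "norm (?f k x) \<le> ?M k" unfolding x(1) split_conv by (intro pcf_term_bound)
    next
      show "summable ?M" by (intro summable_mult summable_power_over_sqrt_fact)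
    qed
    then have "continuous_on S (\<lambda>x. \<Sum>k. ?f k x)"
    proof (rule uniform_limit_theorem[rotated])
      have "continuous_on S (?f k)" for k
        unfolding case_prod_unfold
        by (intro continuous_intros continuous_on_of_real continuous_on_compose2[OF coeff]) auto
      then show "\<forall>\<^sub>F n in sequentially. continuous_on S (\<lambda>x. \<Sum>k<n. ?f k x)"
        by (intro always_eventually allI continuous_on_sum)
    qed simp
    moreover have "(\<lambda>x. \<Sum>k. ?f k x) = (\<lambda>(\<nu>, z :: 'a). pcf_D \<nu> z)" by (auto simp: pcf_D_def fun_eq_iff)
    moreover have "open S" unfolding S_def by (intro open_Times) auto
    moreover have "p \<in> S" by (auto simp: S_def p)
    ultimately show ?thesis by (simp add: continuous_on_eq_continuous_at)
  qed
  then show ?thesis by (simp add: continuous_on_eq_continuous_at)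
qed

lemma continuous_on_pcf_D [continuous_intros]:
  assumes "continuous_on S f" "continuous_on S g"
  shows "continuous_on S (\<lambda>x. pcf_D (f x) (g x :: 'a::{real_normed_field,banach}))"
proof -
  have "continuous_on S (\<lambda>x. (f x, g x))" using assms by (intro continuous_intros)
  from continuous_on_compose2[OF continuous_on_pcf_D_joint this] show ?thesis by simp
qed

subsection \<open>Integral representation\<close>

lemma integral_suminf_dominated:
  fixes f :: "nat \<Rightarrow> real \<Rightarrow> complex"
  assumes f: "\<And>k. (f k has_integral y k) S" and h: "h integrable_on S"
    and bound: "\<And>n x. x \<in> S \<Longrightarrow> norm (\<Sum>k<n. f k x) \<le> h x"
    and lim: "\<And>x. x \<in> S \<Longrightarrow> (\<lambda>k. f k x) sums g x"
    and sums: "y sums Y"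
  shows "(g has_integral Y) S"
proof (rule has_integral_dominated_convergence)
  show "((\<lambda>x. \<Sum>k<n. f k x) has_integral (\<Sum>k<n. y k)) S" for n
    by (intro has_integral_sum f) auto
  show "h integrable_on S" by (rule h)
  show "\<forall>x\<in>S. norm (\<Sum>k<n. f k x) \<le> h x" for n using bound by auto
  show "\<forall>x\<in>S. (\<lambda>n. \<Sum>k<n. f k x) \<longlonglongrightarrow> g x" using lim by (auto simp: sums_def)
  show "(\<lambda>n. \<Sum>k<n. y k) \<longlonglongrightarrow> Y" using sums by (simp add: sums_def)
qed

section \<open>Gamma integrals over the half-line\<close>

lemma powr_add_of_nat_minus_1:
  fixes x :: real
  assumes "x > 0"
  shows "x powr (p + real k - 1) = x powr (p - 1) * x ^ k"
proof -
  have "p + real k - 1 = p - 1 + real k" by simp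
  then show ?thesis using assms by (simp only: powr_add powr_realpow)
qed

lemma has_integral_powr_exp_real:
  fixes m p :: real
  assumes m: "m > 0" and p: "p > 0"
  shows "((\<lambda>t. t powr (p - 1) * exp (- (m * t))) has_integral Gamma p * m powr (- p)) {0<..}"
proof -
  let ?f = "\<lambda>t. t powr (p - 1) / exp t"
  have 1: "(?f has_integral Gamma p) {0<..}"
  proof -
    have "((\<lambda>x. if x \<in> {0<..} then ?f x else 0) has_integral Gamma p) {0..}"
      using Gamma_integral_real[OF p] by (rule has_integral_eq[rotated]) auto
    then show ?thesis by (subst (asm) has_integral_restrict) auto
  qed
  have im: "(\<lambda>t. m * t) ` {0<..} = {0<..}"
  proof safe
    fix x :: real assume "x > 0"
    then show "x \<in> (\<lambda>t. m * t) ` {0<..}" using m by (intro image_eqI[of _ _ "x / m"]) auto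
  qed (use m in auto)
  have "?f absolutely_integrable_on {0<..} \<and> integral {0<..} ?f = Gamma p"
    using 1 by (auto intro!: nonnegative_absolutely_integrable_1 simp: has_integral_integrable integral_unique)
  then have "(\<lambda>x. \<bar>m\<bar> * ?f (m * x)) absolutely_integrable_on {0<..} \<and> integral {0<..} (\<lambda>x. \<bar>m\<bar> * ?f (m * x)) = Gamma p"
    by (subst has_absolute_integral_change_of_variables_1'[of "{0<..}" "\<lambda>t. m * t" "\<lambda>_. m" ?f])
       (use m in \<open>auto simp: im inj_on_def intro!: derivative_eq_intros\<close>)
  then have "((\<lambda>x. \<bar>m\<bar> * ?f (m * x)) has_integral Gamma p) {0<..}"
    by (auto simp: has_integral_iff dest: set_lebesgue_integral_eq_integral(1))
  then have "((\<lambda>x. m powr (- p) * (\<bar>m\<bar> * ?f (m * x))) has_integral m powr (- p) * Gamma p) {0<..}"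
    by (rule has_integral_mult_right)
  moreover have "m powr (- p) * (\<bar>m\<bar> * ?f (m * x)) = x powr (p - 1) * exp (- (m * x))" if "x \<in> {0<..}" for x
  proof -
    have "m powr (- p) * m * m powr (p - 1) = m powr (- p + 1 + (p - 1))"
      using m by (simp only: powr_add) simp
    then have "m powr (- p) * m * m powr (p - 1) = 1" using m by simp
    then show ?thesis using that m by (simp add: powr_mult exp_minus field_simps)
  qed
  ultimately show ?thesis by (subst mult.commute) (rule has_integral_eq[rotated])
qed

text \<open>The real formula is continued to the right half-plane by expanding exp(-\<zeta> t) about
  a real centre m: the terms are real Gamma integrals, and their values sum to the binomial series
  of (1 + w)^(-p) with w = (\<zeta> - m)/m.\<close>

lemma has_integral_powr_exp_complex:
  fixes \<zeta> :: complex and p :: real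
  assumes \<zeta>: "Re \<zeta> > 0" and p: "p > 0"
  shows "((\<lambda>t. of_real (t powr (p - 1)) * exp (- (\<zeta> * of_real t))) has_integral
           Gamma (of_real p) * \<zeta> powr (- of_real p)) {0<..}"
proof -
  \<comment> \<open>This centre gives |m - \<zeta>|^2 = m^2 - |\<zeta>|^2, hence |w| < 1 for every
    \<zeta> with positive real part, and the majorant decays at the positive rate m - |m -
    \<zeta>|.\<close>
  define m where "m = (norm \<zeta>)\<^sup>2 / Re \<zeta>"
  have n0: "norm \<zeta> > 0" using \<zeta> by auto
  then have m0: "m > 0" using \<zeta> by (simp add: m_def)
  have "(norm (of_real m - \<zeta>))\<^sup>2 = m\<^sup>2 - 2 * m * Re \<zeta> + (norm \<zeta>)\<^sup>2"
    unfolding cmod_power2 by (simp add: power2_eq_square algebra_simps)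
  also have "\<dots> = m\<^sup>2 - (norm \<zeta>)\<^sup>2" using \<zeta> by (simp add: m_def)
  also have "\<dots> < m\<^sup>2" using n0 by simp
  finally have less: "norm (of_real m - \<zeta>) < m" using m0 power2_less_imp_less by fastforce
  define w where "w = (\<zeta> - of_real m) / of_real m"
  have w: "norm w < 1" using less m0 by (simp add: w_def norm_divide norm_minus_commute)
  let ?f = "\<lambda>k t. of_real (t powr (p - 1) * exp (- (m * t))) * (((of_real m - \<zeta>) * of_real t) ^ k /\<^sub>R fact k)"
  let ?y = "\<lambda>k. of_real (Gamma p * m powr (- p)) * ((of_real (- p) gchoose k) * w ^ k)"
  show ?thesis
  proof (rule integral_suminf_dominated)
    fix k
    have "((\<lambda>t. t powr (p + real k - 1) * exp (- (m * t))) has_integral Gamma (p + real k) * m powr (- (p + real k))) {0<..}"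
      by (rule has_integral_powr_exp_real) (use m0 p in auto)
    then have "((\<lambda>t. complex_of_real (t powr (p + real k - 1) * exp (- (m * t)))) has_integral of_real (Gamma (p + real k) * m powr (- (p + real k)))) {0<..}"
      by (rule has_integral_of_real)
    then have I: "((\<lambda>t. ((of_real m - \<zeta>) ^ k / fact k) * complex_of_real (t powr (p + real k - 1) * exp (- (m * t)))) has_integral
        ((of_real m - \<zeta>) ^ k / fact k) * of_real (Gamma (p + real k) * m powr (- (p + real k)))) {0<..}"
      by (rule has_integral_mult_right)
    have "((of_real m - \<zeta>) ^ k / fact k) * complex_of_real (t powr (p + real k - 1) * exp (- (m * t))) = ?f k t" if "t \<in> {0<..}" for t
    proof -
      have "t powr (p + real k - 1) = t powr (p - 1) * t ^ k" using that
        by (simp add: powr_add_of_nat_minus_1)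
      then show ?thesis by (simp add: power_mult_distrib scaleR_conv_of_real divide_inverse)
    qed
    then have "(?f k has_integral ((of_real m - \<zeta>) ^ k / fact k) * of_real (Gamma (p + real k) * m powr (- (p + real k)))) {0<..}"
      using I by (rule has_integral_eq)
    moreover have "((of_real m - \<zeta>) ^ k / fact k) * of_real (Gamma (p + real k) * m powr (- (p + real k))) = ?y k"
    proof -
      have "pochhammer p k = Gamma (p + real k) / Gamma p"
        by (rule pochhammer_Gamma) (use p in \<open>auto elim!: nonpos_Ints_cases\<close>)
      then have G: "Gamma (p + real k) = Gamma p * pochhammer p k"
        using Gamma_real_pos[OF p] by simp
      have "of_real (- p) gchoose k = ((-1) ^ k * of_real (pochhammer p k) / fact k :: complex)"
        by (simp add: gbinomial_pochhammer pochhammer_of_real)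
      moreover have "m powr (- (p + real k)) = m powr (- p) / m ^ k"
        using m0 by (simp add: powr_diff powr_realpow)
      moreover have "(of_real m - \<zeta>) ^ k = (-1) ^ k * of_real (m ^ k) * w ^ k"
        using m0 by (simp add: w_def flip: power_mult_distrib)
      ultimately show ?thesis using m0 by (simp add: G)
    qed
    ultimately show "(?f k has_integral ?y k) {0<..}" by simp
  next
    show "(\<lambda>t. t powr (p - 1) * exp (- ((m - norm (of_real m - \<zeta>)) * t))) integrable_on {0<..}"
      using has_integral_powr_exp_real[of "m - norm (of_real m - \<zeta>)" p] less p by (auto simp: has_integral_integrable)
  next
    fix n and t :: real assume t: "t \<in> {0<..}"
    let ?x = "(of_real m - \<zeta>) * of_real t"
    have "norm (\<Sum>k<n. ?x ^ k /\<^sub>R fact k) \<le> (\<Sum>k<n. norm ?x ^ k /\<^sub>R fact k)"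
      by (rule sum_norm_le) (simp add: norm_power norm_mult)
    also have "\<dots> \<le> (\<Sum>k. norm ?x ^ k /\<^sub>R fact k)"
      by (rule sum_le_suminf[OF summable_exp_generic]) auto
    also have "\<dots> = exp (norm ?x)" by (simp add: exp_def)
    finally have E: "norm (\<Sum>k<n. ?x ^ k /\<^sub>R fact k) \<le> exp (norm ?x)" .
    have "norm (\<Sum>k<n. ?f k t) = (t powr (p - 1) * exp (- (m * t))) * norm (\<Sum>k<n. ?x ^ k /\<^sub>R fact k)"
      by (simp only: sum_distrib_left[symmetric] norm_mult norm_of_real) (simp add: abs_mult)
    also have "\<dots> \<le> (t powr (p - 1) * exp (- (m * t))) * exp (norm ?x)"
      by (intro mult_left_mono E) auto
    also have "\<dots> = t powr (p - 1) * exp (- ((m - norm (of_real m - \<zeta>)) * t))"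
    proof -
      have "norm ?x = norm (of_real m - \<zeta>) * t" using t by (simp add: norm_mult)
      then show ?thesis by (simp add: left_diff_distrib flip: exp_add)
    qed
    finally show "norm (\<Sum>k<n. ?f k t) \<le> t powr (p - 1) * exp (- ((m - norm (of_real m - \<zeta>)) * t))" .
  next
    fix t :: real assume t: "t \<in> {0<..}"
    have "(\<lambda>k. ?f k t) sums (of_real (t powr (p - 1) * exp (- (m * t))) * exp ((of_real m - \<zeta>) * of_real t))"
      by (intro sums_mult exp_converges)
    also have "of_real (t powr (p - 1) * exp (- (m * t))) * exp ((of_real m - \<zeta>) * of_real t) =
       of_real (t powr (p - 1)) * (exp (of_real (- (m * t))) * exp ((of_real m - \<zeta>) * of_real t))"
      by (simp only: of_real_mult exp_of_real mult.assoc)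
    also have "exp (of_real (- (m * t))) * exp ((of_real m - \<zeta>) * of_real t) = exp (- (\<zeta> * of_real t))"
      by (simp add: algebra_simps flip: exp_add)
    finally show "(\<lambda>k. ?f k t) sums (of_real (t powr (p - 1)) * exp (- (\<zeta> * of_real t)))" .
  next
    have "?y sums (of_real (Gamma p * m powr (- p)) * (1 + w) powr of_real (- p))"
      by (intro sums_mult gen_binomial_complex w)
    also have "1 + w = \<zeta> / of_real m" using m0 by (simp add: w_def field_simps)
    also have "(\<zeta> / of_real m) powr of_real (- p) = \<zeta> powr of_real (- p) * of_real (m powr p)"
    proof -
      have "\<zeta> powr of_real (- p) = (of_real m * (\<zeta> / of_real m)) powr of_real (- p)" using m0 by simp
      also have "\<dots> = of_real m powr of_real (- p) * (\<zeta> / of_real m) powr of_real (- p)"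
        by (rule powr_times_real_left) (use m0 in \<open>auto simp: complex_is_Real_iff\<close>)
      also have "of_real m powr of_real (- p) = complex_of_real (m powr (- p))"
        using m0 by (simp only: powr_of_real less_imp_le)
      finally show ?thesis using m0 by (simp add: powr_minus)
    qed
    also have "of_real (Gamma p * m powr (- p)) * (\<zeta> powr of_real (- p) * of_real (m powr p)) = Gamma (of_real p) * \<zeta> powr (- of_real p)"
      using m0 by (simp add: Gamma_complex_of_real powr_minus)
    finally show "?y sums (Gamma (of_real p) * \<zeta> powr (- of_real p))" .
  qed
qed

lemma has_integral_powr_gauss_complex:
  fixes \<mu> :: complex and q :: real
  assumes \<mu>: "Re \<mu> > 0" and q: "q > 0"
  shows "((\<lambda>t. of_real (t powr (q - 1)) * exp (- (\<mu> * of_real (t\<^sup>2)))) has_integral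
           Gamma (of_real (q / 2)) * \<mu> powr (- of_real (q / 2)) / 2) {0<..}"
proof -
  let ?f = "\<lambda>t. complex_of_real (t powr (q / 2 - 1)) * exp (- (\<mu> * of_real t))"
  let ?I = "Gamma (complex_of_real (q / 2)) * \<mu> powr (- of_real (q / 2))"
  have I: "(?f has_integral ?I) {0<..}"
    by (rule has_integral_powr_exp_complex) (use assms in auto)
  have "?f absolutely_integrable_on {0<..}"
  proof (rule absolutely_integrable_integrable_bound)
    show "?f integrable_on {0<..}" using I by (auto simp: has_integral_integrable)
    show "(\<lambda>t. t powr (q / 2 - 1) * exp (- (Re \<mu> * t))) integrable_on {0<..}"
      using has_integral_powr_exp_real[of "Re \<mu>" "q / 2"] assms by (auto simp: has_integral_integrable)
  qed (simp add: norm_mult)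
  moreover have im: "(\<lambda>t::real. t\<^sup>2) ` {0<..} = {0<..}"
  proof safe
    fix x :: real assume "x > 0"
    then show "x \<in> (\<lambda>t. t\<^sup>2) ` {0<..}" by (intro image_eqI[of _ _ "sqrt x"]) auto
  qed auto
  ultimately have "(\<lambda>x. \<bar>2 * x\<bar> *\<^sub>R ?f (x\<^sup>2)) absolutely_integrable_on {0<..} \<and> integral {0<..} (\<lambda>x. \<bar>2 * x\<bar> *\<^sub>R ?f (x\<^sup>2)) = ?I"
    by (subst has_absolute_integral_change_of_variables_real[of "{0<..}" "\<lambda>t. t\<^sup>2" "\<lambda>x. 2 * x" ?f])
       (use I in \<open>auto simp: im inj_on_def integral_unique intro!: derivative_eq_intros\<close>)
  then have "((\<lambda>x. \<bar>2 * x\<bar> *\<^sub>R ?f (x\<^sup>2)) has_integral ?I) {0<..}"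
    by (auto simp: has_integral_iff dest: set_lebesgue_integral_eq_integral(1))
  then have "((\<lambda>x. (\<bar>2 * x\<bar> *\<^sub>R ?f (x\<^sup>2)) / 2) has_integral ?I / 2) {0<..}"
    by (rule has_integral_divide)
  moreover have "(\<bar>2 * x\<bar> *\<^sub>R ?f (x\<^sup>2)) / 2 = of_real (x powr (q - 1)) * exp (- (\<mu> * of_real (x\<^sup>2)))" if "x \<in> {0<..}" for x
  proof -
    have "x * (x\<^sup>2) powr (q / 2 - 1) = x powr 1 * x powr (q - 2)"
    proof -
      have "(x\<^sup>2) powr (q / 2 - 1) = (x powr 2) powr (q / 2 - 1)" using that by simp
      also have "\<dots> = x powr (q - 2)" by (simp only: powr_powr) (simp add: algebra_simps)
      finally show ?thesis using that by simp
    qed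
    also have "\<dots> = x powr (q - 1)" by (simp only: powr_add[symmetric]) simp
    finally have "x * (x\<^sup>2) powr (q / 2 - 1) = x powr (q - 1)" .
    then have "complex_of_real (x powr (q - 1)) = of_real x * of_real ((x\<^sup>2) powr (q / 2 - 1))" by (simp flip: of_real_mult)
    then show ?thesis using that by (simp add: scaleR_conv_of_real)
  qed
  ultimately show ?thesis by (rule has_integral_eq[rotated])
qed

text \<open>Both sides are the integral of t^(\<nu>+k-1) exp(-t^2/2) over the half-line. Duplication
  gives k = 0 and, at \<nu> + 1, also k = 1; from k to k + 2 it is \<Gamma>(x + 1) = x
  \<Gamma>(x).\<close>

lemma Gamma_times_pcf_coeff:
  assumes "\<nu> > 0"
  shows "Gamma \<nu> * pcf_coeff \<nu> k = 2 powr ((\<nu> + real k) / 2 - 1) * Gamma ((\<nu> + real k) / 2)"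
proof -
  have h: "Gamma x * pcf_h x = 2 powr (x / 2 - 1) * Gamma (x / 2)" if x: "x > 0" for x
  proof -
    have r: "rGamma (x / 2) * rGamma ((x + 1) / 2) = 2 powr (x - 1) * rGamma x / sqrt pi"
      using rGamma_legendre_duplication_real[of "x / 2"] by (simp add: add_divide_distrib)
    have g: "Gamma y * rGamma y = 1" if "y > 0" for y :: real
      using Gamma_real_pos[OF that] by (simp add: rGamma_inverse_Gamma)
    have "2 powr (x / 2 - 1) * Gamma (x / 2) = 2 powr (x / 2 - 1) * Gamma (x / 2) * (Gamma x * rGamma x)"
      using g[OF x] by simp
    also have "\<dots> = 2 powr (x / 2 - 1) * Gamma (x / 2) * Gamma x * (sqrt pi * 2 powr (- (x - 1)) * (2 powr (x - 1) * rGamma x / sqrt pi))"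
      by (simp only: powr_minus) simp
    also have "\<dots> = 2 powr (x / 2 - 1) * Gamma x * (sqrt pi * 2 powr (- (x - 1)) * (Gamma (x / 2) * rGamma (x / 2)) * rGamma ((x + 1) / 2))"
      unfolding r[symmetric] by (simp add: algebra_simps)
    also have "\<dots> = Gamma x * (sqrt pi * (2 powr (x / 2 - 1) * 2 powr (- (x - 1))) * rGamma ((x + 1) / 2))"
      using g[of "x / 2"] x by simp
    also have "2 powr (x / 2 - 1) * 2 powr (- (x - 1)) = 2 powr (- x / 2)"
      by (simp flip: powr_add)
    finally show ?thesis by (simp add: pcf_h_def)
  qed
  show ?thesis using assms
  proof (induction \<nu> k rule: pcf_coeff.induct)
    case (1 \<nu>) then show ?case using h[of \<nu>] by simp
  next
    case (2 \<nu>)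
    then have "Gamma (\<nu> + 1) = \<nu> * Gamma \<nu>" by (intro Gamma_plus1) (auto elim!: nonpos_Ints_cases)
    then show ?case using h[of "\<nu> + 1"] 2 pcf_h_rec[of \<nu>] by (simp add: mult_ac)
  next
    case (3 \<nu> k)
    let ?x = "(\<nu> + real k) / 2"
    have x: "?x > 0" using 3 by simp
    then have "Gamma (?x + 1) = ?x * Gamma ?x" by (intro Gamma_plus1) (auto elim!: nonpos_Ints_cases)
    moreover have "(\<nu> + real (Suc (Suc k))) / 2 = ?x + 1" by (simp add: field_simps)
    moreover have "2 powr (?x + 1 - 1) = 2 * 2 powr (?x - 1)" by (simp add: powr_diff)
    ultimately have "2 powr ((\<nu> + real (Suc (Suc k))) / 2 - 1) * Gamma ((\<nu> + real (Suc (Suc k))) / 2) =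
      (\<nu> + real k) * (2 powr (?x - 1) * Gamma ?x)" by (simp only:) simp
    then show ?case using 3 by (simp add: algebra_simps)
  qed
qed

text \<open>Replacing t by t exp(i \<phi>) in the integral for \<phi> = 0 predicts the factor
  \<open>cis (- \<phi> * \<nu>)\<close>. Instead of deforming a contour, the exponential series is
  integrated term by term on each ray: the phase of \<mu>^(-(\<nu>+k)/2) absorbs
  \<open>cis \<phi> ^ k\<close>, so every ray yields the same coefficients. The bound on \<phi>
  means Re \<mu> > 0.\<close>

lemma has_integral_pcf_D:
  fixes z :: complex
  assumes \<nu>: "\<nu> > 0" and \<phi>: "\<bar>\<phi>\<bar> < pi / 4"
  shows "((\<lambda>t. of_real (t powr (\<nu> - 1)) * exp (- (cis (2 * \<phi>) / 2 * of_real (t\<^sup>2))) * exp (- (z * cis \<phi> * of_real t)))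
           has_integral cis (- \<phi> * \<nu>) * Gamma (of_real \<nu>) * pcf_D \<nu> z) {0<..}"
proof -
  define \<mu> where "\<mu> = cis (2 * \<phi>) / 2"
  have c: "cos (2 * \<phi>) > 0" using \<phi> by (intro cos_gt_zero_pi) auto
  have Re: "Re \<mu> = cos (2 * \<phi>) / 2" by (simp add: \<mu>_def)
  have Re0: "Re \<mu> > 0" using c Re by simp
  let ?f = "\<lambda>k t. of_real (t powr (\<nu> - 1)) * exp (- (\<mu> * of_real (t\<^sup>2))) * ((- (z * cis \<phi> * of_real t)) ^ k /\<^sub>R fact k)"
  let ?y = "\<lambda>k. cis (- \<phi> * \<nu>) * Gamma (of_real \<nu>) * (of_real ((-1) ^ k * pcf_coeff \<nu> k / fact k) * z ^ k)"
  \<comment> \<open>From completing the square in |z| t - (c/2) t^2, c = cos 2\<phi>, with one unit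
    of decay kept in reserve: the majorant becomes K t^(\<nu>-1) exp(-t).\<close>
  define K where "K = exp ((norm z + 1)\<^sup>2 / (2 * cos (2 * \<phi>)))"
  have "((\<lambda>t. of_real (t powr (\<nu> - 1)) * exp (- (\<mu> * of_real (t\<^sup>2))) * exp (- (z * cis \<phi> * of_real t)))
           has_integral cis (- \<phi> * \<nu>) * Gamma (of_real \<nu>) * pcf_D \<nu> z) {0<..}"
  proof (rule integral_suminf_dominated)
    fix k
    define q where "q = \<nu> + real k"
    have q: "q > 0" using \<nu> by (simp add: q_def)
    have I: "((\<lambda>t. ((- (z * cis \<phi>)) ^ k / fact k) * (of_real (t powr (q - 1)) * exp (- (\<mu> * of_real (t\<^sup>2))))) has_integral
        ((- (z * cis \<phi>)) ^ k / fact k) * (Gamma (of_real (q / 2)) * \<mu> powr (- of_real (q / 2)) / 2)) {0<..}"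
      by (intro has_integral_mult_right has_integral_powr_gauss_complex Re0 q)
    have "((- (z * cis \<phi>)) ^ k / fact k) * (of_real (t powr (q - 1)) * exp (- (\<mu> * of_real (t\<^sup>2)))) = ?f k t" if "t \<in> {0<..}" for t
    proof -
      have "t powr (q - 1) = t powr (\<nu> - 1) * t ^ k" using that
        by (simp add: q_def powr_add_of_nat_minus_1)
      moreover have "(- (z * cis \<phi> * of_real t)) ^ k = (- (z * cis \<phi>)) ^ k * of_real (t ^ k)"
        by (simp flip: power_mult_distrib)
      ultimately show ?thesis by (simp add: scaleR_conv_of_real divide_inverse)
    qed
    then have "(?f k has_integral ((- (z * cis \<phi>)) ^ k / fact k) * (Gamma (of_real (q / 2)) * \<mu> powr (- of_real (q / 2)) / 2)) {0<..}"
      using I by (rule has_integral_eq)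
    moreover have "((- (z * cis \<phi>)) ^ k / fact k) * (Gamma (of_real (q / 2)) * \<mu> powr (- of_real (q / 2)) / 2) = ?y k"
    proof -
      have L: "Ln \<mu> = of_real (- ln 2) + \<i> * of_real (2 * \<phi>)"
      proof (rule Ln_unique)
        show "exp (of_real (- ln 2) + \<i> * of_real (2 * \<phi>)) = \<mu>"
          by (simp add: exp_add exp_minus exp_of_real \<mu>_def cis_conv_exp del: of_real_mult of_real_minus)
      qed (use \<phi> in auto)
      have "\<mu> powr (- of_real (q / 2)) = exp (of_real (q / 2 * ln 2) + \<i> * of_real (- \<phi> * q))"
        using Re0 by (subst powr_def) (auto simp: L algebra_simps)
      also have "\<dots> = of_real (2 powr (q / 2)) * cis (- \<phi> * q)"
        by (subst exp_add, subst exp_of_real) (simp add: cis_conv_exp powr_def)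
      finally have p: "\<mu> powr (- of_real (q / 2)) = of_real (2 powr (q / 2)) * cis (- \<phi> * q)" .
      have "cis (- \<phi> * q) * cis \<phi> ^ k = cis (- \<phi> * \<nu>)"
        by (simp add: Complex.DeMoivre cis_mult q_def algebra_simps)
      moreover have "(- (z * cis \<phi>)) ^ k = (-1) ^ k * z ^ k * cis \<phi> ^ k"
        by (metis mult_minus1 power_mult_distrib mult.assoc)
      moreover have "complex_of_real (Gamma (q / 2) * 2 powr (q / 2) / 2) = of_real (Gamma \<nu> * pcf_coeff \<nu> k)"
        by (rule arg_cong) (use Gamma_times_pcf_coeff[OF \<nu>, of k] in \<open>simp add: q_def powr_diff mult_ac\<close>)
      ultimately have "((- (z * cis \<phi>)) ^ k / fact k) * (of_real (Gamma (q / 2)) * (of_real (2 powr (q / 2)) * cis (- \<phi> * q)) / 2) =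
         (-1) ^ k * z ^ k / fact k * cis (- \<phi> * \<nu>) * of_real (Gamma \<nu> * pcf_coeff \<nu> k)"
        by (simp add: field_simps)
      then show ?thesis unfolding p by (simp add: Gamma_complex_of_real[of "q/2", simplified] Gamma_complex_of_real)
    qed
    ultimately show "(?f k has_integral ?y k) {0<..}" by simp
  next
    have "(\<lambda>t. t powr (\<nu> - 1) * exp (- (1 * t))) integrable_on {0<..}"
      using has_integral_powr_exp_real[of 1 \<nu>] \<nu> by (auto simp: has_integral_integrable)
    then show "(\<lambda>t. K * (t powr (\<nu> - 1) * exp (- (1 * t)))) integrable_on {0<..}"
      by (rule integrable_on_mult_right)
  next
    fix n and t :: real assume t: "t \<in> {0<..}"
    let ?x = "- (z * cis \<phi> * of_real t)"
    have "norm (\<Sum>k<n. ?x ^ k /\<^sub>R fact k) \<le> (\<Sum>k<n. norm ?x ^ k /\<^sub>R fact k)"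
      by (rule sum_norm_le) (simp add: norm_power norm_mult)
    also have "\<dots> \<le> (\<Sum>k. norm ?x ^ k /\<^sub>R fact k)"
      by (rule sum_le_suminf[OF summable_exp_generic]) auto
    also have "\<dots> = exp (norm ?x)" by (simp add: exp_def)
    finally have E: "norm (\<Sum>k<n. ?x ^ k /\<^sub>R fact k) \<le> exp (norm z * t)" using t by (simp add: norm_mult)
    have "norm (\<Sum>k<n. ?f k t) = t powr (\<nu> - 1) * exp (- (Re \<mu> * t\<^sup>2)) * norm (\<Sum>k<n. ?x ^ k /\<^sub>R fact k)"
      by (simp only: sum_distrib_left[symmetric] norm_mult norm_of_real norm_exp_eq_Re) simp
    also have "\<dots> \<le> t powr (\<nu> - 1) * exp (- (Re \<mu> * t\<^sup>2)) * exp (norm z * t)"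
      by (intro mult_left_mono E) auto
    also have "\<dots> = t powr (\<nu> - 1) * exp (norm z * t - Re \<mu> * t\<^sup>2)"
      by (simp flip: exp_add)
    also have "norm z * t - Re \<mu> * t\<^sup>2 \<le> (norm z + 1)\<^sup>2 / (2 * cos (2 * \<phi>)) - t"
    proof -
      let ?b = "norm z + 1" and ?c = "cos (2 * \<phi>)"
      have "0 \<le> (?b - ?c * t)\<^sup>2 / (2 * ?c)" using c by simp
      also have "\<dots> = ?b\<^sup>2 / (2 * ?c) - ?b * t + ?c / 2 * t\<^sup>2"
        using c by (simp add: field_simps power2_eq_square)
      finally show ?thesis by (simp add: Re algebra_simps)
    qed
    then have "t powr (\<nu> - 1) * exp (norm z * t - Re \<mu> * t\<^sup>2) \<le> t powr (\<nu> - 1) * exp ((norm z + 1)\<^sup>2 / (2 * cos (2 * \<phi>)) - t)"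
      by (intro mult_left_mono) auto
    also have "\<dots> = K * (t powr (\<nu> - 1) * exp (- (1 * t)))"
      by (simp add: K_def exp_diff exp_minus field_simps)
    finally show "norm (\<Sum>k<n. ?f k t) \<le> K * (t powr (\<nu> - 1) * exp (- (1 * t)))" by simp
  next
    fix t :: real assume t: "t \<in> {0<..}"
    show "(\<lambda>k. ?f k t) sums (of_real (t powr (\<nu> - 1)) * exp (- (\<mu> * of_real (t\<^sup>2))) * exp (- (z * cis \<phi> * of_real t)))"
      by (intro sums_mult exp_converges)
  next
    show "?y sums (cis (- \<phi> * \<nu>) * Gamma (of_real \<nu>) * pcf_D \<nu> z)"
      unfolding pcf_D_def by (intro sums_mult summable_sums summable_pcf)
  qed
  then show ?thesis unfolding \<mu>_def .
qed

subsection \<open>Asymptotics in the sector\<close>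

lemma norm_exp_minus_1_le:
  assumes "Re w \<ge> 0" shows "norm (exp (- w) - 1) \<le> norm (w :: complex)"
proof -
  have "norm (exp (- w) - exp 0) \<le> 1 * norm (- w - 0)"
  proof (rule field_differentiable_bound[of "{x. Re x \<le> 0}" exp exp])
    show "convex {x. Re x \<le> 0}" by (rule convex_halfspace_Re_le)
  qed (use assms in \<open>auto intro: DERIV_subset[OF DERIV_exp]\<close>)
  then show ?thesis by simp
qed

text \<open>Watson's lemma with one term: replacing the Gaussian factor by 1 costs at most t^2/2,
  and the remaining integrals are Gamma integrals. The angle \<phi> turns z to within \<pi>/2 - s of
  the positive axis, where Re \<zeta> \<ge> |z| sin s.\<close>

lemma pcf_D_sector_bound:
  fixes z :: complex
  assumes \<nu>: "\<nu> > 0" and \<phi>: "\<bar>\<phi>\<bar> < pi / 4" and s: "s > 0" and z: "z \<noteq> 0"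
    and arg: "\<bar>Arg z + \<phi>\<bar> \<le> pi / 2 - s"
  shows "norm (pcf_D \<nu> z * z powr of_real \<nu> - 1) \<le> \<nu> * (\<nu> + 1) / (2 * sin s powr (\<nu> + 2)) / (norm z)\<^sup>2"
proof -
  define \<zeta> where "\<zeta> = z * cis \<phi>"
  have s2: "s \<le> pi / 2" using arg abs_ge_zero[of "Arg z + \<phi>"] by linarith
  have sin: "sin s > 0" using s s2 by (intro sin_gt_zero) auto
  have zeq: "z = of_real (norm z) * cis (Arg z)" using z by (metis rcis_cmod_Arg rcis_def)
  have \<zeta>eq: "\<zeta> = of_real (norm z) * cis (Arg z + \<phi>)"
    unfolding \<zeta>_def by (subst zeq) (simp add: cis_mult)
  have "sin s = cos (pi / 2 - s)" by (simp add: cos_diff)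
  also have "\<dots> \<le> cos \<bar>Arg z + \<phi>\<bar>"
    by (rule cos_monotone_0_pi_le) (use arg s s2 in auto)
  finally have cos: "sin s \<le> cos (Arg z + \<phi>)" by simp
  have Re\<zeta>: "Re \<zeta> \<ge> norm z * sin s" unfolding \<zeta>eq using cos by (simp add: mult_left_mono)
  have nz: "norm z * sin s > 0" using z sin by simp
  then have Re\<zeta>0: "Re \<zeta> > 0" using Re\<zeta> by linarith
  have Lz: "exp (of_real (ln (norm z)) + \<i> * of_real (Arg z)) = z"
    using z by (subst (3) zeq) (simp add: exp_add exp_of_real cis_conv_exp)
  have "Ln z = of_real (ln (norm z)) + \<i> * of_real (Arg z)"
    by (rule Ln_unique[OF Lz]) (use mpi_less_Arg[of z] Arg_le_pi[of z] in auto)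
  \<comment> \<open>Arg z + \<phi> stays in the principal range, so the principal powers of z and
    \<zeta> differ only by a phase and no multiple of 2\<pi>i intervenes.\<close>
  moreover have "Ln \<zeta> = of_real (ln (norm z)) + \<i> * of_real (Arg z + \<phi>)"
    by (rule Ln_unique) (use z arg s in \<open>auto simp: \<zeta>eq exp_add exp_of_real cis_conv_exp\<close>)
  ultimately have Ln: "Ln \<zeta> = Ln z + \<i> * of_real \<phi>" by (simp add: algebra_simps)
  have \<zeta>0: "\<zeta> \<noteq> 0" using Re\<zeta>0 by auto
  have pw: "\<zeta> powr (- of_real \<nu>) = z powr (- of_real \<nu>) * cis (- \<phi> * \<nu>)"
    using z \<zeta>0 by (simp add: powr_def Ln cis_conv_exp algebra_simps flip: exp_add)
  let ?w = "\<lambda>t::real. cis (2 * \<phi>) / 2 * of_real (t\<^sup>2)"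
  let ?f = "\<lambda>t. of_real (t powr (\<nu> - 1)) * exp (- (?w t)) * exp (- (z * cis \<phi> * of_real t))"
  let ?g = "\<lambda>t. of_real (t powr (\<nu> - 1)) * exp (- (\<zeta> * of_real t))"
  let ?G = "Gamma (complex_of_real \<nu>)"
  let ?e = "cis (- \<phi> * \<nu>)"
  have d: "((\<lambda>t. ?f t - ?g t) has_integral ?e * ?G * pcf_D \<nu> z - ?G * \<zeta> powr (- of_real \<nu>)) {0<..}"
    by (intro has_integral_diff has_integral_pcf_D has_integral_powr_exp_complex assms Re\<zeta>0)
  let ?m = "norm z * sin s"
  let ?h = "\<lambda>t. 1 / 2 * (t powr (\<nu> + 2 - 1) * exp (- (?m * t)))"
  have h: "(?h has_integral 1 / 2 * (Gamma (\<nu> + 2) * ?m powr (- (\<nu> + 2)))) {0<..}"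
    by (intro has_integral_mult_right has_integral_powr_exp_real nz) (use \<nu> in auto)
  have "norm (?e * ?G * pcf_D \<nu> z - ?G * \<zeta> powr (- of_real \<nu>)) = norm (integral {0<..} (\<lambda>t. ?f t - ?g t))"
    using d by (simp add: integral_unique)
  also have "\<dots> \<le> integral {0<..} ?h"
  proof (rule integral_norm_bound_integral)
    show "(\<lambda>t. ?f t - ?g t) integrable_on {0<..}" using d by (auto simp: has_integral_integrable)
    show "?h integrable_on {0<..}" using h by (auto simp: has_integral_integrable)
    fix t :: real assume t: "t \<in> {0<..}"
    have "?f t - ?g t = of_real (t powr (\<nu> - 1)) * exp (- (\<zeta> * of_real t)) * (exp (- ?w t) - 1)"
      by (simp add: \<zeta>_def algebra_simps)
    then have "norm (?f t - ?g t) = t powr (\<nu> - 1) * exp (- (Re \<zeta> * t)) * norm (exp (- ?w t) - 1)"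
      by (simp add: norm_mult)
    also have "\<dots> \<le> t powr (\<nu> - 1) * exp (- (?m * t)) * (t\<^sup>2 / 2)"
    proof (intro mult_mono)
      show "exp (- (Re \<zeta> * t)) \<le> exp (- (?m * t))" using t Re\<zeta> by simp
      have "cos (2 * \<phi>) > 0" using \<phi> by (intro cos_gt_zero_pi) auto
      moreover have "?w t = (t\<^sup>2 / 2) *\<^sub>R cis (2 * \<phi>)" by (simp add: scaleR_conv_of_real)
      ultimately have "Re (?w t) \<ge> 0" by (simp only: scaleR_complex.sel) simp
      from norm_exp_minus_1_le[OF this] show "norm (exp (- ?w t) - 1) \<le> t\<^sup>2 / 2"
        by (simp add: norm_mult norm_divide norm_power)
    qed auto
    also have "\<dots> = ?h t" using t powr_add_of_nat_minus_1[of t \<nu> 2] by simp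
    finally show "norm (?f t - ?g t) \<le> ?h t" .
  qed
  also have "\<dots> = Gamma (\<nu> + 2) * ?m powr (- (\<nu> + 2)) / 2" using integral_unique[OF h] by simp
  finally have B: "norm (?e * ?G * pcf_D \<nu> z - ?G * \<zeta> powr (- of_real \<nu>)) \<le> Gamma (\<nu> + 2) * ?m powr (- (\<nu> + 2)) / 2" .
  have "?e * ?G * pcf_D \<nu> z - ?G * \<zeta> powr (- of_real \<nu>) = ?e * ?G * z powr (- of_real \<nu>) * (pcf_D \<nu> z * z powr of_real \<nu> - 1)"
  proof -
    have "z powr (- of_real \<nu>) * z powr of_real \<nu> = 1" using z by (simp add: powr_minus)
    moreover have "?e * ?G * z powr (- of_real \<nu>) * (pcf_D \<nu> z * z powr of_real \<nu> - 1) =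
      ?e * ?G * pcf_D \<nu> z * (z powr (- of_real \<nu>) * z powr of_real \<nu>) - ?G * (z powr (- of_real \<nu>) * ?e)"
      by (simp only: right_diff_distrib mult_1_right mult_1_left mult_ac)
    ultimately show ?thesis by (simp only: pw mult_1_right)
  qed
  then have "norm (?e * ?G * pcf_D \<nu> z - ?G * \<zeta> powr (- of_real \<nu>)) = Gamma \<nu> * norm z powr (- \<nu>) * norm (pcf_D \<nu> z * z powr of_real \<nu> - 1)"
    using Gamma_real_pos[OF \<nu>] by (simp add: norm_mult Gamma_complex_of_real norm_powr_real_powr')
  moreover have "Gamma (\<nu> + 2) = \<nu> * (\<nu> + 1) * Gamma \<nu>"
  proof -
    have "Gamma (\<nu> + 1 + 1) = (\<nu> + 1) * Gamma (\<nu> + 1)" "Gamma (\<nu> + 1) = \<nu> * Gamma \<nu>"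
      by (rule Gamma_plus1, use \<nu> in \<open>auto elim!: nonpos_Ints_cases\<close>)+
    then show ?thesis by (simp add: add.assoc)
  qed
  moreover have "?m powr (- (\<nu> + 2)) = norm z powr (- \<nu>) / (norm z)\<^sup>2 / sin s powr (\<nu> + 2)"
  proof -
    have "norm z powr (- (\<nu> + 2)) = norm z powr (- \<nu>) * norm z powr (- 2)" by (simp flip: powr_add)
    moreover have "norm z powr (- 2) = 1 / (norm z)\<^sup>2" using z by (simp add: powr_minus_divide)
    moreover have "sin s powr (- (\<nu> + 2)) = 1 / sin s powr (\<nu> + 2)" by (rule powr_minus_divide)
    moreover have "?m powr (- (\<nu> + 2)) = norm z powr (- (\<nu> + 2)) * sin s powr (- (\<nu> + 2))"
      by (rule powr_mult)
    ultimately show ?thesis by simp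
  qed
  ultimately have "Gamma \<nu> * norm z powr (- \<nu>) * norm (pcf_D \<nu> z * z powr of_real \<nu> - 1) \<le>
      Gamma \<nu> * norm z powr (- \<nu>) * (\<nu> * (\<nu> + 1) / (2 * sin s powr (\<nu> + 2)) / (norm z)\<^sup>2)"
    using B by (simp add: mult_ac)
  then show ?thesis using Gamma_real_pos[OF \<nu>] z by (subst (asm) mult_le_cancel_left_pos) auto
qed

abbreviation (input) sector_filter :: "real \<Rightarrow> complex filter" where
  "sector_filter \<delta> \<equiv> inf at_infinity (principal {z. z \<noteq> 0 \<and> \<bar>Arg z\<bar> \<le> 3 * pi / 4 - \<delta>})"

lemma tendsto_norm_power_sector:
  "((\<lambda>z. C / (norm z)\<^sup>2) \<longlongrightarrow> 0) (inf at_infinity F :: complex filter)"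
proof (rule tendsto_mono[OF inf_le1])
  have "((\<lambda>x::real. C / x\<^sup>2) \<longlongrightarrow> 0) at_top" by real_asymp
  then show "((\<lambda>z::complex. C / (norm z)\<^sup>2) \<longlongrightarrow> 0) at_infinity"
    by (rule filterlim_compose) (rule filterlim_norm_at_top)
qed

lemma pcf_D_asymptotic_pos:
  assumes \<nu>: "\<nu> > 0" and \<delta>: "\<delta> > 0"
  shows "((\<lambda>z. pcf_D \<nu> z * z powr of_real \<nu>) \<longlongrightarrow> 1) (sector_filter \<delta>)"
proof -
  \<comment> \<open>With |\<phi>| = \<pi>/4 - d/2 and sign opposite to Arg z, arguments up to
    3\<pi>/4 - d are brought within \<pi>/2 - d/2. The cap \<pi>/4 keeps the angles admissible when
    \<delta> is large.\<close>
  define d where "d = min \<delta> (pi / 4)"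
  have d: "0 < d" "d \<le> \<delta>" "d \<le> pi / 4" using \<delta> by (auto simp: d_def)
  define C where "C = \<nu> * (\<nu> + 1) / (2 * sin (d / 2) powr (\<nu> + 2))"
  have "norm (pcf_D \<nu> z * z powr of_real \<nu> - 1) \<le> C / (norm z)\<^sup>2"
    if z: "z \<noteq> 0" "\<bar>Arg z\<bar> \<le> 3 * pi / 4 - \<delta>" for z
  proof (cases "Arg z \<ge> 0")
    case True
    show ?thesis unfolding C_def
      by (rule pcf_D_sector_bound[where \<phi> = "- (pi / 4 - d / 2)"]) (use True z d \<nu> in auto)
  next
    case False
    show ?thesis unfolding C_def
      by (rule pcf_D_sector_bound[where \<phi> = "pi / 4 - d / 2"]) (use False z d \<nu> in auto)
  qed
  then have "eventually (\<lambda>z. norm (pcf_D \<nu> z * z powr of_real \<nu> - 1) \<le> C / (norm z)\<^sup>2) (sector_filter \<delta>)"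
    by (auto simp: eventually_inf_principal)
  then have "((\<lambda>z. pcf_D \<nu> z * z powr of_real \<nu> - 1) \<longlongrightarrow> 0) (sector_filter \<delta>)"
    by (rule Lim_null_comparison) (rule tendsto_norm_power_sector)
  then show ?thesis by (simp add: LIM_zero_iff)
qed

lemma pcf_D_asymptotic:
  assumes \<delta>: "\<delta> > 0"
  shows "((\<lambda>z. pcf_D \<nu> z * z powr of_real \<nu>) \<longlongrightarrow> 1) (sector_filter \<delta>)"
proof -
  have "\<nu> > - real n \<Longrightarrow> ((\<lambda>z. pcf_D \<nu> z * z powr of_real \<nu>) \<longlongrightarrow> 1) (sector_filter \<delta>)" for n
  proof (induction n arbitrary: \<nu>)
    case 0
    then show ?case using pcf_D_asymptotic_pos[OF _ \<delta>] by simp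
  next
    case (Suc n)
    have L: "((\<lambda>z. pcf_D \<mu> z * z powr of_real \<mu>) \<longlongrightarrow> 1) (sector_filter \<delta>)" if "\<mu> \<ge> \<nu> + 1" for \<mu>
      using Suc that by (intro Suc.IH) auto
    have n0: "((\<lambda>z. 1 / z\<^sup>2) \<longlongrightarrow> 0) (sector_filter \<delta>)"
      by (rule Lim_null_comparison[OF _ tendsto_norm_power_sector[of 1]]) (simp add: norm_divide norm_power)
    \<comment> \<open>After multiplication by z^\<nu> the second term of the recurrence is smaller
      by a factor z^(-2), so the limit comes from the first.\<close>
    have "((\<lambda>z. pcf_D (\<nu> + 1) z * z powr of_real (\<nu> + 1) +
        of_real (\<nu> + 1) * (pcf_D (\<nu> + 2) z * z powr of_real (\<nu> + 2)) * (1 / z\<^sup>2)) \<longlongrightarrow> 1 + of_real (\<nu> + 1) * 1 * 0) (sector_filter \<delta>)"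
      by (intro tendsto_intros n0 L) auto
    moreover have "pcf_D (\<nu> + 1) z * z powr of_real (\<nu> + 1) + of_real (\<nu> + 1) * (pcf_D (\<nu> + 2) z * z powr of_real (\<nu> + 2)) * (1 / z\<^sup>2)
       = pcf_D \<nu> z * z powr of_real \<nu>" if "z \<noteq> 0" for z :: complex
    proof -
      have p1: "z powr of_real (\<nu> + 1) = z powr of_real \<nu> * z" using that by (simp add: powr_add)
      have p2: "z powr of_real (\<nu> + 2) = z powr of_real \<nu> * z\<^sup>2" using that by (simp add: powr_add)
      have "pcf_D \<nu> z = z * pcf_D (\<nu> + 1) z + of_real (\<nu> + 1) * pcf_D (\<nu> + 2) z"
        using pcf_D_rec[of "\<nu> + 1" z] by (simp add: add.assoc)
      then show ?thesis unfolding p1 p2 using that by (simp add: field_simps)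
    qed
    then have "eventually (\<lambda>z. pcf_D (\<nu> + 1) z * z powr of_real (\<nu> + 1) + of_real (\<nu> + 1) * (pcf_D (\<nu> + 2) z * z powr of_real (\<nu> + 2)) * (1 / z\<^sup>2)
       = pcf_D \<nu> z * z powr of_real \<nu>) (sector_filter \<delta>)"
      by (auto simp: eventually_inf_principal)
    ultimately show ?case by (auto elim: Lim_transform_eventually)
  qed
  moreover obtain n :: nat where "- \<nu> < real n" using reals_Archimedean2 by blast
  ultimately show ?thesis by (metis minus_less_iff)
qed

section \<open>The function U, its recurrence and its differential equation\<close>

definition pcf_U :: "real \<Rightarrow> 'a \<Rightarrow> 'a::{real_normed_field,banach}" where
  "pcf_U a z = exp (- z\<^sup>2 / 4) * pcf_D (a + 1/2) z"

lemma has_field_derivative_pcf_U: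
  "(pcf_U a has_field_derivative - z / 2 * pcf_U a z - of_real (a + 1/2) * pcf_U (a + 1) z) (at (z :: 'a::{real_normed_field,banach}))"
proof -
  have e: "a + 1 / 2 + 1 = a + 1 + 1 / 2" by simp
  have "((\<lambda>z. exp (- z\<^sup>2 / 4)) has_field_derivative - z / 2 * exp (- z\<^sup>2 / 4)) (at z)"
    by (auto intro!: derivative_eq_intros simp: field_simps)
  from DERIV_mult[OF this has_field_derivative_pcf_D[of "a + 1/2" z]]
  show ?thesis unfolding pcf_U_def e
    by (rule back_subst[of "\<lambda>d. (_ has_field_derivative d) (at z)"]) (simp add: algebra_simps)
qed

lemma pcf_U_rec: "pcf_U (a - 1) z = z * pcf_U a z + of_real (a + 1/2) * pcf_U (a + 1) (z :: 'a::{real_normed_field,banach})"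
  using pcf_D_rec[of "a + 1/2" z] unfolding pcf_U_def by (simp add: algebra_simps)

lemma has_field_derivative_pcf_U':
  "(pcf_U a has_field_derivative z / 2 * pcf_U a z - pcf_U (a - 1) z) (at (z :: 'a::{real_normed_field,banach}))"
  using has_field_derivative_pcf_U[of a z] by (rule back_subst[of "\<lambda>d. (pcf_U a has_field_derivative d) (at z)"])
    (simp add: pcf_U_rec algebra_simps)

lemma deriv_pcf_U: "deriv (pcf_U a) = (\<lambda>z. z / 2 * pcf_U a z - pcf_U (a - 1) z)"
  using DERIV_imp_deriv[OF has_field_derivative_pcf_U'] by (rule ext)

text \<open>The equation is a composition of the two first-order relations: one lowers the parameter
  to a - 1, the other, applied to \<open>pcf_U (a - 1)\<close>, raises it back, and the terms in
  \<open>pcf_U (a - 1)\<close> cancel.\<close>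

lemma has_field_derivative_deriv_pcf_U:
  "(deriv (pcf_U a) has_field_derivative (z\<^sup>2 / 4 + of_real a) * pcf_U a z) (at (z :: 'a::{real_normed_field,banach}))"
proof -
  have "((\<lambda>z. z / 2 * pcf_U a z - pcf_U (a - 1) z) has_field_derivative
      1 / 2 * pcf_U a z + (z / 2 * pcf_U a z - pcf_U (a - 1) z) * (z / 2) -
      (- z / 2 * pcf_U (a - 1) z - of_real (a - 1 + 1/2) * pcf_U (a - 1 + 1) z)) (at z)"
    by (intro DERIV_diff DERIV_mult has_field_derivative_pcf_U has_field_derivative_pcf_U') (auto intro!: derivative_eq_intros)
  then show ?thesis unfolding deriv_pcf_U
    by (rule back_subst[of "\<lambda>d. (_ has_field_derivative d) (at z)"]) (simp add: field_simps power2_eq_square)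
qed

lemma pcf_U_of_real: "pcf_U a (of_real x) = complex_of_real (pcf_U a x)"
  by (simp add: pcf_U_def pcf_D_of_real flip: exp_of_real)

lemma holomorphic_pcf_U [holomorphic_intros]: "pcf_U a holomorphic_on S"
  by (rule holomorphic_on_subset[of _ UNIV])
    (auto simp: holomorphic_on_def field_differentiable_def intro: has_field_derivative_pcf_U)

lemma is_parabolic_cylinder_U_pcf_U: "is_parabolic_cylinder_U (of_real a) (pcf_U a)"
  unfolding is_parabolic_cylinder_U_def
proof (intro conjI allI impI)
  show "pcf_U a holomorphic_on UNIV" by (rule holomorphic_pcf_U)
  show "deriv (deriv (pcf_U a)) z - (z\<^sup>2 / 4 + of_real a) * pcf_U a z = 0" for z :: complex
    using DERIV_imp_deriv[OF has_field_derivative_deriv_pcf_U[of a z]] by simp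
next
  fix \<delta> :: real assume \<delta>: "\<delta> > 0"
  let ?g = "\<lambda>z::complex. z powr (- of_real a - 1/2) * exp (- z\<^sup>2 / 4)"
  have "pcf_D (a + 1/2) z * z powr of_real (a + 1/2) = pcf_U a z / ?g z" if "z \<noteq> 0" for z :: complex
  proof -
    have "- complex_of_real a - 1/2 = - of_real (a + 1/2)" by simp
    then show ?thesis using that by (simp only: powr_minus pcf_U_def) (simp add: field_simps)
  qed
  then have "eventually (\<lambda>z. pcf_D (a + 1/2) z * z powr of_real (a + 1/2) = pcf_U a z / ?g z) (sector_filter \<delta>)"
    by (auto simp: eventually_inf_principal)
  from Lim_transform_eventually[OF pcf_D_asymptotic[OF \<delta>] this]
  show "pcf_U a \<sim>[sector_filter \<delta>] ?g" by (rule asymp_equivI')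
qed

subsection \<open>Uniqueness\<close>

lemma wronskian_constant:
  fixes f g :: "complex \<Rightarrow> complex"
  assumes f: "f holomorphic_on UNIV" "\<And>z. deriv (deriv f) z = p z * f z"
    and g: "g holomorphic_on UNIV" "\<And>z. deriv (deriv g) z = p z * g z"
  shows "wronskian f g z = wronskian f g w"
proof -
  have d: "(h has_field_derivative deriv h z) (at z)" if "h holomorphic_on UNIV" for h :: "complex \<Rightarrow> complex" and z
    using that by (auto intro: holomorphic_derivI)
  have d': "(deriv h has_field_derivative p z * h z) (at z)"
    if "h holomorphic_on UNIV" "\<And>z. deriv (deriv h) z = p z * h z" for h :: "complex \<Rightarrow> complex" and z
    using d[OF holomorphic_deriv[OF that(1) open_UNIV], of z] by (simp add: that(2))
  have "(wronskian f g has_field_derivative 0) (at z within UNIV)" for z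
    unfolding wronskian_def
    using DERIV_diff[OF DERIV_mult[OF d[OF f(1)] d'[OF g]] DERIV_mult[OF d'[OF f] d[OF g(1)]], of z]
    by (simp add: algebra_simps)
  then obtain c where "\<forall>z. wronskian f g z = c"
    using has_field_derivative_zero_constant[of UNIV "wronskian f g"] by auto
  then show ?thesis by simp
qed

lemma filterlim_of_real_sector:
  assumes "\<delta> \<le> 3 * pi / 4"
  shows "filterlim complex_of_real (sector_filter \<delta>) at_top"
proof (rule filterlim_inf[THEN iffD2], intro conjI)
  show "filterlim complex_of_real at_infinity at_top"
    by (rule filterlim_of_real_at_infinity)
  have "eventually (\<lambda>x::real. x > 0) at_top" by (rule eventually_gt_at_top)
  then show "filterlim complex_of_real (principal {z. z \<noteq> 0 \<and> \<bar>Arg z\<bar> \<le> 3 * pi / 4 - \<delta>}) at_top"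
    unfolding filterlim_principal by eventually_elim (use assms in \<open>auto simp: Arg_of_real\<close>)
qed

text \<open>Comparison on the positive axis decides: for v = y - w the quotient q = v/w tends to 0,
  while q' = -W/w^2 with the constant Wronskian W of v and w. As w is recessive, 1/w^2 is large with
  positive real part, and W \<noteq> 0 would force q to grow.\<close>

lemma is_parabolic_cylinder_U_unique:
  assumes y: "is_parabolic_cylinder_U (of_real a) y" and w: "is_parabolic_cylinder_U (of_real a) w"
  shows "y = w"
proof -
  define g where "g = (\<lambda>x::real. x powr (- a - 1/2) * exp (- x\<^sup>2 / 4))"
  have ratio: "((\<lambda>x. u (complex_of_real x) / of_real (g x)) \<longlongrightarrow> 1) at_top"
    if u: "is_parabolic_cylinder_U (of_real a) u" for u
  proof -
    let ?F = "\<lambda>z::complex. z powr (- of_real a - 1/2) * exp (- z\<^sup>2 / 4)"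
    have "u \<sim>[sector_filter 1] ?F"
      by (rule u[unfolded is_parabolic_cylinder_U_def, THEN conjunct2, THEN conjunct2, rule_format]) simp
    then have "((\<lambda>z. if u z = 0 \<and> ?F z = 0 then 1 else u z / ?F z) \<longlongrightarrow> 1) (sector_filter 1)"
      by (rule asymp_equivD)
    from filterlim_compose[OF this filterlim_of_real_sector]
    have "((\<lambda>x. if u (of_real x) = 0 \<and> ?F (of_real x) = 0 then 1 else u (of_real x) / ?F (of_real x)) \<longlongrightarrow> 1) at_top"
      using pi_gt3 by simp
    moreover have "eventually (\<lambda>x. (if u (of_real x) = 0 \<and> ?F (of_real x) = 0 then 1 else u (of_real x) / ?F (of_real x)) =
        u (complex_of_real x) / of_real (g x)) at_top"
      using eventually_gt_at_top[of "0::real"]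
    proof eventually_elim
      case (elim x)
      have "complex_of_real x powr of_real (- a - 1/2) = of_real (x powr (- a - 1/2))"
        using elim by (intro powr_of_real) auto
      then have "?F (of_real x) = of_real (g x)"
        by (simp add: g_def flip: exp_of_real)
      moreover have "g x \<noteq> 0" using elim by (simp add: g_def)
      ultimately show ?case by simp
    qed
    ultimately show ?thesis by (rule Lim_transform_eventually)
  qed
  have hol: "y holomorphic_on UNIV" "w holomorphic_on UNIV"
    using y w by (auto simp: is_parabolic_cylinder_U_def)
  define v where "v = (\<lambda>z. y z - w z)"
  have dy: "(y has_field_derivative deriv y z) (at z)" and dw: "(w has_field_derivative deriv w z) (at z)" for z
    using hol by (auto intro: holomorphic_derivI)
  have dv: "(v has_field_derivative deriv y z - deriv w z) (at z)" for z
    unfolding v_def by (intro DERIV_diff dy dw)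
  have v_hol: "v holomorphic_on UNIV" unfolding v_def by (intro holomorphic_intros hol)
  have deriv_v: "deriv v = (\<lambda>z. deriv y z - deriv w z)" using DERIV_imp_deriv[OF dv] by (rule ext)
  have ddv: "deriv (deriv v) z = (z\<^sup>2 / 4 + of_real a) * v z" for z
  proof -
    have "deriv (deriv v) z = deriv (deriv y) z - deriv (deriv w) z"
      unfolding deriv_v by (intro deriv_diff) (auto intro!: holomorphic_on_imp_differentiable_at[of _ UNIV] holomorphic_deriv hol)
    also have "\<dots> = (z\<^sup>2 / 4 + of_real a) * y z - (z\<^sup>2 / 4 + of_real a) * w z"
      using y w by (simp add: is_parabolic_cylinder_U_def)
    finally show ?thesis by (simp add: fun_cong[OF v_def] right_diff_distrib)
  qed
  have ddw: "deriv (deriv w) z = (z\<^sup>2 / 4 + of_real a) * w z" for z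
    using w by (simp add: is_parabolic_cylinder_U_def)
  define W where "W = wronskian v w 0"
  have W: "v z * deriv w z - deriv v z * w z = W" for z
    using wronskian_constant[OF v_hol ddv hol(2) ddw, of z 0] by (simp add: W_def wronskian_def)
  have rw: "((\<lambda>x. w (complex_of_real x) / of_real (g x)) \<longlongrightarrow> 1) at_top" by (rule ratio[OF w])
  have ev_nz: "eventually (\<lambda>x. w (complex_of_real x) \<noteq> 0) at_top"
    using tendsto_imp_eventually_ne[OF rw one_neq_zero] by eventually_elim auto
  define q where "q = (\<lambda>x::real. v (of_real x) / w (of_real x))"
  have q0: "(q \<longlongrightarrow> 0) at_top"
  proof -
    have "((\<lambda>x. (y (complex_of_real x) / of_real (g x)) / (w (complex_of_real x) / of_real (g x)) - 1) \<longlongrightarrow> 1 / 1 - 1) at_top"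
      by (intro tendsto_intros ratio y w) auto
    moreover have "eventually (\<lambda>x. (y (complex_of_real x) / of_real (g x)) / (w (complex_of_real x) / of_real (g x)) - 1 = q x) at_top"
      using eventually_conj[OF ev_nz eventually_gt_at_top[of 0]]
    proof eventually_elim
      case (elim x)
      then have "g x \<noteq> 0" by (simp add: g_def)
      then show ?case using elim by (simp add: q_def v_def field_simps)
    qed
    ultimately show ?thesis using Lim_transform_eventually by fastforce
  qed
  obtain X where X: "\<And>x. x \<ge> X \<Longrightarrow> w (complex_of_real x) \<noteq> 0"
    using ev_nz unfolding eventually_at_top_linorder by blast
  have dq: "(q has_vector_derivative - W / (w (of_real x))\<^sup>2) (at x)" if "x \<ge> X" for x
  proof -
    have "((\<lambda>z. v z / w z) has_field_derivative (deriv v (of_real x) * w (of_real x) - v (of_real x) * deriv w (of_real x)) / (w (of_real x) * w (of_real x))) (at (of_real x))"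
      using X[OF that] dv[of "of_real x"] by (intro DERIV_divide dw) (auto simp: deriv_v)
    also have "deriv v (of_real x) * w (of_real x) - v (of_real x) * deriv w (of_real x) = - W"
      using W[of "of_real x"] by (metis minus_diff_eq)
    finally show ?thesis unfolding q_def power2_eq_square by (rule has_vector_derivative_real_field)
  qed
  have W0: "W = 0"
  proof (rule ccontr)
    assume W: "W \<noteq> 0"
    \<comment> \<open>Division by -W leaves the derivative Re(1/w^2). It is eventually at least 1/2,
      because (w/g)^2 tends to 1 and g < 1, so r(x) - x/2 is eventually nondecreasing.\<close>
    define r where "r = (\<lambda>x. Re (q x / (- W)))"
    have r': "(r has_real_derivative Re (1 / (w (of_real x))\<^sup>2)) (at x)" if "x \<ge> X" for x
    proof -
      have "((\<lambda>x. Re (q x / (- W))) has_vector_derivative Re ((- W / (w (of_real x))\<^sup>2) / (- W))) (at x)"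
        by (intro bounded_linear.has_vector_derivative[OF bounded_linear_Re]
            bounded_linear.has_vector_derivative[OF bounded_linear_divide] dq that)
      then show ?thesis using W by (simp add: r_def has_real_derivative_iff_has_vector_derivative)
    qed
    have "((\<lambda>x. Re (1 / (w (complex_of_real x) / of_real (g x))\<^sup>2)) \<longlongrightarrow> Re (1 / 1\<^sup>2)) at_top"
      by (intro tendsto_intros rw) auto
    then have "eventually (\<lambda>x. Re (1 / (w (complex_of_real x) / of_real (g x))\<^sup>2) > 1/2) at_top"
      by (rule order_tendstoD) auto
    moreover have "(g \<longlongrightarrow> 0) at_top" unfolding g_def by real_asymp
    then have "eventually (\<lambda>x. g x < 1) at_top" by (rule order_tendstoD) auto
    ultimately have "eventually (\<lambda>x. Re (1 / (w (complex_of_real x))\<^sup>2) \<ge> 1/2) at_top"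
      using eventually_gt_at_top[of 0]
    proof eventually_elim
      case (elim x)
      have g: "0 < g x" using elim by (simp add: g_def)
      have "1 / (w (of_real x))\<^sup>2 = of_real (1 / (g x)\<^sup>2) * (1 / (w (complex_of_real x) / of_real (g x))\<^sup>2)"
        using g by (simp add: field_simps)
      then have "Re (1 / (w (of_real x))\<^sup>2) = 1 / (g x)\<^sup>2 * Re (1 / (w (complex_of_real x) / of_real (g x))\<^sup>2)"
        by (simp only: scaleR_complex.sel flip: scaleR_conv_of_real)
      moreover have "1 / (g x)\<^sup>2 \<ge> 1" using g elim by (simp add: power_le_one)
      ultimately show ?case
        using elim mult_right_mono[of 1 "1 / (g x)\<^sup>2" "Re (1 / (w (complex_of_real x) / of_real (g x))\<^sup>2)"] by linarith
    qed
    then obtain Y where Y: "\<And>x. x \<ge> Y \<Longrightarrow> Re (1 / (w (complex_of_real x))\<^sup>2) \<ge> 1/2"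
      unfolding eventually_at_top_linorder by blast
    define Z where "Z = max X Y"
    have mono: "r Z - Z / 2 \<le> r x - x / 2" if "x \<ge> Z" for x
    proof (rule DERIV_nonneg_imp_nondecreasing[OF that])
      fix t assume t: "Z \<le> t" "t \<le> x"
      show "\<exists>d. ((\<lambda>x. r x - x / 2) has_real_derivative d) (at t) \<and> 0 \<le> d"
        using Y[of t] r'[of t] t by (intro exI[of _ "Re (1 / (w (of_real t))\<^sup>2) - 1/2"])
          (auto simp: Z_def intro!: derivative_eq_intros)
    qed
    have "((\<lambda>x. r x) \<longlongrightarrow> Re (0 / (- W))) at_top"
      unfolding r_def using W by (intro tendsto_intros q0) auto
    then have "eventually (\<lambda>x. r x < 1) at_top" by (rule order_tendstoD) auto
    moreover have "eventually (\<lambda>x. x \<ge> Z) at_top" "eventually (\<lambda>x. x > 2 * (1 - r Z + Z / 2)) at_top"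
      by (rule eventually_ge_at_top eventually_gt_at_top)+
    ultimately have "eventually (\<lambda>x::real. False) at_top"
      by eventually_elim (use mono in fastforce)
    then show False by simp
  qed
  have "(q has_vector_derivative 0) (at x within {X..})" if "x \<in> {X..}" for x
    using dq[of x] W0 that by (auto intro: has_vector_derivative_at_within)
  then obtain c where "\<And>x. x \<in> {X..} \<Longrightarrow> q x = c"
    using has_vector_derivative_zero_constant[of "{X..}" q] by auto
  then have qX: "q x = q X" if "x \<ge> X" for x using that by auto
  then have "eventually (\<lambda>x. q x = q X) at_top" using qX unfolding eventually_at_top_linorder by blast
  then have "(q \<longlongrightarrow> q X) at_top" by (rule tendsto_eventually)
  then have "q X = 0" using q0 tendsto_unique[OF trivial_limit_at_top_linorder] by blast
  then have v0: "v (of_real x) = 0" if "x \<ge> X" for x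
    using qX[OF that] X[OF that] \<open>q X = 0\<close> by (simp only: q_def) simp
  have "v z = 0" for z
  proof (rule analytic_continuation[OF v_hol])
    \<comment> \<open>The zeros of v fill a ray, a connected set with more than one point, so its
      points are accumulation points and the identity theorem applies.\<close>
    show "complex_of_real X islimpt (complex_of_real ` {X..})"
    proof (rule connected_imp_perfect)
      show "connected (complex_of_real ` {X..})"
        by (intro connected_continuous_image continuous_intros convex_connected) simp
      show "complex_of_real ` {X..} \<noteq> {a}" for a
      proof
        assume "complex_of_real ` {X..} = {a}"
        then have "complex_of_real X = complex_of_real (X + 1)"
          by (metis atLeast_iff imageI less_add_one less_imp_le order_refl singletonD)
        then show False by simp
      qed
    qed auto
  qed (use v0 in auto)
  then show ?thesis by (auto simp: v_def fun_eq_iff)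
qed

lemma parabolic_cylinder_U_of_real: "parabolic_cylinder_U (of_real a) = pcf_U a"
  unfolding parabolic_cylinder_U_def
  by (intro the_equality is_parabolic_cylinder_U_pcf_U is_parabolic_cylinder_U_unique[OF _ is_parabolic_cylinder_U_pcf_U])

lemma U_sol_of_real: "U_sol j (of_real a) z = pcf_U ((-1) ^ j * a) ((- \<i>) ^ j * z)"
  using parabolic_cylinder_U_of_real[of "(-1) ^ j * a"] by (simp add: U_sol_def)

subsection \<open>Moments\<close>

text \<open>Moments are used in two forms: as integrals over the half-line, for dominated
  convergence, and as limits of finite integrals, for the fundamental theorem of calculus and for
  integrals from infinity.\<close>

lemma exp_bounded_integral_at_top:
  fixes f :: "real \<Rightarrow> real"
  assumes cont: "continuous_on {0..} f" and bound: "\<And>t. t \<ge> 0 \<Longrightarrow> \<bar>f t\<bar> \<le> C * exp (- t)"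
  shows "f integrable_on {0..}" and "((\<lambda>r. integral {0..r} f) \<longlongrightarrow> integral {0..} f) at_top"
proof -
  have E: "((\<lambda>t::real. C * exp (- 1 * t)) has_integral C * (exp (- 1 * r) / 1)) {r..}" for r
    by (intro has_integral_mult_right has_integral_exp_minus_to_infinity) simp
  show int: "f integrable_on {0..}"
  proof (rule measurable_bounded_by_integrable_imp_integrable)
    show "f \<in> borel_measurable (lebesgue_on {0..})"
      by (rule continuous_imp_measurable_on_sets_lebesgue[OF cont]) simp
    show "(\<lambda>t. C * exp (- 1 * t)) integrable_on {0..}" using E[of 0] by (auto simp: has_integral_integrable)
  qed (use bound in auto)
  have "norm (integral {0..r} f - integral {0..} f) \<le> C * exp (- r)" if r: "r \<ge> 0" for r
  proof -
    have i2: "f integrable_on {r..}"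
    proof (rule measurable_bounded_by_integrable_imp_integrable)
      show "f \<in> borel_measurable (lebesgue_on {r..})"
        by (rule continuous_imp_measurable_on_sets_lebesgue[OF continuous_on_subset[OF cont]]) (use r in auto)
      show "(\<lambda>t. C * exp (- 1 * t)) integrable_on {r..}" using E[of r] by (auto simp: has_integral_integrable)
    qed (use bound r in auto)
    have i1: "f integrable_on {0..r}"
      by (rule integrable_continuous_interval[OF continuous_on_subset[OF cont]]) auto
    have "(f has_integral integral {0..r} f + integral {r..} f) ({0..r} \<union> {r..})"
    proof (rule has_integral_Un)
      have "{0..r} \<inter> {r..} = {r}" using r by auto
      then show "negligible ({0..r} \<inter> {r..})" by simp
    qed (use i1 i2 in \<open>auto simp: has_integral_integral\<close>)
    moreover have "{0..r} \<union> {r..} = {0..}" using r by auto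
    ultimately have "integral {0..r} f - integral {0..} f = - integral {r..} f" by (simp add: integral_unique)
    moreover have "norm (integral {r..} f) \<le> integral {r..} (\<lambda>t. C * exp (- 1 * t))"
      by (rule integral_norm_bound_integral[OF i2]) (use E[of r] bound r in \<open>auto simp: has_integral_integrable\<close>)
    moreover have "integral {r..} (\<lambda>t. C * exp (- 1 * t)) = C * exp (- r)" using integral_unique[OF E[of r]] by simp
    ultimately show ?thesis by (simp only: norm_minus_cancel)
  qed
  then have "eventually (\<lambda>r. norm (integral {0..r} f - integral {0..} f) \<le> C * exp (- r)) at_top"
    unfolding eventually_at_top_linorder by blast
  moreover have "((\<lambda>r::real. C * exp (- r)) \<longlongrightarrow> 0) at_top" by real_asymp
  ultimately have "((\<lambda>r. integral {0..r} f - integral {0..} f) \<longlongrightarrow> 0) at_top"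
    by (rule Lim_null_comparison)
  then show "((\<lambda>r. integral {0..r} f) \<longlongrightarrow> integral {0..} f) at_top" by (simp add: LIM_zero_iff)
qed

lemma has_integral_pcf_D_real:
  fixes x :: real
  assumes "\<nu> > 0"
  shows "((\<lambda>t. t powr (\<nu> - 1) * exp (- t\<^sup>2 / 2) * exp (- (x * t))) has_integral Gamma \<nu> * pcf_D \<nu> x) {0<..}"
proof -
  have "((\<lambda>t. complex_of_real (t powr (\<nu> - 1) * exp (- t\<^sup>2 / 2) * exp (- (x * t)))) has_integral complex_of_real (Gamma \<nu> * pcf_D \<nu> x)) {0<..}"
    using has_integral_pcf_D[of \<nu> 0 "of_real x"] assms
    by (simp add: Gamma_complex_of_real pcf_D_of_real flip: exp_of_real)
  from has_integral_linear[OF this bounded_linear_Re] show ?thesis by (simp add: o_def)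
qed

text \<open>The Laplace integrand is nonnegative and decreasing in x, so the value at x = 0 is the
  largest.\<close>

lemma pcf_D_bound_pos:
  fixes x :: real
  assumes \<nu>: "\<nu> > 0" and x: "x \<ge> 0"
  shows "\<bar>pcf_D \<nu> x\<bar> \<le> pcf_h \<nu>"
proof -
  have G: "Gamma \<nu> > 0" using \<nu> by (rule Gamma_real_pos)
  have "0 \<le> Gamma \<nu> * pcf_D \<nu> x"
    by (rule has_integral_nonneg[OF has_integral_pcf_D_real[OF \<nu>]]) auto
  moreover have "Gamma \<nu> * pcf_D \<nu> x \<le> Gamma \<nu> * pcf_D \<nu> (0::real)"
    by (rule has_integral_le[OF has_integral_pcf_D_real[OF \<nu>] has_integral_pcf_D_real[OF \<nu>]])
      (use x in \<open>auto intro!: mult_left_le\<close>)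
  ultimately show ?thesis using G by (simp add: pcf_D_0 zero_le_mult_iff)
qed

lemma power_times_exp_neg_square_le:
  fixes t :: real
  assumes t: "t \<ge> 0"
  shows "t ^ R * exp (- t\<^sup>2 / 4) \<le> fact R * exp 4 * exp (- t)"
proof -
  have "(\<lambda>k. t ^ k /\<^sub>R fact k) sums exp t" by (rule exp_converges)
  then have "t ^ R /\<^sub>R fact R \<le> exp t"
    using sum_le_suminf[of "\<lambda>k. t ^ k /\<^sub>R fact k" "{R}"] t by (auto simp: sums_iff)
  then have "t ^ R \<le> fact R * exp t" by (simp add: field_simps)
  then have "t ^ R * exp (- t\<^sup>2 / 4) \<le> fact R * exp t * exp (- t\<^sup>2 / 4)" by (intro mult_right_mono) auto
  also have "\<dots> = fact R * exp (t - t\<^sup>2 / 4)"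
    by (simp only: mult.assoc exp_add[symmetric]) simp
  also have "\<dots> \<le> fact R * exp (4 - t)"
  proof -
    \<comment> \<open>The square is t^2/4 - 2t + 4; this is the origin of the constant
      \<open>exp 4\<close>.\<close>
    have "0 \<le> (t / 2 - 2)\<^sup>2" by simp
    then have "t - t\<^sup>2 / 4 \<le> 4 - t" by (simp add: power2_eq_square algebra_simps)
    then show ?thesis by simp
  qed
  finally show ?thesis by (simp add: exp_diff exp_minus field_simps)
qed

lemma continuous_on_pcf_U [continuous_intros]:
  assumes "continuous_on S f" "continuous_on S g"
  shows "continuous_on S (\<lambda>x. pcf_U (f x) (g x :: 'a::{real_normed_field,banach}))"
proof -
  have "continuous_on S (\<lambda>x. - (g x)\<^sup>2 / (4::'a))" using assms by (intro continuous_intros) auto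
  then show ?thesis unfolding pcf_U_def
    by (intro continuous_on_mult continuous_on_exp continuous_on_pcf_D continuous_on_add continuous_on_const assms)
qed

text \<open>One constant for a whole interval of parameters, as continuity of the moments in a
  requires. The induction descends in a through the recurrence, whose factor t raises the power by
  one; hence R and the interval vary in it.\<close>

lemma pcf_U_moment_bound:
  shows "\<exists>C. \<forall>a\<in>{\<alpha>..\<beta>}. \<forall>t\<ge>0. \<bar>t ^ R * pcf_U a t\<bar> \<le> C * exp (- t :: real)"
proof -
  have "\<alpha> > - 1/2 - real n \<Longrightarrow> \<exists>C. \<forall>a\<in>{\<alpha>..\<beta>}. \<forall>t\<ge>0. \<bar>t ^ R * pcf_U a t\<bar> \<le> C * exp (- t :: real)" for n
  proof (induction n arbitrary: \<alpha> \<beta> R)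
    case 0
    have "bounded ((\<lambda>a. pcf_h (a + 1/2)) ` {\<alpha>..\<beta>})"
      by (intro compact_imp_bounded compact_continuous_image continuous_intros) auto
    then obtain B where B: "\<And>a. a \<in> {\<alpha>..\<beta>} \<Longrightarrow> \<bar>pcf_h (a + 1/2)\<bar> \<le> B"
      unfolding bounded_iff real_norm_def by blast
    show ?case
    proof (intro exI[of _ "B * (fact R * exp 4)"] ballI allI impI)
      fix a t :: real assume a: "a \<in> {\<alpha>..\<beta>}" and t: "t \<ge> 0"
      have D: "\<bar>pcf_D (a + 1/2) t\<bar> \<le> B"
        using pcf_D_bound_pos[of "a + 1/2" t] a t 0 B[OF a] by auto
      have "\<bar>pcf_D (a + 1/2) t\<bar> * (t ^ R * exp (- t\<^sup>2 / 4)) \<le> B * (fact R * exp 4 * exp (- t))"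
        by (rule mult_mono[OF D power_times_exp_neg_square_le[OF t]])
          (use t order_trans[OF abs_ge_zero D] in auto)
      then show "\<bar>t ^ R * pcf_U a t\<bar> \<le> B * (fact R * exp 4) * exp (- t)"
        using t by (simp add: pcf_U_def abs_mult mult_ac)
    qed
  next
    case (Suc n)
    obtain C1 where C1: "\<And>a t. a \<in> {\<alpha> + 1..\<beta> + 1} \<Longrightarrow> t \<ge> 0 \<Longrightarrow> \<bar>t ^ Suc R * pcf_U a t\<bar> \<le> C1 * exp (- t :: real)"
    proof -
      have "\<alpha> + 1 > - 1/2 - real n" using Suc.prems by simp
      from Suc.IH[OF this, of "\<beta> + 1" "Suc R"] that show ?thesis by blast
    qed
    obtain C2 where C2: "\<And>a t. a \<in> {\<alpha> + 2..\<beta> + 2} \<Longrightarrow> t \<ge> 0 \<Longrightarrow> \<bar>t ^ R * pcf_U a t\<bar> \<le> C2 * exp (- t :: real)"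
    proof -
      have "\<alpha> + 2 > - 1/2 - real n" using Suc.prems by simp
      from Suc.IH[OF this, of "\<beta> + 2" R] that show ?thesis by blast
    qed
    show ?case
    proof (intro exI[of _ "C1 + (\<bar>\<alpha>\<bar> + \<bar>\<beta>\<bar> + 3/2) * C2"] ballI allI impI)
      fix a t :: real assume a: "a \<in> {\<alpha>..\<beta>}" and t: "t \<ge> 0"
      have "t ^ R * pcf_U a t = t ^ Suc R * pcf_U (a + 1) t + (a + 3/2) * (t ^ R * pcf_U (a + 2) t)"
        using pcf_U_rec[of "a + 1" t] by (simp add: algebra_simps)
      also have "\<bar>\<dots>\<bar> \<le> \<bar>t ^ Suc R * pcf_U (a + 1) t\<bar> + \<bar>a + 3/2\<bar> * \<bar>t ^ R * pcf_U (a + 2) t\<bar>"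
        by (rule order_trans[OF abs_triangle_ineq]) (simp add: abs_mult)
      also have "\<dots> \<le> C1 * exp (- t) + (\<bar>\<alpha>\<bar> + \<bar>\<beta>\<bar> + 3/2) * (C2 * exp (- t))"
        using a t by (intro add_mono mult_mono C1 C2) auto
      finally show "\<bar>t ^ R * pcf_U a t\<bar> \<le> (C1 + (\<bar>\<alpha>\<bar> + \<bar>\<beta>\<bar> + 3/2) * C2) * exp (- t)"
        by (simp add: algebra_simps)
    qed
  qed
  moreover obtain n :: nat where "- 1/2 - \<alpha> < real n" using reals_Archimedean2 by blast
  then have "\<alpha> > - 1/2 - real n" by simp
  ultimately show ?thesis by blast
qed

definition pcf_M :: "nat \<Rightarrow> real \<Rightarrow> real" where
  "pcf_M R a = integral {0..} (\<lambda>t::real. t ^ R * pcf_U a t)"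

lemma continuous_on_moment_integrand: "continuous_on S (\<lambda>t::real. t ^ R * pcf_U a t)"
  by (intro continuous_intros)

lemma moment_integrable: "(\<lambda>t::real. t ^ R * pcf_U a t) integrable_on {0..}"
  and moment_tendsto: "((\<lambda>r. integral {0..r} (\<lambda>t. t ^ R * pcf_U a t)) \<longlongrightarrow> pcf_M R a) at_top"
proof -
  obtain C where "\<And>t. t \<ge> 0 \<Longrightarrow> \<bar>t ^ R * pcf_U a t\<bar> \<le> C * exp (- t :: real)"
    using pcf_U_moment_bound[of a a R] by auto
  note * = exp_bounded_integral_at_top[of "\<lambda>t. t ^ R * pcf_U a t" C, OF continuous_on_moment_integrand this]
  show "(\<lambda>t::real. t ^ R * pcf_U a t) integrable_on {0..}" by (rule *)
  show "((\<lambda>r. integral {0..r} (\<lambda>t. t ^ R * pcf_U a t)) \<longlongrightarrow> pcf_M R a) at_top"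
    unfolding pcf_M_def by (rule *)
qed

lemma continuous_on_pcf_M: "continuous_on {\<alpha>..\<beta>} (pcf_M R)"
  unfolding continuous_on_sequentially
proof (intro ballI allI impI, elim conjE)
  fix x :: "nat \<Rightarrow> real" and a assume a: "a \<in> {\<alpha>..\<beta>}" "\<forall>n. x n \<in> {\<alpha>..\<beta>}" and lim: "x \<longlonglongrightarrow> a"
  obtain C where C: "\<And>a t. a \<in> {\<alpha>..\<beta>} \<Longrightarrow> t \<ge> 0 \<Longrightarrow> \<bar>t ^ R * pcf_U a t\<bar> \<le> C * exp (- t :: real)"
    using pcf_U_moment_bound[of \<alpha> \<beta> R] by blast
  show "(pcf_M R \<circ> x) \<longlonglongrightarrow> pcf_M R a"
    unfolding o_def pcf_M_def
  proof (rule dominated_convergence)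
    show "(\<lambda>t::real. t ^ R * pcf_U (x n) t) integrable_on {0..}" for n by (rule moment_integrable)
    show "(\<lambda>t. C * exp (- 1 * t)) integrable_on {0..}"
      by (intro integrable_on_mult_right integrable_on_exp_minus_to_infinity) simp
    show "norm (t ^ R * pcf_U (x n) t) \<le> C * exp (- 1 * t)" if "t \<in> {0..}" for n t
      using C a that by auto
    show "(\<lambda>n. t ^ R * pcf_U (x n) t) \<longlonglongrightarrow> t ^ R * pcf_U a t" for t :: real
    proof -
      have "continuous_on UNIV (\<lambda>a. t ^ R * pcf_U a t)" by (intro continuous_intros)
      from continuous_on_tendsto_compose[OF this lim] show ?thesis by simp
    qed
  qed
qed

lemma isCont_pcf_M: "isCont (pcf_M R) a"
  using continuous_on_interior[OF continuous_on_pcf_M[of "a - 1" "a + 1" R], of a] by simp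

lemma moment_tendsto_0: "((\<lambda>t. t ^ R * pcf_U a t) \<longlongrightarrow> (0::real)) at_top"
proof -
  obtain C where C: "\<And>t. t \<ge> 0 \<Longrightarrow> \<bar>t ^ R * pcf_U a t\<bar> \<le> C * exp (- t :: real)"
    using pcf_U_moment_bound[of a a R] by auto
  have "((\<lambda>r::real. C * exp (- r)) \<longlongrightarrow> 0) at_top" by real_asymp
  moreover have "eventually (\<lambda>t. norm (t ^ R * pcf_U a t) \<le> C * exp (- t)) at_top"
    unfolding eventually_at_top_linorder using C by (intro exI[of _ 0]) auto
  ultimately show ?thesis by (rule Lim_null_comparison[rotated])
qed

lemma pcf_U_0: "pcf_U a 0 = of_real (pcf_h (a + 1/2))"
  by (simp add: pcf_U_def pcf_D_0)

section \<open>Recurrences for the moments\<close>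

lemma pcf_M_down: "pcf_M R (a - 1) = pcf_M (Suc R) a + (a + 1/2) * pcf_M R (a + 1)"
proof -
  have "pcf_M R (a - 1) = integral {0..} (\<lambda>t. t ^ Suc R * pcf_U a t + (a + 1/2) * (t ^ R * pcf_U (a + 1) t))"
    unfolding pcf_M_def by (rule integral_cong) (simp add: pcf_U_rec algebra_simps)
  also have "\<dots> = pcf_M (Suc R) a + (a + 1/2) * pcf_M R (a + 1)"
    unfolding pcf_M_def
    by (subst Henstock_Kurzweil_Integration.integral_add) (auto intro!: moment_integrable integrable_on_mult_right simp del: power_Suc)
  finally show ?thesis .
qed

text \<open>Obtained by integrating the derivative of t^R U(a, t). The boundary term at 0 survives
  only for R = 0, where it takes the place of R M_(R-1).\<close>

lemma pcf_M_up:
  "pcf_M (Suc R) a = 2 * (if R = 0 then pcf_h (a + 1/2) else real R * pcf_M (R - 1) a) - (2 * a + 1) * pcf_M R (a + 1)"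
proof -
  \<comment> \<open>For R = 0 the index \<open>R - 1\<close> is truncated to 0, but its coefficient
    vanishes.\<close>
  let ?F' = "\<lambda>t. real R * (t ^ (R - 1) * pcf_U a t) + (- 1 / 2) * (t ^ Suc R * pcf_U a t) + (- (a + 1/2)) * (t ^ R * pcf_U (a + 1) t)"
  have d: "((\<lambda>t. t ^ R * pcf_U a t) has_real_derivative ?F' t) (at t within S)" for t S
  proof -
    have "((\<lambda>t. t ^ R * pcf_U a t) has_real_derivative real R * t ^ (R - 1) * pcf_U a t + (- t / 2 * pcf_U a t - of_real (a + 1/2) * pcf_U (a + 1) t) * t ^ R) (at t within S)"
      using DERIV_mult[OF DERIV_pow[of R t S] has_field_derivative_at_within[OF has_field_derivative_pcf_U[of a t]]]
      by simp
    then show ?thesis by (rule back_subst[of "\<lambda>d. (_ has_real_derivative d) _"]) (simp add: algebra_simps)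
  qed
  have "integral {0..r} ?F' = r ^ R * pcf_U a r - 0 ^ R * pcf_U a 0" if "r \<ge> 0" for r
    by (intro integral_unique fundamental_theorem_of_calculus that)
      (simp only: has_real_derivative_iff_has_vector_derivative[symmetric] d)
  moreover have "integral {0..r} ?F' = real R * integral {0..r} (\<lambda>t. t ^ (R - 1) * pcf_U a t) +
     (- 1 / 2) * integral {0..r} (\<lambda>t. t ^ Suc R * pcf_U a t) + (- (a + 1/2)) * integral {0..r} (\<lambda>t. t ^ R * pcf_U (a + 1) t)" for r :: real
  proof -
    have i: "(\<lambda>t. t ^ n * pcf_U b t) integrable_on {0..r}" for n b
      by (intro integrable_continuous_interval continuous_on_moment_integrand)
    show ?thesis
      by (simp only: Henstock_Kurzweil_Integration.integral_add integrable_add integrable_on_mult_right i integral_mult_right)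
  qed
  ultimately have "eventually (\<lambda>r. real R * integral {0..r} (\<lambda>t. t ^ (R - 1) * pcf_U a t) +
     (- 1 / 2) * integral {0..r} (\<lambda>t. t ^ Suc R * pcf_U a t) + (- (a + 1/2)) * integral {0..r} (\<lambda>t. t ^ R * pcf_U (a + 1) t)
     = r ^ R * pcf_U a r - 0 ^ R * pcf_U a 0) at_top"
    unfolding eventually_at_top_linorder by (intro exI[of _ 0]) simp
  moreover have "((\<lambda>r. real R * integral {0..r} (\<lambda>t. t ^ (R - 1) * pcf_U a t) +
     (- 1 / 2) * integral {0..r} (\<lambda>t. t ^ Suc R * pcf_U a t) + (- (a + 1/2)) * integral {0..r} (\<lambda>t. t ^ R * pcf_U (a + 1) t))
     \<longlongrightarrow> real R * pcf_M (R - 1) a + (- 1 / 2) * pcf_M (Suc R) a + (- (a + 1/2)) * pcf_M R (a + 1)) at_top"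
    by (intro tendsto_intros moment_tendsto)
  ultimately have "((\<lambda>r. r ^ R * pcf_U a r - 0 ^ R * pcf_U a 0) \<longlongrightarrow>
      real R * pcf_M (R - 1) a + (- 1 / 2) * pcf_M (Suc R) a + (- (a + 1/2)) * pcf_M R (a + 1)) at_top"
    by (rule Lim_transform_eventually[rotated])
  moreover have "((\<lambda>r. r ^ R * pcf_U a r - 0 ^ R * pcf_U a 0) \<longlongrightarrow> 0 - 0 ^ R * pcf_U a (0::real)) at_top"
    by (intro tendsto_intros moment_tendsto_0)
  ultimately have "real R * pcf_M (R - 1) a + (- 1 / 2) * pcf_M (Suc R) a + (- (a + 1/2)) * pcf_M R (a + 1) = 0 - 0 ^ R * pcf_U a (0::real)"
    by (rule tendsto_unique[OF trivial_limit_at_top_linorder])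
  then show ?thesis by (cases "R = 0") (auto simp: pcf_U_0 power_0_left algebra_simps)
qed

subsection \<open>The zeroth moment\<close>

lemma has_integral_powr_gauss_real:
  fixes m q :: real
  assumes m: "m > 0" and q: "q > 0"
  shows "((\<lambda>t. t powr (q - 1) * exp (- (m * t\<^sup>2))) has_integral Gamma (q / 2) * m powr (- (q / 2)) / 2) {0<..}"
proof -
  have "complex_of_real m powr (- of_real (q / 2)) = of_real (m powr (- (q / 2)))"
    using powr_of_real[of m "- (q / 2)"] m by simp
  then have "((\<lambda>t. complex_of_real (t powr (q - 1) * exp (- (m * t\<^sup>2)))) has_integral complex_of_real (Gamma (q / 2) * m powr (- (q / 2)) / 2)) {0<..}"
    using has_integral_powr_gauss_complex[of "of_real m" q] m q Gamma_complex_of_real[of "q / 2"]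
    by (simp flip: exp_of_real)
  from has_integral_linear[OF this bounded_linear_Re] show ?thesis by (simp add: o_def)
qed

text \<open>The incomplete Beta integral B_(1/2)(x, 1/2 - x). The complete integral diverges at u =
  1 once x \<ge> 1/2, so the cut at 1/2 matters.\<close>

definition half_beta :: "real \<Rightarrow> real" where
  "half_beta x = integral {0..1/2} (\<lambda>u. u powr (x - 1) * (1 - u) powr (- 1/2 - x))"

text \<open>The exponent is (t + 2s)^2/4 - s^2/2 up to sign, so t + 2s = s sqrt(2/u) leaves a pure
  Gaussian in s, and t = 0 becomes u = 1/2. Nonnegative integrals are used so that Tonelli applies
  afterwards.\<close>

lemma exp_quadratic_substitution:
  assumes s: "s > 0"
  shows "(\<integral>\<^sup>+t. ennreal (indicator {0<..} t * exp (- (t\<^sup>2 / 4 + s * t + s\<^sup>2 / 2))) \<partial>lborel) =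
    (\<integral>\<^sup>+u. ennreal (indicator {0<..<1/2} u * (s * (sqrt 2 / 2 * u powr (- 3/2)) * exp (- ((1 - u) / (2 * u) * s\<^sup>2)))) \<partial>lborel)"
proof -
  let ?f = "\<lambda>t::real. exp (- (t\<^sup>2 / 4 + s * t + s\<^sup>2 / 2))"
  let ?g = "\<lambda>u. s * (sqrt 2 * u powr (- 1/2) - 2)"
  let ?h = "\<lambda>u. - (s * (sqrt 2 / 2 * u powr (- 3/2)))"
  have "?f integrable_on {0<..}"
  proof (rule measurable_bounded_by_integrable_imp_integrable)
    show "?f \<in> borel_measurable (lebesgue_on {0<..})"
      by (rule continuous_imp_measurable_on_sets_lebesgue) (auto intro!: continuous_intros)
    show "(\<lambda>t. t powr (1 - 1) * exp (- (s * t))) integrable_on {0<..}"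
      using has_integral_powr_exp_real[of s 1] s by (auto simp: has_integral_integrable)
    fix t :: real assume "t \<in> {0<..}"
    moreover have "- (t\<^sup>2 / 4 + s * t + s\<^sup>2 / 2) \<le> - (s * t)"
      using zero_le_power2[of t] zero_le_power2[of s] by linarith
    ultimately show "norm (?f t) \<le> t powr (1 - 1) * exp (- (s * t))" by simp
  qed auto
  then have f: "?f absolutely_integrable_on {0<..}"
    by (intro nonnegative_absolutely_integrable_1) auto
  have im: "?g ` {0<..<1/2} = {0<..}"
  proof safe
    fix u :: real assume u: "u \<in> {0<..<1/2}"
    have "(1/2) powr (- 1/2) < u powr (- 1/2)" using u by (intro powr_less_mono2_neg) auto
    moreover have "(1/2) powr (- 1/2) = sqrt 2" by (simp add: powr_minus powr_half_sqrt real_sqrt_divide)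
    ultimately have "sqrt 2 * sqrt 2 < sqrt 2 * u powr (- 1/2)" by (intro mult_strict_left_mono) auto
    then show "?g u > 0" using s by simp
  next
    fix t :: real assume t: "t > 0"
    define u where "u = 2 / (t / s + 2)\<^sup>2"
    have ts: "t / s > 0" using t s by simp
    have "2\<^sup>2 < (t / s + 2)\<^sup>2" using ts by (intro power_strict_mono) auto
    then have u: "u \<in> {0<..<1/2}" unfolding u_def using ts by (auto simp: field_simps)
    have "u powr (- 1/2) = (t / s + 2) / sqrt 2"
      using u ts by (simp add: powr_minus powr_half_sqrt u_def real_sqrt_divide)
    then have "t = ?g u" using s by (simp add: field_simps)
    then show "t \<in> ?g ` {0<..<1/2}" using u by blast
  qed
  have inj: "inj_on ?g {0<..<1/2}"
  proof (rule inj_onI)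
    fix u v :: real assume "u \<in> {0<..<1/2}" "v \<in> {0<..<1/2}" "?g u = ?g v"
    then have "(u powr (- 1/2)) powr (- 2) = (v powr (- 1/2)) powr (- 2)" "u > 0" "v > 0" using s by auto
    then show "u = v" by (simp add: powr_powr)
  qed
  have der: "(?g has_field_derivative ?h u) (at u within {0<..<1/2})" if "u \<in> {0<..<1/2}" for u
    using that by (auto intro!: derivative_eq_intros)
  have "(\<lambda>u. \<bar>?h u\<bar> * ?f (?g u)) absolutely_integrable_on {0<..<1/2} \<and>
      integral {0<..<1/2} (\<lambda>u. \<bar>?h u\<bar> * ?f (?g u)) = integral {0<..} ?f"
    by (subst has_absolute_integral_change_of_variables_1'[OF _ der inj]) (use f im in auto)
  then have "((\<lambda>u. \<bar>?h u\<bar> * ?f (?g u)) has_integral integral {0<..} ?f) {0<..<1/2}"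
    by (auto simp: has_integral_iff dest: set_lebesgue_integral_eq_integral(1))
  moreover have "\<bar>?h u\<bar> * ?f (?g u) = s * (sqrt 2 / 2 * u powr (- 3/2)) * exp (- ((1 - u) / (2 * u) * s\<^sup>2))"
    if "u \<in> {0<..<1/2}" for u
  proof -
    define v where "v = u powr (- 1/2)"
    have "v\<^sup>2 = u powr (- 1/2 + - 1/2)" unfolding v_def power2_eq_square by (rule powr_add[symmetric])
    then have v: "v\<^sup>2 = 1 / u" using that by (simp add: powr_minus_divide)
    have "(?g u)\<^sup>2 / 4 + s * ?g u + s\<^sup>2 / 2 = s\<^sup>2 * ((sqrt 2)\<^sup>2 * v\<^sup>2 / 4 - 1/2)"
      unfolding v_def[symmetric] by (simp add: power2_eq_square field_simps)
    also have "\<dots> = (1 - u) / (2 * u) * s\<^sup>2" using that by (simp add: v field_simps)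
    finally show ?thesis using s by (simp add: abs_mult)
  qed
  ultimately have "((\<lambda>u. s * (sqrt 2 / 2 * u powr (- 3/2)) * exp (- ((1 - u) / (2 * u) * s\<^sup>2))) has_integral integral {0<..} ?f) {0<..<1/2}"
    by (rule has_integral_eq[rotated])
  from nn_integral_has_integral_lebesgue[OF _ this]
  have "(\<integral>\<^sup>+u. ennreal (indicator {0<..<1/2} u * (s * (sqrt 2 / 2 * u powr (- 3/2)) * exp (- ((1 - u) / (2 * u) * s\<^sup>2)))) \<partial>lborel) = ennreal (integral {0<..} ?f)"
    using s by simp
  moreover have "(\<integral>\<^sup>+t. ennreal (indicator {0<..} t * ?f t) \<partial>lborel) = ennreal (integral {0<..} ?f)"
    by (rule nn_integral_has_integral_lebesgue) (use f in \<open>auto simp: has_integral_iff dest: set_lebesgue_integral_eq_integral(1)\<close>)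
  ultimately show ?thesis by simp
qed

text \<open>Substituting \<open>t = s y\<close> turns the double integral for \<open>\<Gamma> \<cdot> M\<^sub>0\<close> into a power of a quadratic polynomial in \<open>y\<close>;
  \<open>y + 2 = sqrt (2 / u)\<close> then gives an incomplete Beta integral.\<close>

lemma moment_0_eq_half_beta:
  assumes x: "x > 0"
  shows half_beta_has_integral:
      "((\<lambda>u. u powr (x - 1) * (1 - u) powr (- 1/2 - x)) has_integral half_beta x) {0..1/2}" (is ?th1)
    and "pcf_M 0 (2 * x - 1/2) = sqrt pi * 2 powr (- x) * rGamma x * half_beta x" (is ?th2)
proof -
  define \<nu> where "\<nu> = 2 * x"
  have \<nu>: "\<nu> > 0" using x by (simp add: \<nu>_def)
  let ?M = "pcf_M 0 (\<nu> - 1/2)"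
  have D0: "0 \<le> Gamma \<nu> * pcf_D \<nu> t" for t :: real
    by (rule has_integral_nonneg[OF has_integral_pcf_D_real[OF \<nu>]]) auto
  have "((\<lambda>t::real. t ^ 0 * pcf_U (\<nu> - 1/2) t) has_integral ?M) {0..}"
    unfolding pcf_M_def by (rule integrable_integral[OF moment_integrable])
  then have "((\<lambda>t::real. Gamma \<nu> * (t ^ 0 * pcf_U (\<nu> - 1/2) t)) has_integral Gamma \<nu> * ?M) {0..}"
    by (rule has_integral_mult_right)
  then have m: "((\<lambda>t. exp (- t\<^sup>2 / 4) * (Gamma \<nu> * pcf_D \<nu> t)) has_integral Gamma \<nu> * ?M) {0..}"
    by (simp add: pcf_U_def mult_ac)
  have "((\<lambda>t. if t \<in> {0<..} then exp (- t\<^sup>2 / 4) * (Gamma \<nu> * pcf_D \<nu> t) else 0) has_integral Gamma \<nu> * ?M) {0..}"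
    by (rule has_integral_spike_finite[OF _ _ m, of "{0}"]) auto
  then have m': "((\<lambda>t. exp (- t\<^sup>2 / 4) * (Gamma \<nu> * pcf_D \<nu> t)) has_integral Gamma \<nu> * ?M) {0<..}"
    by (subst (asm) has_integral_restrict) auto
  have M0: "0 \<le> Gamma \<nu> * ?M" by (rule has_integral_nonneg[OF m']) (use D0 in auto)
  \<comment> \<open>Collects what the integration over s leaves besides powers of u and 1 - u:
    \<open>sqrt 2 / 2\<close> from the Jacobian, 1/2 and the Gamma factor from the Gaussian
    integral, and a power of 2 from the scale m.\<close>
  define c where "c = sqrt 2 / 4 * Gamma (x + 1/2) * 2 powr (x + 1/2)"
  have c: "c > 0" unfolding c_def using x by (simp add: Gamma_real_pos)
  have "ennreal (Gamma \<nu> * ?M) = (\<integral>\<^sup>+t. indicator {0<..} t * (exp (- t\<^sup>2 / 4) * (Gamma \<nu> * pcf_D \<nu> t)) \<partial>lborel)"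
    by (rule nn_integral_has_integral_lebesgue[OF _ m', symmetric]) (use D0 in auto)
  also have "\<dots> = (\<integral>\<^sup>+t. ennreal (indicator {0<..} t * exp (- t\<^sup>2 / 4)) * ennreal (Gamma \<nu> * pcf_D \<nu> t) \<partial>lborel)"
    using D0 by (intro nn_integral_cong) (simp add: ennreal_mult' mult.assoc)
  also have "\<dots> = (\<integral>\<^sup>+t. ennreal (indicator {0<..} t * exp (- t\<^sup>2 / 4)) *
      (\<integral>\<^sup>+s. ennreal (indicator {0<..} s * (s powr (\<nu> - 1) * exp (- s\<^sup>2 / 2) * exp (- (t * s)))) \<partial>lborel) \<partial>lborel)"
    by (intro nn_integral_cong arg_cong2[of _ _ _ _ "(*)"] refl
        nn_integral_has_integral_lebesgue[OF _ has_integral_pcf_D_real[OF \<nu>], symmetric]) auto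
  also have "\<dots> = (\<integral>\<^sup>+t. \<integral>\<^sup>+s. ennreal (indicator {0<..} t * exp (- t\<^sup>2 / 4)) *
      ennreal (indicator {0<..} s * (s powr (\<nu> - 1) * exp (- s\<^sup>2 / 2) * exp (- (t * s)))) \<partial>lborel \<partial>lborel)"
    by (intro nn_integral_cong nn_integral_cmult[symmetric]) measurable
  also have "\<dots> = (\<integral>\<^sup>+s. \<integral>\<^sup>+t. ennreal (indicator {0<..} t * exp (- t\<^sup>2 / 4)) *
      ennreal (indicator {0<..} s * (s powr (\<nu> - 1) * exp (- s\<^sup>2 / 2) * exp (- (t * s)))) \<partial>lborel \<partial>lborel)"
    by (rule lborel_pair.Fubini') measurable
  also have "\<dots> = (\<integral>\<^sup>+s. ennreal (indicator {0<..} s * s powr (\<nu> - 1)) *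
      (\<integral>\<^sup>+t. ennreal (indicator {0<..} t * exp (- (t\<^sup>2 / 4 + s * t + s\<^sup>2 / 2))) \<partial>lborel) \<partial>lborel)"
  proof (intro nn_integral_cong)
    fix s :: real
    have "(\<integral>\<^sup>+t. ennreal (indicator {0<..} t * exp (- t\<^sup>2 / 4)) *
      ennreal (indicator {0<..} s * (s powr (\<nu> - 1) * exp (- s\<^sup>2 / 2) * exp (- (t * s)))) \<partial>lborel) =
      (\<integral>\<^sup>+t. ennreal (indicator {0<..} s * s powr (\<nu> - 1)) * ennreal (indicator {0<..} t * exp (- (t\<^sup>2 / 4 + s * t + s\<^sup>2 / 2))) \<partial>lborel)"
    proof (intro nn_integral_cong)
      fix t :: real
      have E: "exp (- (t\<^sup>2 / 4 + s * t + s\<^sup>2 / 2)) = exp (- t\<^sup>2 / 4) * (exp (- s\<^sup>2 / 2) * exp (- (t * s)))"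
        by (simp only: exp_add[symmetric]) (simp add: algebra_simps)
      have "exp (- t\<^sup>2 / 4) * (s powr (\<nu> - 1) * exp (- s\<^sup>2 / 2) * exp (- (t * s))) =
          s powr (\<nu> - 1) * exp (- (t\<^sup>2 / 4 + s * t + s\<^sup>2 / 2))"
        unfolding E by (simp only: mult_ac)
      then show "ennreal (indicator {0<..} t * exp (- t\<^sup>2 / 4)) *
          ennreal (indicator {0<..} s * (s powr (\<nu> - 1) * exp (- s\<^sup>2 / 2) * exp (- (t * s)))) =
          ennreal (indicator {0<..} s * s powr (\<nu> - 1)) * ennreal (indicator {0<..} t * exp (- (t\<^sup>2 / 4 + s * t + s\<^sup>2 / 2)))"
        by (simp add: indicator_def flip: ennreal_mult)
    qed
    also have "\<dots> = ennreal (indicator {0<..} s * s powr (\<nu> - 1)) *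
      (\<integral>\<^sup>+t. ennreal (indicator {0<..} t * exp (- (t\<^sup>2 / 4 + s * t + s\<^sup>2 / 2))) \<partial>lborel)"
      by (rule nn_integral_cmult) measurable
    finally show "(\<integral>\<^sup>+t. ennreal (indicator {0<..} t * exp (- t\<^sup>2 / 4)) *
      ennreal (indicator {0<..} s * (s powr (\<nu> - 1) * exp (- s\<^sup>2 / 2) * exp (- (t * s)))) \<partial>lborel) = \<dots>" .
  qed
  also have "\<dots> = (\<integral>\<^sup>+s. ennreal (indicator {0<..} s * s powr (\<nu> - 1)) *
      (\<integral>\<^sup>+u. ennreal (indicator {0<..<1/2} u * (s * (sqrt 2 / 2 * u powr (- 3/2)) * exp (- ((1 - u) / (2 * u) * s\<^sup>2)))) \<partial>lborel) \<partial>lborel)"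
  proof (intro nn_integral_cong)
    fix s :: real
    show "ennreal (indicator {0<..} s * s powr (\<nu> - 1)) *
        (\<integral>\<^sup>+t. ennreal (indicator {0<..} t * exp (- (t\<^sup>2 / 4 + s * t + s\<^sup>2 / 2))) \<partial>lborel) =
      ennreal (indicator {0<..} s * s powr (\<nu> - 1)) *
        (\<integral>\<^sup>+u. ennreal (indicator {0<..<1/2} u * (s * (sqrt 2 / 2 * u powr (- 3/2)) * exp (- ((1 - u) / (2 * u) * s\<^sup>2)))) \<partial>lborel)"
      by (cases "s > 0") (simp_all only: exp_quadratic_substitution, simp)
  qed
  also have "\<dots> = (\<integral>\<^sup>+s. \<integral>\<^sup>+u. ennreal (indicator {0<..} s * s powr (\<nu> - 1)) *
      ennreal (indicator {0<..<1/2} u * (s * (sqrt 2 / 2 * u powr (- 3/2)) * exp (- ((1 - u) / (2 * u) * s\<^sup>2)))) \<partial>lborel \<partial>lborel)"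
    by (intro nn_integral_cong nn_integral_cmult[symmetric]) measurable
  also have "\<dots> = (\<integral>\<^sup>+u. \<integral>\<^sup>+s. ennreal (indicator {0<..} s * s powr (\<nu> - 1)) *
      ennreal (indicator {0<..<1/2} u * (s * (sqrt 2 / 2 * u powr (- 3/2)) * exp (- ((1 - u) / (2 * u) * s\<^sup>2)))) \<partial>lborel \<partial>lborel)"
    by (rule lborel_pair.Fubini') measurable
  also have "\<dots> = (\<integral>\<^sup>+u. ennreal (indicator {0<..<1/2} u * (c * (u powr (x - 1) * (1 - u) powr (- 1/2 - x)))) \<partial>lborel)"
  proof (intro nn_integral_cong)
    fix u :: real
    show "(\<integral>\<^sup>+s. ennreal (indicator {0<..} s * s powr (\<nu> - 1)) *
      ennreal (indicator {0<..<1/2} u * (s * (sqrt 2 / 2 * u powr (- 3/2)) * exp (- ((1 - u) / (2 * u) * s\<^sup>2)))) \<partial>lborel)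
      = ennreal (indicator {0<..<1/2} u * (c * (u powr (x - 1) * (1 - u) powr (- 1/2 - x))))"
    proof (cases "u \<in> {0<..<1/2}")
      case True
      define m where "m = (1 - u) / (2 * u)"
      have m: "m > 0" using True by (simp add: m_def)
      let ?k = "sqrt 2 / 2 * u powr (- 3/2)"
      have "((\<lambda>s. ?k * (s powr (\<nu> + 1 - 1) * exp (- (m * s\<^sup>2)))) has_integral ?k * (Gamma ((\<nu> + 1) / 2) * m powr (- ((\<nu> + 1) / 2)) / 2)) {0<..}"
        using \<nu> by (intro has_integral_mult_right has_integral_powr_gauss_real m) auto
      then have "(\<integral>\<^sup>+s. ennreal (indicator {0<..} s * (?k * (s powr (\<nu> + 1 - 1) * exp (- (m * s\<^sup>2))))) \<partial>lborel) =
          ennreal (?k * (Gamma ((\<nu> + 1) / 2) * m powr (- ((\<nu> + 1) / 2)) / 2))"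
        by (intro nn_integral_has_integral_lebesgue) auto
      moreover have "ennreal (indicator {0<..} s * s powr (\<nu> - 1)) * ennreal (indicator {0<..<1/2} u * (s * ?k * exp (- (m * s\<^sup>2)))) =
          ennreal (indicator {0<..} s * (?k * (s powr (\<nu> + 1 - 1) * exp (- (m * s\<^sup>2)))))" for s
      proof (cases "s > 0")
        case s: True
        have "s powr (\<nu> - 1) * s = s powr \<nu>" using s by (simp add: powr_diff)
        then show ?thesis using s True by (simp add: mult_ac flip: ennreal_mult)
      qed auto
      moreover have "?k * (Gamma ((\<nu> + 1) / 2) * m powr (- ((\<nu> + 1) / 2)) / 2) = c * (u powr (x - 1) * (1 - u) powr (- 1/2 - x))"
      proof -
        have e: "(\<nu> + 1) / 2 = x + 1/2" by (simp add: \<nu>_def field_simps)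
        have "m powr (- (x + 1/2)) = (1 - u) powr (- (x + 1/2)) / (2 powr (- (x + 1/2)) * u powr (- (x + 1/2)))"
          unfolding m_def using True by (simp add: powr_divide powr_mult)
        also have "\<dots> = (1 - u) powr (- 1/2 - x) * (2 powr (x + 1/2) * u powr (x + 1/2))"
        proof -
          have "A / (2 powr (- p) * u powr (- p)) = A * (2 powr p * u powr p)" for A p :: real
            by (simp add: powr_minus field_simps)
          moreover have "- (x + 1/2) = - 1/2 - x" by simp
          ultimately show ?thesis by metis
        qed
        finally have 1: "m powr (- (x + 1/2)) = (1 - u) powr (- 1/2 - x) * (2 powr (x + 1/2) * u powr (x + 1/2))" .
        have "u powr (- 3/2) * u powr (x + 1/2) = u powr (x - 1)" by (simp flip: powr_add)
        then show ?thesis unfolding e 1 c_def by (simp add: mult_ac)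
      qed
      ultimately show ?thesis using True by (simp add: m_def)
    qed auto
  qed
  finally have N: "(\<integral>\<^sup>+u. ennreal (indicator {0<..<1/2} u * (c * (u powr (x - 1) * (1 - u) powr (- 1/2 - x)))) \<partial>lborel) = ennreal (Gamma \<nu> * ?M)" by simp
  \<comment> \<open>The value is finite because the moment exists, so convergence of the half Beta
    integral is a by-product of the exchange of integrals.\<close>
  have "((\<lambda>u. indicator {0<..<1/2} u * (c * (u powr (x - 1) * (1 - u) powr (- 1/2 - x)))) has_integral Gamma \<nu> * ?M) UNIV"
    by (rule nn_integral_has_integral[OF _ _ N M0]) (use c in auto)
  then have "((\<lambda>u. if u \<in> {0<..<1/2} then c * (u powr (x - 1) * (1 - u) powr (- 1/2 - x)) else 0) has_integral Gamma \<nu> * ?M) UNIV"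
    by (rule has_integral_eq[rotated]) auto
  then have "((\<lambda>u. c * (u powr (x - 1) * (1 - u) powr (- 1/2 - x))) has_integral Gamma \<nu> * ?M) {0<..<1/2}"
    by (subst (asm) has_integral_restrict_UNIV)
  then have "((\<lambda>u. c * (u powr (x - 1) * (1 - u) powr (- 1/2 - x))) has_integral Gamma \<nu> * ?M) {0..1/2}"
    by (simp only: has_integral_Icc_iff_Ioo)
  from has_integral_mult_right[OF this, of "1 / c"] c
  have B: "((\<lambda>u. u powr (x - 1) * (1 - u) powr (- 1/2 - x)) has_integral Gamma \<nu> * ?M / c) {0..1/2}"
    by simp
  then have hb: "half_beta x = Gamma \<nu> * ?M / c" unfolding half_beta_def by (rule integral_unique)
  show ?th1 using B hb by simp
  have "Gamma \<nu> > 0" using \<nu> by (rule Gamma_real_pos)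
  then have "?M = rGamma \<nu> * c * half_beta x" using c by (simp add: hb rGamma_inverse_Gamma)
  also have "rGamma \<nu> * c = sqrt pi * 2 powr (- x) * rGamma x"
  proof -
    have "rGamma x * rGamma (x + 1/2) = 2 powr (\<nu> - 1) * rGamma \<nu> / sqrt pi"
      unfolding \<nu>_def by (rule rGamma_legendre_duplication_real)
    then have r: "rGamma \<nu> = sqrt pi * 2 powr (1 - \<nu>) * rGamma x * rGamma (x + 1/2)"
      by (simp add: powr_diff field_simps)
    have g: "rGamma (x + 1/2) * Gamma (x + 1/2) = 1"
      unfolding rGamma_inverse_Gamma by (rule left_inverse) (use Gamma_real_pos[of "x + 1/2"] x in linarith)
    have p: "2 powr (1 - \<nu>) * (sqrt 2 / 4) * 2 powr (x + 1/2) = 2 powr (- x)"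
    proof -
      have "sqrt 2 = 2 powr (1/2)" by (simp add: powr_half_sqrt)
      moreover have "1 / 4 = 2 powr (- 2 :: real)" by (simp add: powr_minus_divide)
      ultimately have "2 powr (1 - \<nu>) * (sqrt 2 / 4) * 2 powr (x + 1/2) = 2 powr (1 - \<nu>) * (2 powr (1/2) * 2 powr (-2)) * 2 powr (x + 1/2)"
        by simp
      also have "\<dots> = 2 powr (- x)" by (simp only: powr_add[symmetric]) (simp add: \<nu>_def)
      finally show ?thesis .
    qed
    have "rGamma \<nu> * c = sqrt pi * (2 powr (1 - \<nu>) * (sqrt 2 / 4) * 2 powr (x + 1/2)) * rGamma x * (rGamma (x + 1/2) * Gamma (x + 1/2))"
      unfolding r c_def by (simp only: mult_ac)
    then show ?thesis unfolding g p by simp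
  qed
  finally show ?th2 by (simp add: \<nu>_def)
qed

subsection \<open>The combination of moments\<close>

lemma has_integral_reflect_half:
  fixes f :: "real \<Rightarrow> real"
  assumes "(f has_integral I) {0..1/2}"
  shows "((\<lambda>x. f (1 - x)) has_integral I) {1/2..1}"
proof -
  have "(\<lambda>x::real. - x + 1) ` {0..1/2} = {1/2..1}"
    using image_affinity_atLeastAtMost[of "-1" 1 0 "1/2"] by simp
  then show ?thesis using has_integral_affinity[of f I 0 "1/2" "-1" 1] assms by (simp add: algebra_simps)
qed

lemma Beta_split_half:
  fixes p q :: real
  assumes "p > 0" "q > 0"
    and I: "((\<lambda>u. u powr (p - 1) * (1 - u) powr (q - 1)) has_integral I) {0..1/2}"
    and J: "((\<lambda>u. u powr (q - 1) * (1 - u) powr (p - 1)) has_integral J) {0..1/2}"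
  shows "I + J = Beta p q"
proof -
  have "((\<lambda>u. u powr (p - 1) * (1 - u) powr (q - 1)) has_integral J) {1/2..1}"
    using has_integral_reflect_half[OF J] by (simp add: mult.commute)
  from has_integral_combine[OF _ _ I this] have "((\<lambda>u. u powr (p - 1) * (1 - u) powr (q - 1)) has_integral I + J) {0..1}" by simp
  then show ?thesis using has_integral_Beta_real[OF assms(1,2)] has_integral_unique by blast
qed

text \<open>Differentiating u^x (1-u)^(1/2-x) relates the integrand to one whose second exponent is
  higher by one. The exponents x - 1 and 1/2 - x are those of Beta(x, 3/2 - x), which converges up
  to u = 1 when x < 3/2.\<close>

lemma half_beta_by_parts:
  assumes x: "x > 0"
  shows "((\<lambda>u. u powr (x - 1) * (1 - u) powr (1/2 - x)) has_integral 2 * ((1/2 - x) * half_beta x + sqrt (1/2))) {0..1/2}"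
proof -
  let ?G = "\<lambda>u::real. u powr x * (1 - u) powr (1/2 - x)"
  let ?g = "\<lambda>u::real. u powr (x - 1) * (1 - u) powr (1/2 - x)"
  let ?b = "\<lambda>u::real. u powr (x - 1) * (1 - u) powr (- 1/2 - x)"
  have "((\<lambda>u. 1/2 * ?g u - (1/2 - x) * ?b u) has_integral ?G (1/2) - ?G 0) {0..1/2}"
  proof (rule fundamental_theorem_of_calculus_interior)
    show "continuous_on {0..1/2} ?G" using x by (intro continuous_on_mult continuous_on_powr' continuous_intros) auto
    fix u :: real assume u: "u \<in> {0<..<1/2}"
    have "(?G has_real_derivative x * u powr (x - 1) * (1 - u) powr (1/2 - x) - (1/2 - x) * (1 - u) powr (1/2 - x - 1) * u powr x) (at u)"
      using u by (auto intro!: derivative_eq_intros)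
    moreover have "u powr x = u powr (x - 1) * u" using u by (simp add: powr_diff)
    moreover have e: "1/2 - x - 1 = - 1/2 - x" by simp
    moreover have "(1 - u) powr (1/2 - x) = (1 - u) powr (- 1/2 - x) * (1 - u)"
    proof -
      have "(1 - u) powr (1/2 - x) = (1 - u) powr (- 1/2 - x + 1)" by simp
      also have "\<dots> = (1 - u) powr (- 1/2 - x) * (1 - u) powr 1" by (rule powr_add)
      finally show ?thesis using u by simp
    qed
    ultimately show "(?G has_vector_derivative 1/2 * ?g u - (1/2 - x) * ?b u) (at u)"
      unfolding has_real_derivative_iff_has_vector_derivative[symmetric]
      by (elim back_subst[of "\<lambda>d. (_ has_real_derivative d) _"]) (simp only: e, simp add: algebra_simps)
  qed simp
  then have "((\<lambda>u. 2 * ((1/2 * ?g u - (1/2 - x) * ?b u) + (1/2 - x) * ?b u)) has_integral 2 * ((?G (1/2) - ?G 0) + (1/2 - x) * half_beta x)) {0..1/2}"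
    by (intro has_integral_mult_right has_integral_add half_beta_has_integral x)
  moreover have "?G (1/2) - ?G 0 = sqrt (1/2)"
    using x by (simp add: powr_half_sqrt flip: powr_add)
  ultimately show ?thesis by (simp add: algebra_simps)
qed

text \<open>The reflection u to 1 - u exchanges x and 3/2 - x, so the integrals at these two
  arguments are the two parts of one Beta integral; the boundary terms leave
  \<open>sqrt 2\<close>.\<close>

lemma half_beta_identity:
  assumes x: "0 < x" "x < 3/2"
  shows "(1/2 - x) * half_beta x + (x - 1) * half_beta (3/2 - x) + sqrt 2 = Beta x (3/2 - x) / 2"
proof -
  have 1: "((\<lambda>u. u powr (x - 1) * (1 - u) powr (3/2 - x - 1)) has_integral 2 * ((1/2 - x) * half_beta x + sqrt (1/2))) {0..1/2}"
    using half_beta_by_parts[of x] x by simp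
  have "1/2 - (3/2 - x) = x - 1" by simp
  then have 2: "((\<lambda>u. u powr (3/2 - x - 1) * (1 - u) powr (x - 1)) has_integral 2 * ((x - 1) * half_beta (3/2 - x) + sqrt (1/2))) {0..1/2}"
    using half_beta_by_parts[of "3/2 - x"] x by simp
  have "2 * sqrt (1/2) = sqrt 2" by (simp add: real_sqrt_divide real_div_sqrt)
  then show ?thesis using Beta_split_half[OF _ _ 1 2] x by (simp add: algebra_simps)
qed

text \<open>Up to the factor \<open>-(tan (\<pi> a) + (-1)\<^sup>R sec (\<pi> a))\<close>, this is the coefficient of \<open>U\<^sub>0\<close> produced by the connection formulas.\<close>

definition moment_comb :: "nat \<Rightarrow> real \<Rightarrow> real" where
  "moment_comb R a = sqrt (pi / 2) * rGamma (1/2 + a) * pcf_M R (- a) + sin (pi / 4 - pi * a / 2 + pi * real R / 2) * pcf_M R a"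

definition moment_value :: "nat \<Rightarrow> real \<Rightarrow> real" where
  "moment_value R a = 2 powr (- a / 2 + 3 / 2 * real R - 1 / 4) * pi *
     hyperF_reg (1/2 - real R / 2) (- real R / 2) (a / 2 - real R / 2 + 3 / 4) (1/2)"

text \<open>This is what makes the boundary terms of \<open>pcf_M_up\<close> at R = 0 cancel inside
  \<open>moment_comb\<close>, so that the combination obeys homogeneous recurrences. Duplication and
  reflection at y = a/2 + 1/4 give it.\<close>

lemma pcf_h_connection:
  "sqrt (pi / 2) * rGamma (1/2 + a) * pcf_h (1/2 - a) = sin (pi / 4 + pi * a / 2) * pcf_h (1/2 + a)"
proof -
  define y where "y = a / 2 + 1/4"
  have d: "rGamma (1/2 + a) = sqrt pi * 2 powr (1/2 - a) * (rGamma y * rGamma (y + 1/2))"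
    using rGamma_legendre_duplication_real[of y]
    by (simp add: y_def algebra_simps powr_diff powr_add)
  have r: "rGamma y * rGamma (1 - y) = sin (pi / 4 + pi * a / 2) / pi"
    unfolding rGamma_reflection_real by (simp add: y_def algebra_simps)
  have "pcf_h (1/2 - a) = sqrt pi * 2 powr (a / 2 - 1/4) * rGamma (1 - y)"
    by (simp add: pcf_h_def y_def algebra_simps diff_divide_distrib add_divide_distrib)
  moreover have "pcf_h (1/2 + a) = sqrt pi * 2 powr (- a / 2 - 1/4) * rGamma (y + 1/2)"
    by (simp add: pcf_h_def y_def algebra_simps diff_divide_distrib add_divide_distrib)
  moreover have "2 powr (1/2 - a) * 2 powr (a / 2 - 1/4) = sqrt 2 * 2 powr (- a / 2 - 1/4)"
  proof -
    have "sqrt 2 * 2 powr (- a / 2 - 1/4) = 2 powr (1/2) * 2 powr (- a / 2 - 1/4)" by (simp add: powr_half_sqrt)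
    then show ?thesis by (simp add: algebra_simps flip: powr_add)
  qed
  moreover have "sqrt (pi / 2) * sqrt 2 = sqrt pi" by (simp add: real_sqrt_divide)
  moreover have "sqrt pi * sqrt pi = pi" by simp
  ultimately have "sqrt (pi / 2) * rGamma (1/2 + a) * pcf_h (1/2 - a) =
     sqrt pi * pi * 2 powr (- a / 2 - 1/4) * rGamma (y + 1/2) * (rGamma y * rGamma (1 - y))"
    unfolding d by algebra
  then show ?thesis using \<open>pcf_h (1/2 + a) = _\<close> by (simp add: r)
qed

text \<open>The half Beta formula covers M_0(a) but, in general, not M_0(-a); two recurrences move
  -a to 2 - a, whose Beta argument is 3/2 - x. The range of a says that x and 3/2 - x are both
  positive.\<close>

lemma moment_comb_0_base:
  assumes a: "- 1/2 < a" "a < 5/2"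
  shows "moment_comb 0 a = 2 powr (- a / 2 - 1/4) * pi * rGamma (a / 2 + 3/4)"
proof -
  define x where "x = a / 2 + 1/4"
  have x: "0 < x" "x < 3/2" using a by (auto simp: x_def)
  have aeq: "a = 2 * x - 1/2" by (simp add: x_def)
  define G where "G = rGamma (x + 1/2) * rGamma (3/2 - x)"
  define K where "K = pi * sqrt pi * 2 powr (- x) * rGamma x"
  have M: "pcf_M 0 a = sqrt pi * 2 powr (- x) * rGamma x * half_beta x"
    unfolding aeq by (rule moment_0_eq_half_beta) (rule x)
  have "pcf_M 0 (2 * (3/2 - x) - 1/2) = sqrt pi * 2 powr (- (3/2 - x)) * rGamma (3/2 - x) * half_beta (3/2 - x)"
    by (rule moment_0_eq_half_beta) (use x in simp)
  then have M2: "pcf_M 0 (2 - a) = sqrt pi * 2 powr (x - 3/2) * rGamma (3/2 - x) * half_beta (3/2 - x)"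
    by (simp add: aeq algebra_simps)
  have "pcf_M 0 (1 - a - 1) = pcf_M (Suc 0) (1 - a) + (1 - a + 1/2) * pcf_M 0 (1 - a + 1)"
    by (rule pcf_M_down)
  then have Mn: "pcf_M 0 (- a) = 2 * pcf_h (3/2 - a) - (3/2 - a) * pcf_M 0 (2 - a)"
    using pcf_M_up[of 0 "1 - a"] by (simp add: algebra_simps)
  have h: "pcf_h (3/2 - a) = sqrt pi * 2 powr (x - 1) * rGamma (3/2 - x)"
    by (simp add: pcf_h_def aeq algebra_simps diff_divide_distrib add_divide_distrib)
  have "rGamma (1/2 + a) = sqrt pi * 2 powr (1 - 2 * x) * (rGamma x * rGamma (x + 1/2))"
    using rGamma_legendre_duplication_real[of x] by (simp add: aeq powr_diff)
  moreover have p1: "2 powr (1 - 2 * x) * 2 powr (x - 1) = 2 powr (- x)" by (simp flip: powr_add)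
  moreover have p2: "2 powr (x - 3/2) = 2 powr (x - 1) / sqrt 2"
  proof -
    have "2 powr (x - 3/2) = 2 powr (x - 1 - 1/2)" by simp
    also have "\<dots> = 2 powr (x - 1) / 2 powr (1/2)" by (rule powr_diff)
    finally show ?thesis by (simp add: powr_half_sqrt)
  qed
  moreover have p3: "sqrt (pi / 2) = sqrt pi / sqrt 2" by (simp add: real_sqrt_divide)
  moreover have "sqrt pi * sqrt pi = pi" "sqrt 2 * sqrt 2 = 2" by simp_all
  ultimately have X: "sqrt (pi / 2) * rGamma (1/2 + a) * pcf_M 0 (- a) = K * G * (sqrt 2 + (x - 1) * half_beta (3/2 - x))"
  proof -
    have "sqrt (pi / 2) * rGamma (1/2 + a) * pcf_M 0 (- a) =
      sqrt pi / sqrt 2 * (sqrt pi * 2 powr (1 - 2 * x) * (rGamma x * rGamma (x + 1/2))) *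
      (2 * (sqrt pi * 2 powr (x - 1) * rGamma (3/2 - x)) - (2 - 2 * x) * (sqrt pi * (2 powr (x - 1) / sqrt 2) * rGamma (3/2 - x) * half_beta (3/2 - x)))"
      unfolding Mn h M2 p2 p3 using \<open>rGamma (1/2 + a) = _\<close> by (simp add: aeq)
    also have "\<dots> = (sqrt pi * sqrt pi) * sqrt pi * (2 powr (1 - 2 * x) * 2 powr (x - 1)) * rGamma x * G *
        (2 / sqrt 2 + 2 * (x - 1) * half_beta (3/2 - x) / (sqrt 2 * sqrt 2))"
      unfolding G_def by (simp add: algebra_simps add_divide_distrib diff_divide_distrib del: real_sqrt_mult_self)
    also have "2 / sqrt 2 = sqrt 2" by (simp add: real_div_sqrt)
    finally show ?thesis unfolding p1 K_def by simp
  qed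
  have "rGamma (1/2 - x) = (1/2 - x) * rGamma (3/2 - x)" using rGamma_plus1[of "1/2 - x"] by (simp add: algebra_simps)
  then have "rGamma (1/2 + x) * rGamma (1 - (1/2 + x)) = rGamma (x + 1/2) * ((1/2 - x) * rGamma (3/2 - x))"
    by (simp add: add.commute)
  then have "(1/2 - x) * G = rGamma (1/2 + x) * rGamma (1 - (1/2 + x))" unfolding G_def by simp
  also have "\<dots> = cos (pi * x) / pi" unfolding rGamma_reflection_real by (simp add: distrib_left sin_add)
  finally have cG: "cos (pi * x) = pi * (1/2 - x) * G" by (simp add: field_simps)
  have "sin (pi / 4 - pi * a / 2 + pi * real 0 / 2) = sin (pi / 2 - pi * x)" by (simp add: x_def algebra_simps)
  also have "\<dots> = cos (pi * x)" by (simp add: sin_diff)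
  finally have "sin (pi / 4 - pi * a / 2 + pi * real 0 / 2) * pcf_M 0 a = K * G * ((1/2 - x) * half_beta x)"
    unfolding M cG by (simp add: K_def)
  then have "moment_comb 0 a = K * G * ((1/2 - x) * half_beta x + (x - 1) * half_beta (3/2 - x) + sqrt 2)"
    unfolding moment_comb_def X by (simp add: algebra_simps)
  also have "\<dots> = K * G * (Gamma x * Gamma (3/2 - x) / sqrt pi)"
  proof -
    have "Gamma (1/2 + 1 :: real) = 1/2 * Gamma (1/2)" by (rule Gamma_plus1) (auto elim!: nonpos_Ints_cases)
    then have "Gamma (3/2 :: real) = sqrt pi / 2" by (simp add: Gamma_one_half_real)
    then show ?thesis unfolding half_beta_identity[OF x] Beta_def by simp
  qed
  also have "\<dots> = pi * 2 powr (- x) * rGamma (x + 1/2) * (rGamma x * Gamma x) * (rGamma (3/2 - x) * Gamma (3/2 - x))"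
    unfolding K_def G_def by simp
  also have "rGamma x * Gamma x = 1"
    unfolding rGamma_inverse_Gamma by (rule left_inverse) (use Gamma_real_pos[of x] x in linarith)
  also have "rGamma (3/2 - x) * Gamma (3/2 - x) = 1"
    unfolding rGamma_inverse_Gamma by (rule left_inverse) (use Gamma_real_pos[of "3/2 - x"] x in linarith)
  finally show ?thesis by (simp add: x_def algebra_simps)
qed

lemma moment_comb_0_step: "(a + 1/2) * moment_comb 0 (a + 1) = moment_comb 0 (a - 1)"
proof -
  have 1: "(a + 1/2) * pcf_M 0 (a + 1) = 2 * pcf_h (1/2 + a) - pcf_M 0 (a - 1)"
    using pcf_M_down[of 0 a] pcf_M_up[of 0 a] by (simp add: algebra_simps)
  have 2: "pcf_M 0 (- (a + 1)) = 2 * pcf_h (1/2 - a) + (a - 1/2) * pcf_M 0 (- (a - 1))"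
  proof -
    have "- a - 1 = - (a + 1)" "- a + 1 = - (a - 1)" "- a + 1/2 = 1/2 - a" by simp_all
    then show ?thesis using pcf_M_down[of 0 "- a"] pcf_M_up[of 0 "- a"]
      by (simp only:) (simp add: left_diff_distrib)
  qed
  have g1: "(a + 1/2) * rGamma (1/2 + (a + 1)) = rGamma (1/2 + a)" using rGamma_plus1[of "1/2 + a"] by (simp add: algebra_simps)
  have g2: "rGamma (1/2 + a) * (a - 1/2) = rGamma (1/2 + (a - 1))" using rGamma_plus1[of "a - 1/2"] by (simp add: algebra_simps)
  have s1: "sin (pi / 4 - pi * (a + 1) / 2 + pi * real 0 / 2) = - sin (pi / 4 + pi * a / 2)"
  proof -
    have "pi / 4 - pi * (a + 1) / 2 + pi * real 0 / 2 = - (pi / 4 + pi * a / 2)" by (simp add: field_simps)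
    then show ?thesis by (simp only: sin_minus)
  qed
  have s2: "sin (pi / 4 - pi * (a - 1) / 2 + pi * real 0 / 2) = sin (pi / 4 + pi * a / 2)"
  proof -
    have "pi / 4 - pi * (a - 1) / 2 + pi * real 0 / 2 = pi - (pi / 4 + pi * a / 2)" by (simp add: field_simps)
    then show ?thesis by (simp only: sin_pi_minus)
  qed
  have "(a + 1/2) * moment_comb 0 (a + 1) = sqrt (pi / 2) * ((a + 1/2) * rGamma (1/2 + (a + 1))) * pcf_M 0 (- (a + 1)) -
      sin (pi / 4 + pi * a / 2) * ((a + 1/2) * pcf_M 0 (a + 1))"
    unfolding moment_comb_def s1 by (simp add: distrib_left right_diff_distrib mult.left_commute mult.assoc)
  also have "\<dots> = 2 * (sqrt (pi / 2) * rGamma (1/2 + a) * pcf_h (1/2 - a) - sin (pi / 4 + pi * a / 2) * pcf_h (1/2 + a)) +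
      sqrt (pi / 2) * (rGamma (1/2 + a) * (a - 1/2)) * pcf_M 0 (- (a - 1)) + sin (pi / 4 + pi * a / 2) * pcf_M 0 (a - 1)"
    unfolding g1 1 2 by (simp add: algebra_simps)
  also have "\<dots> = moment_comb 0 (a - 1)"
    unfolding pcf_h_connection g2 moment_comb_def s2 by simp
  finally show ?thesis .
qed

lemma moment_comb_0:
  assumes "a > - 1/2"
  shows "moment_comb 0 a = 2 powr (- a / 2 - 1/4) * pi * rGamma (a / 2 + 3/4)"
proof -
  have "a > - 1/2 \<Longrightarrow> a < 3/2 + 2 * real n \<Longrightarrow> moment_comb 0 a = 2 powr (- a / 2 - 1/4) * pi * rGamma (a / 2 + 3/4)" for n
  proof (induction n arbitrary: a)
    case 0
    then show ?case by (intro moment_comb_0_base) auto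
  next
    case (Suc n)
    show ?case
    \<comment> \<open>The base case reaches beyond 2. For a \<ge> 2 the recurrence may be divided by
      a - 1/2, and a - 2 is still above -1/2.\<close>
    proof (cases "a < 2")
      case True
      then show ?thesis using Suc.prems by (intro moment_comb_0_base) auto
    next
      case False
      have "(a - 1/2) * moment_comb 0 a = moment_comb 0 (a - 2)" using moment_comb_0_step[of "a - 1"] by (simp add: algebra_simps)
      also have "\<dots> = 2 powr (- (a - 2) / 2 - 1/4) * pi * rGamma ((a - 2) / 2 + 3/4)"
        using False Suc.prems by (intro Suc.IH) auto
      also have "(a - 2) / 2 + 3/4 = a / 2 - 1/4" by (simp add: field_simps)
      also have "rGamma (a / 2 - 1/4) = (a / 2 - 1/4) * rGamma (a / 2 + 3/4)"
        using rGamma_plus1[of "a / 2 - 1/4"] by (simp add: algebra_simps)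
      also have "2 powr (- (a - 2) / 2 - 1/4) = 2 * 2 powr (- a / 2 - 1/4)"
      proof -
        have "- (a - 2) / 2 - 1/4 = 1 + (- a / 2 - 1/4)" by (simp add: field_simps)
        then show ?thesis by (simp only: powr_add) simp
      qed
      also have "2 * 2 powr (- a / 2 - 1/4) * pi * ((a / 2 - 1/4) * rGamma (a / 2 + 3/4)) =
          (a - 1/2) * (2 powr (- a / 2 - 1/4) * pi * rGamma (a / 2 + 3/4))" by (simp add: algebra_simps)
      finally show ?thesis using False by simp
    qed
  qed
  moreover obtain n :: nat where "a < real n" using reals_Archimedean2 by blast
  then have "a < 3/2 + 2 * real n" by simp
  ultimately show ?thesis using assms by blast
qed

text \<open>Going from (R + 1, a) to (R, a + 1) or to (R - 1, a) shifts the phase of the sine by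
  \<pi>. These signs turn the differing recurrences of M_R(a) and M_R(-a) into one with common
  coefficients.\<close>

lemma moment_comb_rec:
  "moment_comb (Suc R) a = (2 * a + 1) * moment_comb R (a + 1) - 2 * real R * moment_comb (R - 1) a"
proof -
  define X where "X = (\<lambda>R a. sqrt (pi / 2) * rGamma (1/2 + a) * pcf_M R (- a))"
  define s where "s = sin (pi / 4 - pi * a / 2 + pi * real (Suc R) / 2)"
  have s1: "sin (pi / 4 - pi * (a + 1) / 2 + pi * real R / 2) = - s"
  proof -
    have "pi / 4 - pi * (a + 1) / 2 + pi * real R / 2 = (pi / 4 - pi * a / 2 + pi * real (Suc R) / 2) - pi" by (simp add: field_simps)
    then show ?thesis by (simp only: s_def sin_minus_pi)
  qed
  have s2: "real R * sin (pi / 4 - pi * a / 2 + pi * real (R - 1) / 2) = - (real R * s)"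
  proof (cases R)
    case (Suc n)
    have "pi / 4 - pi * a / 2 + pi * real n / 2 = (pi / 4 - pi * a / 2 + pi * real (Suc R) / 2) - pi" by (simp add: Suc field_simps)
    then show ?thesis by (simp only: s_def Suc diff_Suc_1 sin_minus_pi mult_minus_right)
  qed simp
  have g: "(a + 1/2) * rGamma (1/2 + (a + 1)) = rGamma (1/2 + a)" using rGamma_plus1[of "1/2 + a"] by (simp add: algebra_simps)
  let ?h = "\<lambda>\<nu>. if R = 0 then pcf_h \<nu> else 0"
  have Mup: "pcf_M (Suc R) b = 2 * ?h (1/2 + b) + 2 * real R * pcf_M (R - 1) b - (2 * b + 1) * pcf_M R (b + 1)" for b
    using pcf_M_up[of R b] by (simp add: add.commute)
  have M1: "pcf_M (Suc R) (- a) = - 2 * ?h (1/2 - a) - 2 * real R * pcf_M (R - 1) (- a) + 2 * pcf_M R (- (a + 1))"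
  proof -
    have "- a - 1 = - (a + 1)" "- a + 1/2 = 1/2 - a" "1/2 + - a = 1/2 - a" by simp_all
    then show ?thesis using Mup[of "- a"] pcf_M_down[of R "- a"]
      by (simp only:) (simp add: left_diff_distrib)
  qed
  have "X (Suc R) a = - 2 * (sqrt (pi / 2) * rGamma (1/2 + a) * ?h (1/2 - a)) - 2 * real R * X (R - 1) a +
      2 * (sqrt (pi / 2) * ((a + 1/2) * rGamma (1/2 + (a + 1))) * pcf_M R (- (a + 1)))"
    unfolding X_def M1 g by (simp add: algebra_simps)
  then have XR: "X (Suc R) a = - 2 * (sqrt (pi / 2) * rGamma (1/2 + a) * ?h (1/2 - a)) - 2 * real R * X (R - 1) a + (2 * a + 1) * X R (a + 1)"
    unfolding X_def by (simp add: algebra_simps)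
  have c: "sqrt (pi / 2) * rGamma (1/2 + a) * ?h (1/2 - a) = s * ?h (1/2 + a)"
  proof (cases "R = 0")
    case True
    have "pi / 4 - pi * a / 2 + pi * real (Suc 0) / 2 = pi - (pi / 4 + pi * a / 2)" by (simp add: field_simps)
    then have "s = sin (pi / 4 + pi * a / 2)" by (simp only: s_def True sin_pi_minus)
    then show ?thesis using True pcf_h_connection[of a] by simp
  qed simp
  have "moment_comb (Suc R) a = X (Suc R) a + s * pcf_M (Suc R) a" by (simp only: moment_comb_def X_def s_def)
  also have "\<dots> = (2 * a + 1) * (X R (a + 1) - s * pcf_M R (a + 1)) - 2 * real R * X (R - 1) a + 2 * (real R * s) * pcf_M (R - 1) a"
    unfolding XR c Mup[of a] by (simp add: algebra_simps)
  also have "\<dots> = (2 * a + 1) * (X R (a + 1) - s * pcf_M R (a + 1)) - 2 * (real R * X (R - 1) a + real R * sin (pi / 4 - pi * a / 2 + pi * real (R - 1) / 2) * pcf_M (R - 1) a)"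
    unfolding s2 by (simp add: algebra_simps)
  also have "\<dots> = (2 * a + 1) * moment_comb R (a + 1) - 2 * real R * moment_comb (R - 1) a"
    unfolding moment_comb_def X_def s1 by (simp add: algebra_simps)
  finally show ?thesis .
qed

subsection \<open>The hypergeometric value and the trigonometric factor\<close>

text \<open>The hypergeometric term after the duplication (-r)_(2s) = 4^s (1/2 - r/2)_s (-r/2)_s. A
  real r treats r - 1, r and r + 1 uniformly, also at r = 0.\<close>

definition hyp_coeff :: "real \<Rightarrow> nat \<Rightarrow> real" where
  "hyp_coeff r s = pochhammer (- r) (2 * s) / 8 ^ s / fact s"

lemma hyperF_reg_terminating:
  assumes "R \<le> N"
  shows "hyperF_reg (1/2 - real R / 2) (- real R / 2) c (1/2) = (\<Sum>s\<le>N. hyp_coeff (real R) s * rGamma (c + real s))"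
proof -
  have eq: "pochhammer (1/2 - real R / 2) s * pochhammer (- real R / 2) s * (1/2) ^ s * rGamma (c + real s) / fact s
     = hyp_coeff (real R) s * rGamma (c + real s)" for s
  proof -
    have "pochhammer (- real R) (2 * s) = 4 ^ s * (pochhammer (1/2 - real R / 2) s * pochhammer (- real R / 2) s)"
      using pochhammer_double[of "- real R / 2" s] by (simp add: power_mult add.commute)
    moreover have "(8::real) ^ s = 4 ^ s * 2 ^ s" by (simp flip: power_mult_distrib)
    ultimately show ?thesis by (simp add: hyp_coeff_def power_divide)
  qed
  have "hyperF_reg (1/2 - real R / 2) (- real R / 2) c (1/2) = (\<Sum>s. hyp_coeff (real R) s * rGamma (c + real s))"
    unfolding hyperF_reg_def eq ..
  also have "\<dots> = (\<Sum>s\<le>N. hyp_coeff (real R) s * rGamma (c + real s))"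
    by (rule suminf_finite) (use assms in \<open>auto simp: hyp_coeff_def pochhammer_of_nat_eq_0_lemma\<close>)
  finally show ?thesis .
qed

lemma hyp_coeff_Suc:
  fixes r :: real and n :: nat
  defines "Q \<equiv> r * pochhammer (1 - r) (2 * n)"
  shows "hyp_coeff (r + 1) (Suc n) = (r + 1) * Q / 8 ^ Suc n / fact (Suc n)"
    and "hyp_coeff r (Suc n) = (r - 2 * real n - 1) * Q / 8 ^ Suc n / fact (Suc n)"
    and "r * hyp_coeff (r - 1) (Suc n) = (r - 2 * real n - 1) * (r - 2 * real n - 2) * Q / 8 ^ Suc n / fact (Suc n)"
proof -
  have p: "pochhammer (- r) (Suc (2 * n)) = - Q"
    using pochhammer_rec[of "- r" "2 * n"] by (simp add: Q_def)
  have "pochhammer (- (r + 1)) (2 * Suc n) = (- (r + 1)) * pochhammer (- (r + 1) + 1) (Suc (2 * n))"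
    using pochhammer_rec[of "- (r + 1)" "Suc (2 * n)"] by simp
  also have "- (r + 1) + 1 = - r" by simp
  finally have "pochhammer (- (r + 1)) (2 * Suc n) = (r + 1) * Q" unfolding p by (simp add: algebra_simps)
  then show "hyp_coeff (r + 1) (Suc n) = (r + 1) * Q / 8 ^ Suc n / fact (Suc n)" by (simp only: hyp_coeff_def)
  have "pochhammer (- r) (2 * Suc n) = (- r + real (Suc (2 * n))) * pochhammer (- r) (Suc (2 * n))"
    using pochhammer_rec'[of "- r" "Suc (2 * n)"] by simp
  then have p2: "pochhammer (- r) (2 * Suc n) = (r - 2 * real n - 1) * Q" unfolding p by (simp add: algebra_simps)
  then show "hyp_coeff r (Suc n) = (r - 2 * real n - 1) * Q / 8 ^ Suc n / fact (Suc n)" by (simp only: hyp_coeff_def)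
  have "- r * pochhammer (- (r - 1)) (2 * Suc n) = pochhammer (- r) (Suc (2 * Suc n))"
    using pochhammer_rec[of "- r" "2 * Suc n"] by simp
  also have "\<dots> = (- r + real (2 * Suc n)) * pochhammer (- r) (2 * Suc n)" by (rule pochhammer_rec')
  finally have "r * pochhammer (- (r - 1)) (2 * Suc n) = (r - 2 * real n - 1) * (r - 2 * real n - 2) * Q"
    unfolding p2 by (simp add: algebra_simps)
  then show "r * hyp_coeff (r - 1) (Suc n) = (r - 2 * real n - 1) * (r - 2 * real n - 2) * Q / 8 ^ Suc n / fact (Suc n)"
    by (simp only: hyp_coeff_def times_divide_eq_right)
qed

text \<open>Creative telescoping: the summand of the three-term relation is the difference of
  consecutive values of the right-hand side. For a natural number r and large N that boundary value
  vanishes, which leaves the recurrence.\<close>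

lemma hyp_coeff_telescope:
  fixes c r :: real
  shows "(\<Sum>s\<le>N. 4 * (hyp_coeff (r + 1) s * rGamma (c + real s)) - (4 * c + 2 * r) * (hyp_coeff r s * rGamma (c + 1 + real s))
     + r * hyp_coeff (r - 1) s * rGamma (c + 1 + real s)) = - (r * hyp_coeff (r - 1) N * rGamma (c + 1 + real N))"
proof (induction N)
  case 0
  have "rGamma c = c * rGamma (c + 1)" by (rule rGamma_plus1[symmetric])
  then show ?case by (simp add: hyp_coeff_def algebra_simps)
next
  case (Suc n)
  define g where "g = rGamma (c + 1 + real (Suc n))"
  define Q where "Q = r * pochhammer (1 - r) (2 * n)"
  define k where "k = 8 ^ Suc n * (fact (Suc n) :: real)"
  have k: "k \<noteq> 0" by (simp add: k_def)
  have g1: "rGamma (c + real (Suc n)) = (c + real n + 1) * g"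
    using rGamma_plus1[of "c + real n + 1"] by (simp add: g_def algebra_simps)
  have g2: "rGamma (c + 1 + real n) = (c + real n + 1) * g"
    using g1 by (simp add: algebra_simps)
  have d0: "r * hyp_coeff (r - 1) n = 8 * (real n + 1) * Q / k"
  proof -
    have "8 * (real n + 1) \<noteq> 0" by (simp add: add_nonneg_eq_0_iff)
    moreover have "k = 8 * (real n + 1) * (8 ^ n * fact n)" by (simp add: k_def)
    moreover have "m * Q / (m * x) = Q / x" if "m \<noteq> 0" for m x :: real using that by simp
    ultimately have "8 * (real n + 1) * Q / k = Q / (8 ^ n * fact n)" by metis
    then show ?thesis by (simp add: hyp_coeff_def Q_def)
  qed
  note d = hyp_coeff_Suc[of r n, folded Q_def]
  have d1: "hyp_coeff (r + 1) (Suc n) = (r + 1) * Q / k" and d2: "hyp_coeff r (Suc n) = (r - 2 * real n - 1) * Q / k"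
    and d3: "r * hyp_coeff (r - 1) (Suc n) = (r - 2 * real n - 1) * (r - 2 * real n - 2) * Q / k"
    using d by (simp_all only: k_def divide_divide_eq_left)
  show ?case unfolding sum.atMost_Suc Suc g2 g1 d1 d2 d3 d0 g_def[symmetric]
    using k by (simp add: field_simps)
qed

lemma moment_value_rec:
  "moment_value (Suc R) a = (2 * a + 1) * moment_value R (a + 1) - 2 * real R * moment_value (R - 1) a"
proof -
  \<comment> \<open>With this c the arguments of 1/\<Gamma> in the three sums start at c or c + 1,
    and 4c + 2R = 2a + 1 is the coefficient of the recurrence.\<close>
  define c where "c = a / 2 - real R / 2 + 1/4"
  define E where "E = 2 powr (- a / 2 + 3/2 * real R - 3/4) * pi"
  let ?N = "Suc R"
  let ?S1 = "\<Sum>s\<le>?N. hyp_coeff (real R + 1) s * rGamma (c + real s)"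
  let ?S2 = "\<Sum>s\<le>?N. hyp_coeff (real R) s * rGamma (c + 1 + real s)"
  let ?S3 = "\<Sum>s\<le>?N. real R * hyp_coeff (real R - 1) s * rGamma (c + 1 + real s)"
  have "moment_value (Suc R) a = 4 * E * ?S1"
  proof -
    have "- a / 2 + 3/2 * real (Suc R) - 1/4 = 2 + (- a / 2 + 3/2 * real R - 3/4)" by (simp add: field_simps)
    then have "2 powr (- a / 2 + 3/2 * real (Suc R) - 1/4) * pi = 4 * E" unfolding E_def by (simp only: powr_add) simp
    moreover have "a / 2 - real (Suc R) / 2 + 3/4 = c" by (simp add: c_def field_simps)
    ultimately show ?thesis unfolding moment_value_def hyperF_reg_terminating[of "Suc R" ?N, OF order_refl]
      by (simp only:) (simp add: add.commute)
  qed
  moreover have "moment_value R (a + 1) = E * ?S2"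
  proof -
    have "- (a + 1) / 2 + 3/2 * real R - 1/4 = - a / 2 + 3/2 * real R - 3/4" by (simp add: field_simps)
    then have "2 powr (- (a + 1) / 2 + 3/2 * real R - 1/4) * pi = E" unfolding E_def by (simp only:)
    moreover have "(a + 1) / 2 - real R / 2 + 3/4 = c + 1" by (simp add: c_def field_simps)
    ultimately show ?thesis unfolding moment_value_def hyperF_reg_terminating[of R ?N, OF le_SucI[OF order_refl]]
      by (simp only:)
  qed
  moreover have "2 * real R * moment_value (R - 1) a = E * ?S3"
  proof (cases R)
    case (Suc n)
    have R: "real (R - 1) = real R - 1" using Suc by simp
    have "- a / 2 + 3/2 * real (R - 1) - 1/4 = (- a / 2 + 3/2 * real R - 3/4) - 1" unfolding R by (simp add: field_simps)
    then have "2 * (2 powr (- a / 2 + 3/2 * real (R - 1) - 1/4) * pi) = E" unfolding E_def by (simp only: powr_diff) simp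
    moreover have "a / 2 - real (R - 1) / 2 + 3/4 = c + 1" unfolding R by (simp add: c_def field_simps)
    moreover have "hyperF_reg (1/2 - real (R - 1) / 2) (- real (R - 1) / 2) (c + 1) (1/2) =
        (\<Sum>s\<le>?N. hyp_coeff (real R - 1) s * rGamma (c + 1 + real s))"
      using hyperF_reg_terminating[of "R - 1" ?N "c + 1"] R by simp
    ultimately have "2 * moment_value (R - 1) a = E * (\<Sum>s\<le>?N. hyp_coeff (real R - 1) s * rGamma (c + 1 + real s))"
      unfolding moment_value_def by (simp only: mult.assoc[symmetric])
    then have "real R * (2 * moment_value (R - 1) a) = E * (real R * (\<Sum>s\<le>?N. hyp_coeff (real R - 1) s * rGamma (c + 1 + real s)))"
      by simp
    then show ?thesis by (simp only: sum_distrib_left mult.assoc)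
  qed simp
  moreover have "4 * ?S1 - (4 * c + 2 * real R) * ?S2 + ?S3 = 0"
  proof -
    have "pochhammer (1 - real R) (2 * ?N) = 0 \<or> R = 0"
    proof (cases R)
      case (Suc n)
      then have "pochhammer (- real n) (2 * ?N) = 0" by (intro pochhammer_of_nat_eq_0_lemma) simp
      then show ?thesis by (simp add: Suc)
    qed simp
    then have "real R * hyp_coeff (real R - 1) ?N = 0" by (auto simp: hyp_coeff_def)
    moreover have "4 * ?S1 - (4 * c + 2 * real R) * ?S2 + ?S3 = - (real R * hyp_coeff (real R - 1) ?N * rGamma (c + 1 + real ?N))"
      unfolding hyp_coeff_telescope[symmetric, of "real R" ?N c]
      by (simp only: sum.distrib sum_subtractf sum_distrib_left)
    ultimately show ?thesis by (simp only: mult_zero_left minus_zero)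
  qed
  moreover have "4 * c + 2 * real R = 2 * a + 1" by (simp add: c_def field_simps)
  ultimately show ?thesis by algebra
qed

text \<open>Both sides share the recurrence in R and the initial value. The recurrence never lowers
  a, so a > -1/2 persists.\<close>

lemma moment_comb_eq_moment_value:
  assumes "a > - 1/2"
  shows "moment_comb R a = moment_value R a"
  using assms
proof (induction R arbitrary: a rule: less_induct)
  case (less R)
  show ?case
  proof (cases R)
    case 0
    have "moment_value 0 a = 2 powr (- a / 2 - 1/4) * pi * rGamma (a / 2 + 3/4)"
      unfolding moment_value_def using hyperF_reg_terminating[of 0 0 "a / 2 + 3/4"] by (simp add: hyp_coeff_def)
    then show ?thesis using moment_comb_0[OF less.prems] 0 by simp
  next
    case (Suc n)
    have "moment_comb n (a + 1) = moment_value n (a + 1)" using less.prems Suc by (intro less.IH) auto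
    moreover have "real n * moment_comb (n - 1) a = real n * moment_value (n - 1) a"
      using less.prems Suc by (cases n) (auto intro!: less.IH)
    ultimately show ?thesis unfolding Suc moment_comb_rec moment_value_rec by (simp add: mult.assoc)
  qed
qed

section \<open>The trigonometric factor as a single tangent\<close>

lemma cos_eq_0_half_integer:
  assumes "cos (pi * a) = 0" shows "\<exists>N::int. a = of_int N + 1/2"
proof -
  obtain i :: int where i: "odd i" "pi * a = of_int i * (pi / 2)" using assms cos_zero_iff_int by auto
  then obtain N where "i = 2 * N + 1" by (elim oddE)
  then have "pi * a = pi * (of_int N + 1/2)" using i(2) by (simp add: field_simps)
  then show ?thesis by auto
qed

text \<open>The half-angle formula (sin x + 1)/cos x = tan(x/2 + \<pi>/4), with R turning the angle
  by multiples of \<pi>/2. The single tangent has its poles exactly at the excluded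
  parameters.\<close>

lemma tan_sec_formula:
  assumes "cos (pi * a) \<noteq> 0"
  shows "tan (pi * a) + (-1) ^ R * (1 / cos (pi * a)) = tan (pi * a / 2 + pi / 4 - pi * real R / 2)"
    and "cos (pi * a / 2 + pi / 4 - pi * real R / 2) \<noteq> 0"
proof -
  let ?\<phi> = "pi * a / 2 + pi / 4 - pi * real R / 2"
  have e: "2 * ?\<phi> = pi * a + pi / 2 - real R * pi" by (simp add: field_simps)
  have s: "sin (2 * ?\<phi>) = (-1) ^ R * cos (pi * a)"
    unfolding e sin_diff by (simp add: sin_add cos_npi sin_npi)
  have c: "cos (2 * ?\<phi>) = - ((-1) ^ R * sin (pi * a))"
    unfolding e cos_diff by (simp add: cos_add cos_npi sin_npi)
  have s': "2 * sin ?\<phi> * cos ?\<phi> = (-1) ^ R * cos (pi * a)" using s unfolding sin_double .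
  then show nz: "cos ?\<phi> \<noteq> 0" using assms by auto
  have c': "1 - 2 * (sin ?\<phi>)\<^sup>2 = - ((-1) ^ R * sin (pi * a))"
    using c unfolding cos_double_sin .
  have R: "(-1) ^ R * (-1) ^ R = (1::real)" by (simp flip: power_mult_distrib)
  have "sin ?\<phi> * cos (pi * a) = cos ?\<phi> * (sin (pi * a) + (-1) ^ R)"
  proof -
    have "cos (pi * a) = (-1) ^ R * (2 * sin ?\<phi> * cos ?\<phi>)" unfolding s' using R by (simp add: mult.assoc[symmetric])
    moreover have "sin (pi * a) + (-1) ^ R = (-1) ^ R * (2 * (sin ?\<phi>)\<^sup>2)"
    proof -
      have "2 * (sin ?\<phi>)\<^sup>2 = 1 + (-1) ^ R * sin (pi * a)" using c' by linarith
      then show ?thesis using R by (simp add: distrib_left mult.assoc[symmetric])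
    qed
    ultimately show ?thesis by (simp add: power2_eq_square)
  qed
  then show "tan (pi * a) + (-1) ^ R * (1 / cos (pi * a)) = tan ?\<phi>"
    unfolding tan_def using assms nz by (simp add: field_simps)
qed

lemma eventually_not_half_integer:
  fixes a :: real
  assumes "a = of_int N + 1/2"
  shows "eventually (\<lambda>b. \<forall>M::int. b \<noteq> of_int M + 1/2) (at a)"
proof -
  have "eventually (\<lambda>b. dist b a < 1 \<and> b \<noteq> a) (at a)"
    by (auto simp: eventually_at intro: exI[of _ 1])
  then show ?thesis
  proof eventually_elim
    case (elim b)
    show ?case
    proof (intro allI notI)
      fix M :: int assume b: "b = of_int M + 1/2"
      then have "\<bar>of_int (M - N)\<bar> < (1::real)" using elim assms by (simp add: dist_real_def)
      then have "\<bar>M - N\<bar> < 1" by linarith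
      then show False using elim b assms by simp
    qed
  qed
qed

lemma tan_sec_eq_tan:
  assumes "\<forall>N::int. even (N - int R) \<longrightarrow> a \<noteq> of_int N + 1/2"
  shows "tan_sec R a = tan (pi * a / 2 + pi / 4 - pi * real R / 2)"
    and "cos (pi * a / 2 + pi / 4 - pi * real R / 2) \<noteq> 0"
proof -
  have "tan_sec R a = tan (pi * a / 2 + pi / 4 - pi * real R / 2) \<and> cos (pi * a / 2 + pi / 4 - pi * real R / 2) \<noteq> 0"
  proof (cases "removable_param R a")
    case True
    then obtain N :: int where N: "a = of_int N + 1/2" "odd (N - int R)" by (auto simp: removable_param_def)
    then obtain m where m: "N - int R = 2 * m + 1" by (elim oddE)
    \<comment> \<open>For N - R odd the angle is a multiple of \<pi>, where the tangent is
      continuous, so the limit is its value.\<close>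
    have "pi * a / 2 + pi / 4 - pi * real R / 2 = pi / 2 * (of_int (N - int R) + 1)" by (simp add: N field_simps)
    also have "\<dots> = of_int (m + 1) * pi" unfolding m by (simp add: field_simps)
    finally have e: "pi * a / 2 + pi / 4 - pi * real R / 2 = of_int (m + 1) * pi" .
    have nz: "cos (pi * a / 2 + pi / 4 - pi * real R / 2) \<noteq> 0"
    proof -
      have "sin (pi * a / 2 + pi / 4 - pi * real R / 2) = 0" unfolding e sin_zero_iff_int2 by blast
      then show ?thesis using sin_cos_squared_add[of "pi * a / 2 + pi / 4 - pi * real R / 2"] by auto
    qed
    have "((\<lambda>b. tan (pi * b / 2 + pi / 4 - pi * real R / 2)) \<longlongrightarrow> tan (pi * a / 2 + pi / 4 - pi * real R / 2)) (at a)"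
      by (intro tendsto_intros nz) auto
    moreover have "eventually (\<lambda>b. tan (pi * b / 2 + pi / 4 - pi * real R / 2) = tan (pi * b) + (-1) ^ R * (1 / cos (pi * b))) (at a)"
      using eventually_not_half_integer[OF N(1)]
      by eventually_elim (metis cos_eq_0_half_integer tan_sec_formula(1))
    ultimately have "((\<lambda>b. tan (pi * b) + (-1) ^ R * (1 / cos (pi * b))) \<longlongrightarrow> tan (pi * a / 2 + pi / 4 - pi * real R / 2)) (at a)"
      by (rule Lim_transform_eventually)
    then have "Lim (at a) (\<lambda>b. tan (pi * b) + (-1) ^ R * (1 / cos (pi * b))) = tan (pi * a / 2 + pi / 4 - pi * real R / 2)"
      by (intro tendsto_Lim) auto
    then show ?thesis using True nz by (simp add: tan_sec_def)
  next
    case False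
    have "cos (pi * a) \<noteq> 0"
      using cos_eq_0_half_integer[of a] False assms unfolding removable_param_def by blast
    then show ?thesis using False tan_sec_formula[of a R] by (simp add: tan_sec_def)
  qed
  then show "tan_sec R a = tan (pi * a / 2 + pi / 4 - pi * real R / 2)"
    "cos (pi * a / 2 + pi / 4 - pi * real R / 2) \<noteq> 0" by simp_all
qed

subsection \<open>The solutions and their connection\<close>

lemma has_field_derivative_U_sol:
  "(U_sol j (of_real a) has_field_derivative (- \<i>) ^ j * deriv (pcf_U ((-1) ^ j * a)) ((- \<i>) ^ j * z)) (at z)"
proof -
  have "(pcf_U ((-1) ^ j * a) has_field_derivative deriv (pcf_U ((-1) ^ j * a)) w) (at w)" for w :: complex
    using has_field_derivative_pcf_U'[of "(-1) ^ j * a" w] by (simp add: deriv_pcf_U)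
  from DERIV_chain2[OF this, of "\<lambda>z. (- \<i>) ^ j * z" "(- \<i>) ^ j" z UNIV]
  have "((\<lambda>z. pcf_U ((-1) ^ j * a) ((- \<i>) ^ j * z)) has_field_derivative
      deriv (pcf_U ((-1) ^ j * a)) ((- \<i>) ^ j * z) * (- \<i>) ^ j) (at z)"
    using DERIV_cmult_Id[of "(- \<i>) ^ j" z UNIV] by simp
  moreover have "U_sol j (of_real a) = (\<lambda>z. pcf_U ((-1) ^ j * a) ((- \<i>) ^ j * z))"
    using U_sol_of_real by (rule ext)
  ultimately show ?thesis by (simp add: mult.commute)
qed

lemma holomorphic_U_sol: "U_sol j (of_real a) holomorphic_on S"
  by (rule holomorphic_on_subset[of _ UNIV])
    (auto simp: holomorphic_on_def field_differentiable_def intro: has_field_derivative_U_sol)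

text \<open>The chain rule brings out (-i)^(2j) = (-1)^j, which undoes the signs of both z^2/4 and
  a; hence all U_j solve the same equation.\<close>

lemma deriv_deriv_U_sol: "deriv (deriv (U_sol j (of_real a))) z = (z\<^sup>2 / 4 + of_real a) * U_sol j (of_real a) z"
proof -
  let ?c = "(- \<i>) ^ j" and ?b = "(-1) ^ j * a"
  have d: "deriv (U_sol j (of_real a)) = (\<lambda>z. ?c * deriv (pcf_U ?b) (?c * z))"
    using DERIV_imp_deriv[OF has_field_derivative_U_sol] by (rule ext)
  have "((\<lambda>z. ?c * deriv (pcf_U ?b) (?c * z)) has_field_derivative
      ?c * ((((?c * z)\<^sup>2 / 4 + of_real ?b) * pcf_U ?b (?c * z)) * ?c)) (at z)"
    by (intro DERIV_cmult DERIV_chain2[where f = "deriv (pcf_U ?b)" and g = "\<lambda>z. ?c * z"]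
        has_field_derivative_deriv_pcf_U DERIV_cmult_Id)
  then have "deriv (deriv (U_sol j (of_real a))) z = ?c * ((((?c * z)\<^sup>2 / 4 + of_real ?b) * pcf_U ?b (?c * z)) * ?c)"
    unfolding d by (rule DERIV_imp_deriv)
  also have "\<dots> = (?c * ?c) * (((?c * ?c) * z\<^sup>2 / 4 + (-1) ^ j * of_real a) * pcf_U ?b (?c * z))"
    by (simp add: power2_eq_square mult_ac)
  also have "?c * ?c = (-1) ^ j" by (simp flip: power_mult_distrib)
  also have "(-1) ^ j * (((-1) ^ j * z\<^sup>2 / 4 + (-1) ^ j * of_real a) * pcf_U ?b (?c * z)) =
      ((-1) ^ j * (-1) ^ j) * ((z\<^sup>2 / 4 + of_real a) * pcf_U ?b (?c * z))"
    by (simp only: distrib_left distrib_right mult_ac times_divide_eq_right times_divide_eq_left)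
  also have "(-1) ^ j * (-1) ^ j = (1::complex)" by (simp flip: power_mult_distrib)
  finally have "deriv (deriv (U_sol j (of_real a))) z = (z\<^sup>2 / 4 + of_real a) * pcf_U ?b (?c * z)" by simp
  then show ?thesis by (simp add: U_sol_of_real)
qed

lemma wronskian_U_sol:
  "wronskian (U_sol j (of_real a)) (U_sol k (of_real a)) z =
     (- \<i>) ^ j * of_real (pcf_h ((-1) ^ j * a - 1/2) * pcf_h ((-1) ^ k * a + 1/2))
     - (- \<i>) ^ k * of_real (pcf_h ((-1) ^ j * a + 1/2) * pcf_h ((-1) ^ k * a - 1/2))"
proof -
  have "wronskian (U_sol j (of_real a)) (U_sol k (of_real a)) z = wronskian (U_sol j (of_real a)) (U_sol k (of_real a)) 0"
    by (rule wronskian_constant[OF holomorphic_U_sol deriv_deriv_U_sol holomorphic_U_sol deriv_deriv_U_sol])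
  moreover have "deriv (U_sol j (of_real a)) 0 = - ((- \<i>) ^ j * of_real (pcf_h ((-1) ^ j * a - 1/2)))" for j
    using DERIV_imp_deriv[OF has_field_derivative_U_sol[of j a 0]] by (simp add: deriv_pcf_U pcf_U_0)
  ultimately show ?thesis by (simp add: wronskian_def U_sol_of_real pcf_U_0 algebra_simps)
qed

text \<open>The z-dependent part of the integral from infinity. Starting at 0 for every j, it
  inherits all linear relations among the solutions without integration constants.\<close>

definition U_prim :: "nat \<Rightarrow> nat \<Rightarrow> real \<Rightarrow> complex \<Rightarrow> complex" where
  "U_prim j R a z = contour_integral (linepath 0 z) (\<lambda>t. t ^ R * U_sol j (of_real a) t)"

text \<open>On the ray in direction i^j the function U_j reduces to U((-1)^j a, s) with real s, so
  the part from infinity to 0 is minus a moment; the extra factor i^j comes from dt.\<close>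

lemma int_from_inf_U_sol:
  "int_from_inf (\<i> ^ j) (\<lambda>t. t ^ R * U_sol j (of_real a) t) z =
     U_prim j R a z - (\<i> ^ j) ^ Suc R * of_real (pcf_M R ((-1) ^ j * a))"
proof -
  let ?d = "\<i> ^ j" and ?b = "(-1) ^ j * a"
  define f where "f = (\<lambda>t. t ^ R * U_sol j (of_real a) t)"
  have "f holomorphic_on UNIV" unfolding f_def by (intro holomorphic_intros holomorphic_U_sol)
  \<comment> \<open>A global primitive replaces the segment from \<open>of_real r * ?d\<close> to z
    by the path through 0.\<close>
  then obtain F where F: "\<And>x. (F has_field_derivative f x) (at x within UNIV)"
    using holomorphic_convex_primitive'[of UNIV f] by auto
  have cont: "contour_integral (linepath x y) f = F y - F x" for x y
    using contour_integral_unique[OF contour_integral_primitive[OF F, of "linepath x y"]] by simp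
  have unit: "(- \<i>) ^ j * ?d = 1" by (simp flip: power_mult_distrib)
  have fd: "f (of_real s * ?d) * ?d = ?d ^ Suc R * of_real (s ^ R * pcf_U ?b s)" for s :: real
  proof -
    have e: "(- \<i>) ^ j * (of_real s * ?d) = of_real s" using unit by (simp only: mult.left_commute mult_1_right)
    then have "U_sol j (of_real a) (of_real s * ?d) = of_real (pcf_U ?b s)"
      by (simp only: U_sol_of_real e pcf_U_of_real)
    then show ?thesis by (simp add: f_def power_mult_distrib)
  qed
  have "F (of_real r * ?d) - F 0 = ?d ^ Suc R * of_real (integral {0..r} (\<lambda>s. s ^ R * pcf_U ?b s))" if r: "r \<ge> 0" for r
  proof -
    have "((\<lambda>s. F (of_real s * ?d)) has_vector_derivative f (of_real s * ?d) * ?d) (at s within {0..r})" for s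
    proof -
      have "((\<lambda>w. w * ?d) has_field_derivative ?d) (at (of_real s))" by (auto intro!: derivative_eq_intros)
      from DERIV_chain2[where f = F and g = "\<lambda>w. w * ?d", OF F this]
      have "((\<lambda>w. F (w * ?d)) has_field_derivative f (of_real s * ?d) * ?d) (at (of_real s))" .
      then show ?thesis by (rule has_vector_derivative_real_field)
    qed
    from fundamental_theorem_of_calculus[OF r this]
    have "((\<lambda>s. ?d ^ Suc R * complex_of_real (s ^ R * pcf_U ?b s)) has_integral F (of_real r * ?d) - F 0) {0..r}"
      by (simp only: fd) simp
    moreover have "((\<lambda>s. ?d ^ Suc R * complex_of_real (s ^ R * pcf_U ?b s)) has_integral
        ?d ^ Suc R * of_real (integral {0..r} (\<lambda>s. s ^ R * pcf_U ?b s))) {0..r}"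
      by (intro has_integral_mult_right has_integral_of_real integrable_integral integrable_continuous_interval continuous_on_moment_integrand)
    ultimately show ?thesis by (rule has_integral_unique)
  qed
  then have "eventually (\<lambda>r. F z - F 0 - ?d ^ Suc R * of_real (integral {0..r} (\<lambda>s. s ^ R * pcf_U ?b s)) =
      contour_integral (linepath (of_real r * ?d) z) f) at_top"
    unfolding eventually_at_top_linorder cont by (intro exI[of _ 0]) (auto simp: algebra_simps)
  moreover have "((\<lambda>r. F z - F 0 - ?d ^ Suc R * of_real (integral {0..r} (\<lambda>s. s ^ R * pcf_U ?b s))) \<longlongrightarrow>
      F z - F 0 - ?d ^ Suc R * of_real (pcf_M R ?b)) at_top"
    by (intro tendsto_intros moment_tendsto)
  ultimately have "((\<lambda>r. contour_integral (linepath (of_real r * ?d) z) f) \<longlongrightarrow> F z - F 0 - ?d ^ Suc R * of_real (pcf_M R ?b)) at_top"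
    by (rule Lim_transform_eventually[rotated])
  then have "int_from_inf ?d f z = F z - F 0 - ?d ^ Suc R * of_real (pcf_M R ?b)"
    unfolding int_from_inf_def by (rule tendsto_Lim[OF trivial_limit_at_top_linorder])
  then show ?thesis using cont[of 0 z] by (simp add: U_prim_def f_def)
qed

lemma U_inhom_eq:
  "U_inhom j k R (of_real a) z = 1 / wronskian (U_sol j (of_real a)) (U_sol k (of_real a)) 0 *
     (U_sol k (of_real a) z * (U_prim j R a z - (\<i> ^ j) ^ Suc R * of_real (pcf_M R ((-1) ^ j * a)))
      - U_sol j (of_real a) z * (U_prim k R a z - (\<i> ^ k) ^ Suc R * of_real (pcf_M R ((-1) ^ k * a))))"
proof -
  have "wronskian (U_sol j (of_real a)) (U_sol k (of_real a)) z = wronskian (U_sol j (of_real a)) (U_sol k (of_real a)) 0"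
    unfolding wronskian_U_sol ..
  then show ?thesis unfolding U_inhom_def int_from_inf_U_sol by simp
qed

text \<open>The expansion of a 3 by 3 determinant with the row of solutions repeated, all Wronskians
  taken at the same t; since they are constant, the relation can be integrated.\<close>

lemma U_sol_linear_relation:
  fixes a :: real
  defines "W \<equiv> \<lambda>j k. wronskian (U_sol j (of_real a)) (U_sol k (of_real a)) 0"
  shows "W j k * U_sol i (of_real a) t + W k i * U_sol j (of_real a) t + W i j * U_sol k (of_real a) t = 0"
    and "W j k * U_prim i R a z + W k i * U_prim j R a z + W i j * U_prim k R a z = 0"
proof -
  have W: "W j k = wronskian (U_sol j (of_real a)) (U_sol k (of_real a)) t" for j k t
    unfolding W_def wronskian_U_sol ..
  show 1: "W j k * U_sol i (of_real a) t + W k i * U_sol j (of_real a) t + W i j * U_sol k (of_real a) t = 0" for t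
    unfolding W[of _ _ t] wronskian_def by (simp add: algebra_simps)
  let ?f = "\<lambda>j t. t ^ R * U_sol j (of_real a) t"
  have "continuous_on S (?f j)" for j S
    by (intro holomorphic_on_imp_continuous_on holomorphic_intros holomorphic_U_sol)
  then have i: "((\<lambda>t. c * ?f j t) has_contour_integral c * U_prim j R a z) (linepath 0 z)" for c j
    unfolding U_prim_def
    by (intro has_contour_integral_lmul has_contour_integral_integral contour_integrable_continuous_linepath)
  have "((\<lambda>t. W j k * ?f i t + W k i * ?f j t + W i j * ?f k t) has_contour_integral
      W j k * U_prim i R a z + W k i * U_prim j R a z + W i j * U_prim k R a z) (linepath 0 z)"
    by (intro has_contour_integral_add i)
  moreover have "W j k * ?f i t + W k i * ?f j t + W i j * ?f k t = 0" for t
  proof -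
    have "W j k * ?f i t + W k i * ?f j t + W i j * ?f k t =
        t ^ R * (W j k * U_sol i (of_real a) t + W k i * U_sol j (of_real a) t + W i j * U_sol k (of_real a) t)"
      by (simp only: distrib_left mult_ac)
    then show ?thesis by (simp only: 1 mult_zero_right)
  qed
  ultimately have "((\<lambda>t. 0) has_contour_integral
      W j k * U_prim i R a z + W k i * U_prim j R a z + W i j * U_prim k R a z) (linepath 0 z)" by simp
  then show "W j k * U_prim i R a z + W k i * U_prim j R a z + W i j * U_prim k R a z = 0"
    using has_contour_integral_unique[OF _ has_contour_integral_0] by blast
qed

text \<open>After clearing the Wronskians, the linear relations remove the primitives and convert
  the multiples of U_k and U_2 into U_0, so only the constants \<open>c\<close> remain in front of
  U_0.\<close>

lemma U_inhom_difference:
  fixes a :: real and R :: nat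
  defines "W \<equiv> \<lambda>j k. wronskian (U_sol j (of_real a)) (U_sol k (of_real a)) 0"
    and "c \<equiv> \<lambda>j. (\<i> ^ j) ^ Suc R * of_real (pcf_M R ((-1) ^ j * a))"
  assumes "W 0 k \<noteq> 0" "W 0 2 \<noteq> 0"
  shows "U_inhom 0 2 R (of_real a) z - U_inhom 0 k R (of_real a) z =
    U_sol 0 (of_real a) z * (W k 2 * c 0 - W 0 2 * c k + W 0 k * c 2) / (W 0 k * W 0 2)"
proof -
  let ?u = "\<lambda>j. U_sol j (of_real a) z" and ?F = "\<lambda>j. U_prim j R a z"
  have "W 2 0 = - W 0 2" unfolding W_def wronskian_def by simp
  moreover have "W k 2 * ?u 0 + W 2 0 * ?u k + W 0 k * ?u 2 = 0" "W k 2 * ?F 0 + W 2 0 * ?F k + W 0 k * ?F 2 = 0"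
    unfolding W_def by (rule U_sol_linear_relation)+
  ultimately have 1: "W k 2 * ?u 0 = W 0 2 * ?u k - W 0 k * ?u 2" and 2: "W k 2 * ?F 0 = W 0 2 * ?F k - W 0 k * ?F 2"
    by (simp_all add: algebra_simps)
  have e: "U_inhom 0 k R (of_real a) z = 1 / W 0 k * (?u k * (?F 0 - c 0) - ?u 0 * (?F k - c k))" for k
    unfolding W_def c_def by (rule U_inhom_eq)
  have "(W 0 k * W 0 2) * (U_inhom 0 2 R (of_real a) z - U_inhom 0 k R (of_real a) z) =
     W 0 k * (?u 2 * (?F 0 - c 0) - ?u 0 * (?F 2 - c 2)) - W 0 2 * (?u k * (?F 0 - c 0) - ?u 0 * (?F k - c k))"
    unfolding e using assms(3,4) by (simp add: field_simps)
  also have "\<dots> = ?u 0 * (W k 2 * c 0 - W 0 2 * c k + W 0 k * c 2)"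
    using 1 2 by algebra
  finally show ?thesis using assms(3,4) by (simp add: field_simps)
qed

lemma pcf_h_products:
  defines "\<theta> \<equiv> \<lambda>a. pi * a / 2 + pi / 4"
  shows "pcf_h (1/2 - a) * pcf_h (a - 1/2) = sin (\<theta> a)"
    and "pcf_h (- a - 1/2) * pcf_h (a + 1/2) = cos (\<theta> a)"
    and "2 * pcf_h (- a - 1/2) * pcf_h (1/2 - a) = sqrt (2 * pi) * rGamma (1/2 - a)"
proof -
  have s: "sqrt pi * sqrt pi = pi" by simp
  have "pcf_h (1/2 - a) * pcf_h (a - 1/2) =
     (sqrt pi * sqrt pi) * (2 powr (- (1/2 - a) / 2) * 2 powr (- (a - 1/2) / 2)) * (rGamma (a / 2 + 1/4) * rGamma (1 - (a / 2 + 1/4)))"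
    unfolding pcf_h_def by (simp add: algebra_simps add_divide_distrib diff_divide_distrib)
  also have "2 powr (- (1/2 - a) / 2) * 2 powr (- (a - 1/2) / 2) = (1::real)"
    by (simp only: powr_add[symmetric]) (simp add: field_simps)
  finally show "pcf_h (1/2 - a) * pcf_h (a - 1/2) = sin (\<theta> a)"
    unfolding rGamma_reflection_real s by (simp add: \<theta>_def algebra_simps)
  have "pcf_h (- a - 1/2) * pcf_h (a + 1/2) =
     (sqrt pi * sqrt pi) * (2 powr (- (- a - 1/2) / 2) * 2 powr (- (a + 1/2) / 2)) * (rGamma (a / 2 + 3/4) * rGamma (1 - (a / 2 + 3/4)))"
    unfolding pcf_h_def by (simp add: algebra_simps add_divide_distrib diff_divide_distrib)
  also have "2 powr (- (- a - 1/2) / 2) * 2 powr (- (a + 1/2) / 2) = (1::real)"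
    by (simp only: powr_add[symmetric]) (simp add: field_simps)
  finally have "pcf_h (- a - 1/2) * pcf_h (a + 1/2) = sin (pi * (a / 2 + 3/4))"
    unfolding rGamma_reflection_real s by simp
  also have "pi * (a / 2 + 3/4) = \<theta> a + pi / 2" by (simp add: \<theta>_def algebra_simps)
  also have "sin (\<theta> a + pi / 2) = cos (\<theta> a)" by (simp add: sin_add)
  finally show "pcf_h (- a - 1/2) * pcf_h (a + 1/2) = cos (\<theta> a)" .
  define y where "y = 1/4 - a / 2"
  have "2 * pcf_h (- a - 1/2) * pcf_h (1/2 - a) =
     2 * (sqrt pi * sqrt pi) * (2 powr (- (- a - 1/2) / 2) * 2 powr (- (1/2 - a) / 2)) * (rGamma y * rGamma (y + 1/2))"
    unfolding pcf_h_def y_def by (simp add: algebra_simps add_divide_distrib diff_divide_distrib)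
  also have "2 powr (- (- a - 1/2) / 2) * 2 powr (- (1/2 - a) / 2) = 2 powr a"
    by (simp only: powr_add[symmetric]) (simp add: field_simps)
  also have "rGamma y * rGamma (y + 1/2) = 2 powr (- a - 1/2) * rGamma (1/2 - a) / sqrt pi"
    unfolding rGamma_legendre_duplication_real by (simp add: y_def algebra_simps)
  also have "2 * (sqrt pi * sqrt pi) * 2 powr a * (2 powr (- a - 1/2) * rGamma (1/2 - a) / sqrt pi) =
      (2 powr a * 2 powr (- a - 1/2)) * 2 * sqrt pi * rGamma (1/2 - a)" by (simp add: field_simps)
  also have "2 powr a * 2 powr (- a - 1/2) = 1 / sqrt 2"
    by (simp only: powr_add[symmetric]) (simp add: powr_minus_divide powr_half_sqrt)
  also have "1 / sqrt 2 * 2 * sqrt pi * rGamma (1/2 - a) = sqrt (2 * pi) * rGamma (1/2 - a)"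
    by (simp add: real_sqrt_mult real_div_sqrt)
  finally show "2 * pcf_h (- a - 1/2) * pcf_h (1/2 - a) = sqrt (2 * pi) * rGamma (1/2 - a)" .
qed

text \<open>The pairs (0,1) and (0,3) have unimodular Wronskians and cause no trouble for any a; the
  pair (0,2) degenerates when 1/2 - a is a non-positive integer, which is the source of the
  exceptional parameters.\<close>

lemma wronskian_values:
  fixes a :: real
  defines "W \<equiv> \<lambda>j k. wronskian (U_sol j (of_real (- a))) (U_sol k (of_real (- a))) 0"
    and "\<theta> \<equiv> pi * a / 2 + pi / 4"
  shows "W 0 1 = cis \<theta>" "W 0 3 = cis (- \<theta>)" "W 1 2 = cis (- \<theta>)" "W 3 2 = cis \<theta>"
    and "W 0 2 = of_real (sqrt (2 * pi) * rGamma (1/2 - a))"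
proof -
  note p = pcf_h_products[of a, folded \<theta>_def]
  have p1: "pcf_h (a + 1/2) * pcf_h (- a - 1/2) = cos \<theta>" "pcf_h (a - 1/2) * pcf_h (1/2 - a) = sin \<theta>"
    using p(1,2) by (simp_all add: mult.commute)
  have e: "- a + 1/2 = 1/2 - a" by simp
  have i: "(- \<i>) ^ 3 = \<i>" "(- \<i>) ^ 2 = - 1" by (simp_all add: power3_eq_cube)
  have m: "(-1 :: real) ^ 3 = -1" by simp
  note w = wronskian_U_sol power_0 power_one_right i m power2_minus one_power2 mult_1_left mult_minus1 minus_minus e p(1,2) p1
  show "W 0 1 = cis \<theta>" unfolding W_def by (simp only: w) (simp add: complex_eq_iff)
  show "W 0 3 = cis (- \<theta>)" unfolding W_def by (simp only: w) (simp add: complex_eq_iff)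
  show "W 1 2 = cis (- \<theta>)" unfolding W_def by (simp only: w) (simp add: complex_eq_iff)
  show "W 3 2 = cis \<theta>" unfolding W_def by (simp only: w) (simp add: complex_eq_iff)
  show "W 0 2 = of_real (sqrt (2 * pi) * rGamma (1/2 - a))"
    unfolding W_def p(3)[symmetric] by (simp only: w) (simp add: mult.commute)
qed

subsection \<open>The connection formula\<close>

lemma U_inhom_combination:
  fixes a :: real and R :: nat and z :: complex
  assumes a: "cos (pi * a) \<noteq> 0"
  shows "U_inhom 0 2 R (- of_real a) z = 1/2 * (U_inhom 0 1 R (- of_real a) z + U_inhom 0 3 R (- of_real a) z) +
    of_real (- tan (pi * a / 2 + pi / 4 - pi * real R / 2) * moment_comb R a) * U_sol 0 (- of_real a) z"
proof -
  define \<theta> where "\<theta> = pi * a / 2 + pi / 4"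
  define \<phi> where "\<phi> = \<theta> - pi * real R / 2"
  define w where "w = sqrt (2 * pi) * rGamma (1/2 - a)"
  define Mm where "Mm = pcf_M R (- a)"
  define Mp where "Mp = pcf_M R a"
  let ?k = "sqrt (pi / 2) * rGamma (1/2 + a)"
  \<comment> \<open>Reflection shows that the factor of M_R(-a) in \<open>moment_comb\<close> is
    cos(\<pi> a)/w, so the division by the Wronskian w becomes part of the tangent.\<close>
  have kw: "?k * w = cos (pi * a)"
  proof -
    have "?k * w = (sqrt (pi / 2) * sqrt (2 * pi)) * (rGamma (1/2 + a) * rGamma (1 - (1/2 + a)))" by (simp add: w_def)
    also have "sqrt (pi / 2) * sqrt (2 * pi) = pi" by (simp flip: real_sqrt_mult)
    finally show ?thesis unfolding rGamma_reflection_real by (simp add: distrib_left sin_add)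
  qed
  then have w0: "w \<noteq> 0" using a by auto
  note W = wronskian_values[of a, folded \<theta>_def w_def]
  let ?b = "of_real (- a) :: complex"
  let ?u = "U_sol 0 ?b z"
  have i3: "\<i> ^ 3 = - \<i>" by (simp add: power3_eq_cube)
  have d: "U_inhom 0 2 R ?b z - U_inhom 0 1 R ?b z =
      ?u * (cis (- \<theta>) * of_real Mm - of_real w * (\<i> ^ Suc R * of_real Mp) + cis \<theta> * ((-1) ^ Suc R * of_real Mm)) / (cis \<theta> * of_real w)"
    "U_inhom 0 2 R ?b z - U_inhom 0 3 R ?b z =
      ?u * (cis \<theta> * of_real Mm - of_real w * ((- \<i>) ^ Suc R * of_real Mp) + cis (- \<theta>) * ((-1) ^ Suc R * of_real Mm)) / (cis (- \<theta>) * of_real w)"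
    using U_inhom_difference[of "- a" 1 R z] U_inhom_difference[of "- a" 3 R z] w0
    unfolding W by (simp_all add: Mm_def Mp_def i3 del: power_Suc of_real_minus)
  have i: "\<i> ^ Suc R = cis (real (Suc R) * pi / 2)" "(- \<i>) ^ Suc R = cis (- (real (Suc R) * pi / 2))"
  proof -
    have "\<i> = cis (pi / 2)" "- \<i> = cis (- (pi / 2))" by (simp_all add: complex_eq_iff)
    then show "\<i> ^ Suc R = cis (real (Suc R) * pi / 2)" "(- \<i>) ^ Suc R = cis (- (real (Suc R) * pi / 2))"
      by (metis Complex.DeMoivre times_divide_eq_right mult_minus_right)+
  qed
  have cc: "cis \<theta> * cis (- \<theta>) = 1" "cis (- \<theta>) * cis \<theta> = 1" by (simp_all add: cis_mult)
  have alg: "(f * m - v * (p * n) + e * (q * m)) / (e * v) = m / v * (f * f) - p * f * n + q * m / v"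
    if "e * f = 1" "v \<noteq> 0" for e f m n p q v :: complex
  proof -
    have e: "e \<noteq> 0" and f: "f = 1 / e" using that(1) by (auto simp: eq_divide_eq mult.commute)
    show ?thesis unfolding f using e that(2) by (simp add: field_simps)
  qed
  have X1: "(cis (- \<theta>) * of_real Mm - of_real w * (\<i> ^ Suc R * of_real Mp) + cis \<theta> * ((-1) ^ Suc R * of_real Mm)) / (cis \<theta> * of_real w) =
     of_real (Mm / w) * cis (- 2 * \<theta>) - cis (real (Suc R) * pi / 2 - \<theta>) * of_real Mp + of_real ((-1) ^ Suc R * Mm / w)"
  proof -
    have "cis (- 2 * \<theta>) = cis (- \<theta>) * cis (- \<theta>)" "cis (real (Suc R) * pi / 2 - \<theta>) = \<i> ^ Suc R * cis (- \<theta>)"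
      unfolding i by (simp_all add: cis_mult)
    then show ?thesis using alg[OF cc(1)] w0 by (simp del: power_Suc)
  qed
  have X3: "(cis \<theta> * of_real Mm - of_real w * ((- \<i>) ^ Suc R * of_real Mp) + cis (- \<theta>) * ((-1) ^ Suc R * of_real Mm)) / (cis (- \<theta>) * of_real w) =
     of_real (Mm / w) * cis (2 * \<theta>) - cis (- (real (Suc R) * pi / 2 - \<theta>)) * of_real Mp + of_real ((-1) ^ Suc R * Mm / w)"
  proof -
    have "cis (2 * \<theta>) = cis \<theta> * cis \<theta>" "cis (- (real (Suc R) * pi / 2 - \<theta>)) = (- \<i>) ^ Suc R * cis \<theta>"
      unfolding i by (simp_all add: cis_mult)
    then show ?thesis using alg[OF cc(2)] w0 by (simp del: power_Suc)
  qed
  have cis2: "cis x + cis (- x) = of_real (2 * cos x)" for x by (simp add: complex_eq_iff)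
  \<comment> \<open>The phases from the pairs (0,1) and (0,3) are conjugate; their mean turns
    exponentials into cosines and makes the coefficient of U_0 real.\<close>
  let ?v = "Mm / w * cos (2 * \<theta>) - cos (real (Suc R) * pi / 2 - \<theta>) * Mp + (-1) ^ Suc R * Mm / w"
  have "2 * U_inhom 0 2 R ?b z - (U_inhom 0 1 R ?b z + U_inhom 0 3 R ?b z) =
      ?u * (of_real (Mm / w) * (cis (2 * \<theta>) + cis (- (2 * \<theta>))) -
        (cis (real (Suc R) * pi / 2 - \<theta>) + cis (- (real (Suc R) * pi / 2 - \<theta>))) * of_real Mp + 2 * of_real ((-1) ^ Suc R * Mm / w))"
  proof -
    have "2 * U_inhom 0 2 R ?b z - (U_inhom 0 1 R ?b z + U_inhom 0 3 R ?b z) =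
      (U_inhom 0 2 R ?b z - U_inhom 0 1 R ?b z) + (U_inhom 0 2 R ?b z - U_inhom 0 3 R ?b z)" by simp
    also have "\<dots> = ?u * (of_real (Mm / w) * cis (- 2 * \<theta>) - cis (real (Suc R) * pi / 2 - \<theta>) * of_real Mp + of_real ((-1) ^ Suc R * Mm / w)) +
       ?u * (of_real (Mm / w) * cis (2 * \<theta>) - cis (- (real (Suc R) * pi / 2 - \<theta>)) * of_real Mp + of_real ((-1) ^ Suc R * Mm / w))"
      unfolding d times_divide_eq_right[symmetric] X1 X3 ..
    finally show ?thesis by (simp only: mult_minus_left) (simp add: algebra_simps del: power_Suc)
  qed
  also have "\<dots> = 2 * (?u * of_real ?v)" unfolding cis2 by (simp add: algebra_simps del: power_Suc)
  finally have "U_inhom 0 2 R ?b z = 1/2 * (U_inhom 0 1 R ?b z + U_inhom 0 3 R ?b z) + of_real ?v * ?u"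
    by (simp add: field_simps del: power_Suc)
  moreover have "?v = - tan \<phi> * moment_comb R a"
  proof -
    have ph: "\<phi> = pi * a / 2 + pi / 4 - pi * real R / 2" by (simp add: \<phi>_def \<theta>_def)
    have t: "tan \<phi> * cos (pi * a) = sin (pi * a) + (-1) ^ R" and nz: "cos \<phi> \<noteq> 0"
      using tan_sec_formula[OF a, of R] a unfolding ph by (simp_all add: tan_def field_simps)
    have e2: "pi / 4 - pi * a / 2 + pi * real R / 2 = pi / 2 - \<phi>" by (simp add: ph field_simps)
    have e3: "real (Suc R) * pi / 2 - \<theta> = pi / 2 - \<phi>" by (simp add: \<phi>_def field_simps)
    have "2 * \<theta> = pi * a + pi / 2" by (simp add: \<theta>_def field_simps)
    then have c2: "cos (2 * \<theta>) = - sin (pi * a)" by (simp add: cos_add)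
    have k: "?k = cos (pi * a) / w" using kw w0 by (simp add: field_simps)
    have "- tan \<phi> * moment_comb R a = - (tan \<phi> * cos (pi * a)) * Mm / w - (tan \<phi> * cos \<phi>) * Mp"
      unfolding moment_comb_def e2 k Mm_def[symmetric] Mp_def[symmetric] by (simp add: sin_diff algebra_simps)
    also have "tan \<phi> * cos \<phi> = sin \<phi>" using nz by (simp add: tan_def)
    finally show ?thesis unfolding t c2 e3 by (simp add: cos_diff diff_divide_distrib algebra_simps)
  qed
  ultimately show ?thesis by (simp only: \<phi>_def \<theta>_def of_real_minus[of a])
qed

section \<open>Continuity in the parameter\<close>

lemma continuous_on_U_sol_param: "continuous_on S (\<lambda>b::real. U_sol j (of_real (- b)) z)"
  unfolding U_sol_of_real by (intro continuous_intros)

lemma continuous_on_U_prim_param: "continuous_on UNIV (\<lambda>b::real. U_prim j R (- b) z)"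
proof -
  have "U_prim j R (- b) z = integral (cbox 0 1)
      (\<lambda>x. (of_real x * z) ^ R * pcf_U ((-1) ^ j * - b) ((- \<i>) ^ j * (of_real x * z)) * z)" for b
    unfolding U_prim_def contour_integral_integral U_sol_of_real
    by (simp add: linepath_def scaleR_conv_of_real vector_derivative_linepath_at[unfolded linepath_def])
  moreover have "continuous_on UNIV (\<lambda>b. integral (cbox 0 1)
      (\<lambda>x::real. (of_real x * z) ^ R * pcf_U ((-1) ^ j * - b) ((- \<i>) ^ j * (of_real x * z)) * z))"
    by (rule integral_continuous_on_param) (unfold case_prod_unfold, intro continuous_intros)
  ultimately show ?thesis by simp
qed

text \<open>These pairs have an exponential, hence nowhere vanishing, Wronskian. For the pair (0,2)
  the limit is obtained from the connection formula itself.\<close>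

lemma tendsto_U_inhom_param:
  assumes k: "k = 1 \<or> k = 3"
  shows "((\<lambda>b. U_inhom 0 k R (- complex_of_real b) z) \<longlongrightarrow> U_inhom 0 k R (- complex_of_real a) z) (at a)"
proof -
  define s :: real where "s = (if k = 1 then 1 else -1)"
  have W: "wronskian (U_sol 0 (of_real (- b))) (U_sol k (of_real (- b))) 0 = cis (s * (pi * b / 2 + pi / 4))" for b
    using wronskian_values(1,2)[of b] k by (auto simp: s_def simp del: of_real_minus)
  have cont: "(f \<longlongrightarrow> f a) (at a)" if "continuous_on UNIV f" for f :: "real \<Rightarrow> complex"
    using that by (simp add: continuous_on_def)
  have u: "((\<lambda>b. U_sol j (of_real (- b)) z) \<longlongrightarrow> U_sol j (of_real (- a)) z) (at a)" for j
    by (rule cont[OF continuous_on_U_sol_param])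
  have p: "((\<lambda>b. U_prim j R (- b) z) \<longlongrightarrow> U_prim j R (- a) z) (at a)" for j
    by (rule cont[OF continuous_on_U_prim_param])
  have m: "((\<lambda>b. pcf_M R ((-1) ^ j * - b)) \<longlongrightarrow> pcf_M R ((-1) ^ j * - a)) (at a)" for j :: nat
    by (rule isCont_tendsto_compose[OF isCont_pcf_M]) (intro tendsto_intros)
  have "((\<lambda>b. U_inhom 0 k R (of_real (- b)) z) \<longlongrightarrow> U_inhom 0 k R (of_real (- a)) z) (at a)"
    unfolding U_inhom_eq W cis_conv_exp by (intro tendsto_intros u p m) auto
  then show ?thesis by simp
qed

theorem mainTheorem8:
  fixes a :: real and R :: nat and z :: complex
  assumes "a > 0"
    and "\<forall>N::int. even (N - int R) \<longrightarrow> a \<noteq> of_int N + 1/2"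
  shows "U_inhom02_neg R a z =
           1/2 * (U_inhom 0 1 R (- complex_of_real a) z + U_inhom 0 3 R (- complex_of_real a) z)
           + complex_of_real (lambda_coeff R a) * parabolic_cylinder_U (- complex_of_real a) z"
proof -
  let ?\<phi> = "\<lambda>b. pi * b / 2 + pi / 4 - pi * real R / 2"
  let ?rhs = "\<lambda>b. 1/2 * (U_inhom 0 1 R (- complex_of_real b) z + U_inhom 0 3 R (- complex_of_real b) z)
       + complex_of_real (- tan (?\<phi> b) * moment_comb R b) * U_sol 0 (- complex_of_real b) z"
  \<comment> \<open>The closed form enters only at a itself; the limit below is taken with
    \<open>moment_comb\<close>, whose continuity comes from that of the moments.\<close>
  have "moment_comb R a = moment_value R a" using assms(1) by (intro moment_comb_eq_moment_value) simp
  then have "lambda_coeff R a = - tan (?\<phi> a) * moment_comb R a"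
    unfolding lambda_coeff_def tan_sec_eq_tan(1)[OF assms(2)] by (simp add: moment_value_def)
  moreover have "parabolic_cylinder_U (- complex_of_real a) z = U_sol 0 (- complex_of_real a) z"
    by (simp add: U_sol_def)
  moreover have "U_inhom02_neg R a z = ?rhs a"
  proof (cases "removable_param R a")
    case False
    \<comment> \<open>A half-integer a is either removable, for N - R odd, or excluded, for N - R
      even.\<close>
    have "cos (pi * a) \<noteq> 0"
      using cos_eq_0_half_integer[of a] False assms(2) unfolding removable_param_def by blast
    then show ?thesis using False U_inhom_combination by (simp add: U_inhom02_neg_def)
  next
    case True
    then obtain N :: int where N: "a = of_int N + 1/2" by (auto simp: removable_param_def)
    have "((\<lambda>b. U_sol 0 (of_real (- b)) z) \<longlongrightarrow> U_sol 0 (of_real (- a)) z) (at a)"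
      using continuous_on_U_sol_param[of UNIV 0 z] by (simp add: continuous_on_def)
    then have u: "((\<lambda>b. U_sol 0 (- complex_of_real b) z) \<longlongrightarrow> U_sol 0 (- complex_of_real a) z) (at a)" by simp
    have M: "((\<lambda>b. pcf_M R (f b)) \<longlongrightarrow> pcf_M R (f a)) (at a)" if "(f \<longlongrightarrow> f a) (at a)" for f
      by (rule isCont_tendsto_compose[OF isCont_pcf_M that])
    have g: "((\<lambda>b. rGamma (1/2 + b)) \<longlongrightarrow> rGamma (1/2 + a)) (at a)"
    proof -
      have "continuous_on UNIV (\<lambda>b::real. rGamma (1/2 + b))"
        by (intro continuous_on_compose2[OF continuous_on_rGamma[of UNIV]] continuous_intros) auto
      then show ?thesis by (simp add: continuous_on_def)
    qed
    have mc: "(moment_comb R \<longlongrightarrow> moment_comb R a) (at a)"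
      unfolding moment_comb_def by (intro tendsto_intros g M) auto
    \<comment> \<open>The right-hand side is continuous at a because the tangent is. Half-integers
      are isolated, so near a the formula for nonzero cosine identifies both sides.\<close>
    have "(?rhs \<longlongrightarrow> ?rhs a) (at a)"
      by (intro tendsto_intros tendsto_U_inhom_param u mc tan_sec_eq_tan(2)[OF assms(2)]) auto
    moreover have "eventually (\<lambda>b. ?rhs b = U_inhom 0 2 R (- complex_of_real b) z) (at a)"
      using eventually_not_half_integer[OF N]
    proof eventually_elim
      case (elim b)
      then have "cos (pi * b) \<noteq> 0" using cos_eq_0_half_integer[of b] by blast
      then show ?case by (rule U_inhom_combination[symmetric])
    qed
    ultimately have "((\<lambda>b. U_inhom 0 2 R (- complex_of_real b) z) \<longlongrightarrow> ?rhs a) (at a)"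
      by (rule Lim_transform_eventually)
    then have "Lim (at a) (\<lambda>b. U_inhom 0 2 R (- complex_of_real b) z) = ?rhs a"
      by (intro tendsto_Lim) auto
    then show ?thesis using True by (simp add: U_inhom02_neg_def)
  qed
  ultimately show ?thesis by simp
qed

end
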